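(* As $n\to\infty$, $$g_{\mathrm{PCB}}(n,K_3)=(1+o(1))\,3n.$$
   Context: Planar Constructor-Blocker game: Constructor and Blocker alternately claim previously unclaimed edges of $K_n$, Constructor moving first. Constructor may only claim an edge if her graph (the edges she has claimed) remains planar (no fixed embedding is required; at every moment her graph must admit some crossing-free plane embedding); Blocker may claim any unclaimed edge. The game ends when Constructor cannot claim any more edges or all edges are claimed. The score is the number of triangles in Constructor's graph at the end; Constructor maximizes it, Blocker minimizes it. $g_{\mathrm{PCB}}(n,K_3)$ denotes the score under optimal play. *)

theory Defs
  imports "HOL-Analysis.Analysis" "HOL-Library.Landau_Symbols"
begin

definition Kn_edges :: "nat \<Rightarrow> nat set set" where
  "Kn_edges n = {{u, v} | u v. u < n \<and> v < n \<and> u \<noteq> v}"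

definition planar_graph :: "'a set \<Rightarrow> 'a set set \<Rightarrow> bool" where
  "planar_graph V E \<longleftrightarrow>
     (\<exists>(p :: 'a \<Rightarrow> complex) (\<gamma> :: 'a set \<Rightarrow> real \<Rightarrow> complex).
        inj_on p V \<and>
        (\<forall>e\<in>E. \<exists>u v. u \<in> V \<and> v \<in> V \<and> u \<noteq> v \<and> e = {u, v} \<and>
              arc (\<gamma> e) \<and> pathstart (\<gamma> e) = p u \<and> pathfinish (\<gamma> e) = p v \<and>
              (\<forall>w\<in>V. p w \<in> path_image (\<gamma> e) \<longrightarrow> w = u \<or> w = v)) \<and>
        (\<forall>e\<in>E. \<forall>e'\<in>E. e \<noteq> e' \<longrightarrow>
              path_image (\<gamma> e) \<inter> path_image (\<gamma> e') \<subseteq> p ` (e \<inter> e')))"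

definition triangles :: "nat set set \<Rightarrow> nat" where
  "triangles C = card {T :: nat set. card T = 3 \<and> (\<forall>x\<in>T. \<forall>y\<in>T. x \<noteq> y \<longrightarrow> {x, y} \<in> C)}"

definition constr_moves :: "nat \<Rightarrow> nat set set \<Rightarrow> nat set set \<Rightarrow> nat set set" where
  "constr_moves n C B = {e \<in> Kn_edges n - C - B. planar_graph {0..<n} (insert e C)}"

text \<open>Value of the game under optimal play, with fuel k (an upper bound on the number of
  remaining moves); the Boolean says whether Constructor is to move. The game ends when
  Constructor cannot claim an edge or all edges are claimed.\<close>
fun pcb_val :: "nat \<Rightarrow> nat \<Rightarrow> bool \<Rightarrow> nat set set \<Rightarrow> nat set set \<Rightarrow> nat" where
  "pcb_val n 0 t C B = triangles C"
| "pcb_val n (Suc k) True C B =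
     (if constr_moves n C B = {} then triangles C
      else Max ((\<lambda>e. pcb_val n k False (insert e C) B) ` constr_moves n C B))"
| "pcb_val n (Suc k) False C B =
     (if constr_moves n C B = {} \<or> Kn_edges n - C - B = {} then triangles C
      else Min ((\<lambda>e. pcb_val n k True C (insert e B)) ` (Kn_edges n - C - B)))"

definition g_PCB_K3 :: "nat \<Rightarrow> nat" where
  "g_PCB_K3 n = pcb_val n (card (Kn_edges n)) True {} {}"

end

theory Submission
  imports Defs
begin

text \<open>
  Upper bound: a planar graph on \<open>n\<close> vertices has at most \<open>3n\<close> triangles. Allow vertices to be drawn as
  disjoint compact path-connected blobs; the resulting class of graphs is trivially closed under
  contraction, and it does not contain \<open>K\<^sub>5\<close>: three paths joining two of the blobs through the other three
  form a theta graph, which by Janiszewski's theorem splits the plane into regions that each miss one of the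
  three paths, and two crossing chords cannot share a region. Mader's contraction argument then
  bounds the number of edges by \<open>3n - 6\<close>, and by \<open>2d - 3\<close> inside the neighbourhood of a vertex of degree
  \<open>d\<close>; summing the latter over all vertices counts every triangle three times.

  Lower bound: Constructor first builds a constant number \<open>M\<close> of disjoint gadgets, a hub joined to two
  paths \<open>a b c\<close> and \<open>d e f\<close>. As long as linearly many vertices are unused, some unused vertex \<open>w\<close> has fewer than \<open>M\<close>
  Blocker edges, hence a gadget without Blocker edges to \<open>w\<close>. Constructor joins \<open>w\<close> to its hub, then to the
  middle vertex of the path that Blocker did not spoil, then to one of the two ends of that path. This puts
  \<open>w\<close> inside an empty triangle, creates three new triangles and restores the gadget.
\<close>

section \<open>Arcs in the plane and the theta lemma\<close>

text \<open>With point vertices, contracting an edge would mean redrawing every curve near the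
  merged point; two blobs together with the curve between them simply form a new blob. The price is
  that curves may wander and cross inside blobs, so \<open>K_5\<close> has to be excluded in that
  generality. \<open>K_5\<close> alone suffices: by Mader, excluding it as a minor already gives at
  most 3n - 6 edges. With e edges, T triangles and all degrees at least 2, the two edge bounds
  combine to 3T + 3n \<le> 4e \<le> 4(3n - 6), so T \<le> 3n - 8.

  The number M of gadgets balances two losses. Both losses vanish relative to n when n tends to
  infinity first and M afterwards.\<close>

text \<open>Allowing a single point as an arc saves case distinctions when a path has to start on its target.\<close>

definition arcset :: "complex set \<Rightarrow> complex \<Rightarrow> complex \<Rightarrow> bool" where
  "arcset S p q \<longleftrightarrow> (p = q \<and> S = {p}) \<or>
     (\<exists>g. arc g \<and> pathstart g = p \<and> pathfinish g = q \<and> path_image g = S)"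

section \<open>Arcs: joining, splitting and trimming\<close>

lemma arcset_refl: "arcset {p} p p"
  by (simp add: arcset_def)

lemma arcset_ends: "arcset S p q \<Longrightarrow> p \<in> S \<and> q \<in> S"
  by (auto simp: arcset_def)

lemma arcset_sym: "arcset S p q \<Longrightarrow> arcset S q p"
  unfolding arcset_def by (metis arc_reversepath path_image_reversepath pathfinish_reversepath pathstart_reversepath)

lemma arcset_arc:
  assumes "arcset S p q" "p \<noteq> q"
  obtains g where "arc g" "pathstart g = p" "pathfinish g = q" "path_image g = S"
  using assms by (auto simp: arcset_def)

lemma arcset_compact: "arcset S p q \<Longrightarrow> compact S"
  by (auto simp: arcset_def compact_arc_image)

lemma arcset_closed: "arcset S p q \<Longrightarrow> closed S"
  by (simp add: arcset_compact compact_imp_closed)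

lemma arcset_connected: "arcset S p q \<Longrightarrow> connected S"
  by (auto simp: arcset_def connected_arc_image)

lemma arcset_same: "arcset S p p \<Longrightarrow> S = {p}"
  by (auto simp: arcset_def arc_distinct_ends)

lemma arcset_join:
  assumes "arcset S p q" "arcset T q r" "S \<inter> T = {q}"
  shows "arcset (S \<union> T) p r"
proof -
  consider "S = {p}" "p = q" | "T = {q}" "q = r" | "p \<noteq> q" "q \<noteq> r"
    using assms arcset_same by metis
  then show ?thesis
  proof cases
    case 1
    then show ?thesis using assms arcset_ends[OF assms(2)] by (simp add: insert_absorb)
  next
    case 2
    then show ?thesis using assms arcset_ends[OF assms(1)] by (simp add: insert_absorb)
  next
    case 3
    obtain g where g: "arc g" "pathstart g = p" "pathfinish g = q" "path_image g = S"
      using assms(1) 3(1) by (rule arcset_arc)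
    obtain h where h: "arc h" "pathstart h = q" "pathfinish h = r" "path_image h = T"
      using assms(2) 3(2) by (rule arcset_arc)
    have "arc (g +++ h)" using g h assms(3) by (simp add: arc_join)
    moreover have "path_image (g +++ h) = S \<union> T" using g h by (simp add: path_image_join)
    ultimately show ?thesis using g h unfolding arcset_def by (metis pathfinish_join pathstart_join)
  qed
qed

lemma arc_subpath_arcset:
  assumes "arc g" "0 \<le> s" "s \<le> t" "t \<le> 1"
  shows "arcset (g ` {s..t}) (g s) (g t)"
proof (cases "s = t")
  case False
  then have "arc (subpath s t g)" using assms by (auto intro!: arc_subpath_arc)
  moreover have "path_image (subpath s t g) = g ` {s..t}"
    using assms by (simp add: path_image_subpath)
  ultimately show ?thesis unfolding arcset_def by (metis pathstart_subpath pathfinish_subpath)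
qed (simp add: arcset_refl)

lemma arcset_split:
  assumes "arcset S p q" "z \<in> S"
  obtains S1 S2 where "arcset S1 p z" "arcset S2 z q" "S1 \<union> S2 = S" "S1 \<inter> S2 = {z}"
proof (cases "p = q")
  case True
  then have "S = {p}" "z = p" using assms arcset_same by auto
  then show ?thesis using True that[of "{p}" "{p}"] by (simp add: arcset_refl)
next
  case False
  obtain g where g: "arc g" "pathstart g = p" "pathfinish g = q" "path_image g = S"
    using assms(1) False by (rule arcset_arc)
  obtain t where t: "t \<in> {0..1}" "z = g t" using assms(2) g(4) by (auto simp: path_image_def)
  have 1: "arcset (g ` {0..t}) p z" using arc_subpath_arcset[OF g(1), of 0 t] t g by (auto simp: pathstart_def)
  have 2: "arcset (g ` {t..1}) z q" using arc_subpath_arcset[OF g(1), of t 1] t g by (auto simp: pathfinish_def)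
  have "{0..t} \<union> {t..1} = {0..1::real}" using t by auto
  then have 3: "g ` {0..t} \<union> g ` {t..1} = S" using g(4) by (metis image_Un path_image_def)
  have "inj_on g {0..1}" using g(1) by (simp add: arc_def)
  then have "g ` {0..t} \<inter> g ` {t..1} = g ` ({0..t} \<inter> {t..1})"
    by (intro inj_on_image_Int[symmetric, of g "{0..1}"]) (use t in auto)
  moreover have "{0..t} \<inter> {t..1} = {t}" using t by auto
  ultimately have 4: "g ` {0..t} \<inter> g ` {t..1} = {z}" using t by simp
  show ?thesis using that[OF 1 2 3 4] .
qed

text \<open>The parameters at which the arc lies in \<open>T\<close> form a compact set; the arc is
  cut at the least one. Trimming of this kind later reduces contacts between connections and blobs
  to single points.\<close>

lemma arcset_first_hit:
  assumes "arcset S p q" "closed T" "q \<in> T"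
  obtains S1 z where "arcset S1 p z" "S1 \<subseteq> S" "S1 \<inter> T = {z}"
proof (cases "p = q")
  case True
  then have "S = {p}" using assms arcset_same by auto
  then show ?thesis using True that[of "{p}" p] assms by (simp add: arcset_refl)
next
  case False
  obtain g where g: "arc g" "pathstart g = p" "pathfinish g = q" "path_image g = S"
    using assms(1) False by (rule arcset_arc)
  define K where "K = {0..1} \<inter> g -` T"
  have cg: "continuous_on {0..1} g" using g(1) by (simp add: arc_def path_def)
  have "closed K" unfolding K_def by (rule continuous_closed_preimage[OF cg _ assms(2)]) simp
  moreover have "bounded K" unfolding K_def by (rule bounded_subset[of "{0..1}"]) auto
  ultimately have "compact K" by (simp add: compact_eq_bounded_closed)
  moreover have "1 \<in> K" unfolding K_def using assms(3) g by (auto simp: pathfinish_def)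
  ultimately obtain t where t: "t \<in> K" "\<And>s. s \<in> K \<Longrightarrow> t \<le> s"
    using compact_attains_inf[of K] by blast
  have t01: "0 \<le> t" "t \<le> 1" "g t \<in> T" using t(1) by (auto simp: K_def)
  have "arcset (g ` {0..t}) p (g t)" using arc_subpath_arcset[OF g(1), of 0 t] t01 g by (auto simp: pathstart_def)
  moreover have "g ` {0..t} \<subseteq> S" using g(4) t01 by (auto simp: path_image_def)
  moreover have "g ` {0..t} \<inter> T = {g t}"
  proof -
    have "s = t" if "s \<in> {0..t}" "g s \<in> T" for s
      using that t(2)[of s] t01 by (auto simp: K_def)
    moreover have "t \<in> {0..t}" using t01 by simp
    ultimately show ?thesis using t01(3) by blast
  qed
  ultimately show ?thesis using that by blast
qed

lemma path_connected_arcset: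
  assumes "path_connected S" "p \<in> S" "q \<in> S"
  obtains T where "arcset T p q" "T \<subseteq> S"
proof (cases "p = q")
  case True
  then show ?thesis using that[of "{p}"] assms by (simp add: arcset_refl)
next
  case False
  then obtain g where "arc g" "path_image g \<subseteq> S" "pathstart g = p" "pathfinish g = q"
    using assms unfolding path_connected_arcwise by blast
  then show ?thesis using that[of "path_image g"] unfolding arcset_def by blast
qed

lemma path_connected_hit:
  assumes "path_connected S" "p \<in> S" "closed T" "S \<inter> T \<noteq> {}"
  obtains R z where "arcset R p z" "R \<subseteq> S" "R \<inter> T = {z}"
proof -
  obtain q where q: "q \<in> S" "q \<in> T" using assms by blast
  obtain Q where Q: "arcset Q p q" "Q \<subseteq> S" using path_connected_arcset[OF assms(1,2) q(1)] .
  obtain R z where "arcset R p z" "R \<subseteq> Q" "R \<inter> T = {z}"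
    using arcset_first_hit[OF Q(1) assms(3) q(2)] .
  then show ?thesis using that Q(2) by blast
qed

text \<open>Join \<open>p1\<close> to \<open>p2\<close> by an arc and walk from \<open>p3\<close>
  until this arc is hit; the point of contact is the centre \<open>u\<close>. Legs may shrink to a
  point, which covers coinciding feet and a foot on the arc.\<close>

lemma tripod:
  assumes "path_connected S" "p1 \<in> S" "p2 \<in> S" "p3 \<in> S"
  obtains u L1 L2 L3 where "arcset L1 u p1" "arcset L2 u p2" "arcset L3 u p3"
    "L1 \<subseteq> S" "L2 \<subseteq> S" "L3 \<subseteq> S" "L1 \<inter> L2 = {u}" "L1 \<inter> L3 = {u}" "L2 \<inter> L3 = {u}"
proof -
  obtain Q where Q: "arcset Q p1 p2" "Q \<subseteq> S" using path_connected_arcset[OF assms(1-3)] .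
  have "S \<inter> Q \<noteq> {}" using Q arcset_ends by blast
  then obtain R u where R: "arcset R p3 u" "R \<subseteq> S" "R \<inter> Q = {u}"
    using path_connected_hit[OF assms(1,4) arcset_closed[OF Q(1)]] by metis
  then have "u \<in> Q" by auto
  then obtain Q1 Q2 where "arcset Q1 p1 u" "arcset Q2 u p2" "Q1 \<union> Q2 = Q" "Q1 \<inter> Q2 = {u}"
    using arcset_split[OF Q(1)] by metis
  then show ?thesis using that[of Q1 u Q2 R] Q R arcset_sym arcset_ends by blast
qed

lemma arcset_endless:
  assumes "arcset S p q" "p \<noteq> q"
  shows "connected (S - {p, q})" "S - {p, q} \<noteq> {}" "closure (S - {p, q}) = S"
proof -
  obtain g where g: "arc g" "pathstart g = p" "pathfinish g = q" "path_image g = S"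
    using assms by (rule arcset_arc)
  have sp: "simple_path g" using g(1) arc_imp_simple_path by blast
  show c: "connected (S - {p, q})" using connected_simple_path_endless[OF sp] g by simp
  show ne: "S - {p, q} \<noteq> {}" using nonempty_simple_path_endless[OF sp] g by simp
  have im: "S - {p, q} = g ` {0<..<1}" using simple_path_endless[OF sp] g by simp
  have cg: "continuous_on {0..1} g" using g(1) by (simp add: arc_def path_def)
  have "g ` closure {0<..<1} \<subseteq> closure (g ` {0<..<1})"
    by (rule image_closure_subset) (use cg closure_subset[of "g ` {0<..<1}"] in auto)
  then have "S \<subseteq> closure (S - {p, q})" using im g(4) by (simp add: path_image_def)
  moreover have "closure (S - {p, q}) \<subseteq> S"
    using arcset_closed[OF assms(1)] by (simp add: closure_minimal)
  ultimately show "closure (S - {p, q}) = S" by blast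
qed

text \<open>Adding one point of the closure keeps \<open>W\<close> connected. This carries a set
  without its boundary points, such as an open arc or a face, to one of those points outside
  \<open>J\<close>.\<close>

lemma closure_connected_component:
  assumes "connected W" "W \<inter> J = {}" "closed J" "q \<in> closure W" "q \<notin> J" "w \<in> W"
  shows "connected_component (- J) w q"
proof -
  have "connected (insert q W)" 
    by (rule connected_intermediate_closure[OF assms(1)]) (use assms closure_subset in auto)
  then show ?thesis unfolding connected_component_def using assms
    by (intro exI[of _ "insert q W"]) auto
qed

section \<open>Jordan curves, theta graphs and the exclusion of \<open>K_5\<close>\<close>

lemma Jordan_arcsets:
  assumes "arcset P u v" "arcset Q u v" "u \<noteq> v" "P \<inter> Q = {u, v}"
  obtains I O' where "I \<noteq> {}" "connected I" "O' \<noteq> {}" "connected O'" "I \<inter> O' = {}"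
    "I \<union> O' = - (P \<union> Q)" "frontier I = P \<union> Q" "frontier O' = P \<union> Q" "open I" "open O'"
proof -
  obtain g where g: "arc g" "pathstart g = u" "pathfinish g = v" "path_image g = P"
    using assms(1,3) by (rule arcset_arc)
  obtain h where h: "arc h" "pathstart h = v" "pathfinish h = u" "path_image h = Q"
    using arcset_sym[OF assms(2)] assms(3) by (metis arcset_arc)
  have s: "simple_path (g +++ h)" using g h assms by (intro simple_path_join_loop) auto
  have l: "pathfinish (g +++ h) = pathstart (g +++ h)" using g h by simp
  have im: "path_image (g +++ h) = P \<union> Q" using g h by (simp add: path_image_join)
  from Jordan_inside_outside[OF s l, unfolded im] show ?thesis using that by metis
qed


text \<open>A Jordan curve has only two sides, so two points both cut off from \<open>z\<close> are
  together on the other one.\<close>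

lemma Jordan_same_side:
  assumes "arcset P u v" "arcset Q u v" "u \<noteq> v" "P \<inter> Q = {u, v}"
    and "x \<notin> P \<union> Q" "y \<notin> P \<union> Q" "z \<notin> P \<union> Q"
    and "\<not> connected_component (- (P \<union> Q)) x z" "\<not> connected_component (- (P \<union> Q)) y z"
  shows "connected_component (- (P \<union> Q)) x y"
proof -
  obtain I O' where IO: "I \<noteq> {}" "connected I" "O' \<noteq> {}" "connected O'" "I \<inter> O' = {}"
    "I \<union> O' = - (P \<union> Q)" "frontier I = P \<union> Q" "frontier O' = P \<union> Q"
    using Jordan_arcsets[OF assms(1-4)] by metis
  have "connected_component (- (P \<union> Q)) s t" if "s \<in> I \<and> t \<in> I \<or> s \<in> O' \<and> t \<in> O'" for s t
    using that IO unfolding connected_component_def by blast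
  then show ?thesis using assms(5-9) IO(6) by (metis ComplI UnE)
qed

text \<open>A face of a theta graph has only two of the three paths on its boundary. Suppose
  \<open>W\<close> sees all three. The side of \<open>P2 \<union> P3\<close> away from
  \<open>P1\<close> borders both \<open>P2\<close> and \<open>P3\<close>, hence \<open>W\<close>
  reaches it off \<open>P1 \<union> P2\<close> (through \<open>q3\<close>) and off
  \<open>P1 \<union> P3\<close> (through \<open>q2\<close>). Janiszewski's theorem merges these into
  a connection off the whole theta graph, so \<open>W\<close> lies on that side, whereas
  \<open>q1\<close> puts it on the opposite one.\<close>

lemma theta:
  assumes P: "arcset P1 u v" "arcset P2 u v" "arcset P3 u v" "u \<noteq> v"
    and I: "P1 \<inter> P2 = {u, v}" "P1 \<inter> P3 = {u, v}" "P2 \<inter> P3 = {u, v}"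
    and W: "connected W" "W \<inter> (P1 \<union> P2 \<union> P3) = {}"
  shows "(\<forall>w\<in>W. \<forall>q\<in>P3 - {u, v}. \<not> connected_component (- (P1 \<union> P2)) w q) \<or>
         (\<forall>w\<in>W. \<forall>q\<in>P2 - {u, v}. \<not> connected_component (- (P1 \<union> P3)) w q) \<or>
         (\<forall>w\<in>W. \<forall>q\<in>P1 - {u, v}. \<not> connected_component (- (P2 \<union> P3)) w q)"
proof (rule ccontr)
  assume "\<not> ?thesis"
  then have n: "\<exists>w\<in>W. \<exists>q\<in>P3 - {u, v}. connected_component (- (P1 \<union> P2)) w q"
    "\<exists>w\<in>W. \<exists>q\<in>P2 - {u, v}. connected_component (- (P1 \<union> P3)) w q"
    "\<exists>w\<in>W. \<exists>q\<in>P1 - {u, v}. connected_component (- (P2 \<union> P3)) w q"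
    by simp_all
  obtain w3 q3 where 3: "w3 \<in> W" "q3 \<in> P3 - {u, v}" "connected_component (- (P1 \<union> P2)) w3 q3"
    using n(1) by (elim bexE)
  obtain w2 q2 where 2: "w2 \<in> W" "q2 \<in> P2 - {u, v}" "connected_component (- (P1 \<union> P3)) w2 q2"
    using n(2) by (elim bexE)
  obtain w1 q1 where 1: "w1 \<in> W" "q1 \<in> P1 - {u, v}" "connected_component (- (P2 \<union> P3)) w1 q1"
    using n(3) by (elim bexE)
  note w = 1(1) 2(1) 3(1) and q = 1(2) 2(2) 3(2) and c = 3(3) 2(3) 1(3)
  have WW: "connected_component (- J) x y" if "J \<subseteq> P1 \<union> P2 \<union> P3" "x \<in> W" "y \<in> W" for J x y
    using that W unfolding connected_component_def by blast
  have c3: "connected_component (- (P1 \<union> P2)) w1 q3"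
    using c(1) WW[of "P1 \<union> P2" w1 w3] w connected_component_trans by blast
  have c2: "connected_component (- (P1 \<union> P3)) w1 q2"
    using c(2) WW[of "P1 \<union> P3" w1 w2] w connected_component_trans by blast
  obtain X Y where XY: "X \<noteq> {}" "connected X" "Y \<noteq> {}" "connected Y" "X \<inter> Y = {}"
    "X \<union> Y = - (P2 \<union> P3)" "frontier X = P2 \<union> P3" "frontier Y = P2 \<union> P3" "open X" "open Y"
    using Jordan_arcsets[OF P(2,3,4) I(3)] by metis
  have q1XY: "q1 \<in> X \<union> Y" using q I XY(6) by blast
  \<comment> \<open>\<open>O1\<close> is the side of the Jordan curve \<open>P2 \<union> P3\<close>
    that does not contain the inner part of \<open>P1\<close>.\<close>
  define O1 where "O1 = (if q1 \<in> X then Y else X)"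
  define O2 where "O2 = (if q1 \<in> X then X else Y)"
  have O: "O1 \<noteq> {}" "connected O1" "O1 \<inter> O2 = {}" "O1 \<union> O2 = - (P2 \<union> P3)" "frontier O1 = P2 \<union> P3"
     "open O1" "open O2" "q1 \<in> O2"
    using XY q1XY unfolding O1_def O2_def by auto
  obtain y where y: "y \<in> O1" using O by blast
  have P1O: "(P1 - {u, v}) \<inter> O1 = {}"
  proof (rule ccontr)
    assume "(P1 - {u, v}) \<inter> O1 \<noteq> {}"
    moreover have "(P1 - {u, v}) \<inter> O2 \<noteq> {}" using q(1) O by blast
    moreover have "P1 - {u, v} \<subseteq> O1 \<union> O2" using I O(4) by blast
    moreover have "connected (P1 - {u, v})" using arcset_endless[OF P(1) P(4)] by blast
    ultimately show False using O(3,6,7) unfolding connected_def by blast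
  qed
  have "u \<in> P2" "v \<in> P2" using I by auto
  then have P1O': "O1 \<inter> P1 = {}" using P1O O(4) by blast
  have clO: "P2 \<union> P3 \<subseteq> closure O1" using O(5) by (auto simp: frontier_def)
  have clos: "closed P1" "closed P2" "closed P3" using P arcset_closed by auto
  have OP: "O1 \<inter> (P1 \<union> P2) = {}" "O1 \<inter> (P1 \<union> P3) = {}" using O(4) P1O' by blast+
  have qn: "q3 \<notin> P1 \<union> P2" "q2 \<notin> P1 \<union> P3" using q I by blast+
  have qcl: "q3 \<in> closure O1" "q2 \<in> closure O1" using q clO by blast+
  have y3: "connected_component (- (P1 \<union> P2)) y q3"
    by (rule closure_connected_component[OF O(2) OP(1) closed_Un[OF clos(1,2)] qcl(1) qn(1) y])
  have y2: "connected_component (- (P1 \<union> P3)) y q2"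
    by (rule closure_connected_component[OF O(2) OP(2) closed_Un[OF clos(1,3)] qcl(2) qn(2) y])
  \<comment> \<open>The two closed sets meet in \<open>P1\<close>, which is connected: this is the
    hypothesis of Janiszewski's theorem.\<close>
  have "(P1 \<union> P2) \<inter> (P1 \<union> P3) = P1" using I by blast
  then have "connected ((P1 \<union> P2) \<inter> (P1 \<union> P3))" using arcset_connected[OF P(1)] by simp
  moreover have "connected_component (- (P1 \<union> P2)) w1 y"
    using c3 y3 connected_component_trans connected_component_sym by blast
  moreover have "connected_component (- (P1 \<union> P3)) w1 y"
    using c2 y2 connected_component_trans connected_component_sym by blast
  moreover have "compact (P1 \<union> P2)" using P arcset_compact by blast
  moreover have "closed (P1 \<union> P3)" using clos by blast
  ultimately have "connected_component (- ((P1 \<union> P2) \<union> (P1 \<union> P3))) w1 y"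
    using Janiszewski by blast
  then have "connected_component (- (P2 \<union> P3)) w1 y"
    by (rule connected_component_of_subset) auto
  then have "connected_component (- (P2 \<union> P3)) y q1"
    using c(3) connected_component_trans connected_component_sym by blast
  then obtain T where T: "connected T" "T \<subseteq> - (P2 \<union> P3)" "y \<in> T" "q1 \<in> T"
    unfolding connected_component_def by blast
  have "T \<inter> O1 \<noteq> {}" "T \<inter> O2 \<noteq> {}" "T \<subseteq> O1 \<union> O2" "O1 \<inter> O2 \<inter> T = {}"
    using T y O by auto
  then show False using T(1) O(6,7) unfolding connected_def by blast
qed

text \<open>Both chords lie on the side of \<open>P1 \<union> P2\<close> away from
  \<open>P3\<close>: \<open>N\<close> by assumption \<open>D\<close>, and \<open>K\<close> because
  it touches \<open>P1\<close> and \<open>P2\<close> and, by \<open>theta\<close>, cannot see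
  \<open>P3\<close> as well. Now \<open>K\<close> and the two halves of the curve
  \<open>P1 \<union> P2\<close> between \<open>c\<close> and \<open>d\<close> form a second theta
  graph. \<open>N\<close> touches both halves and is on the same side of the curve as
  \<open>K\<close>, so it sees all three paths, against \<open>theta\<close>.\<close>

lemma theta_crossing_chords:
  assumes P: "arcset P1 u v" "arcset P2 u v" "arcset P3 u v" "u \<noteq> v"
    and I: "P1 \<inter> P2 = {u, v}" "P1 \<inter> P3 = {u, v}" "P2 \<inter> P3 = {u, v}"
    and P1: "arcset P1a u c" "arcset P1b c v" "P1a \<inter> P1b = {c}" "P1a \<union> P1b = P1"
    and P2: "arcset P2a u d" "arcset P2b d v" "P2a \<inter> P2b = {d}" "P2a \<union> P2b = P2"
    and cd: "c \<notin> {u, v}" "d \<notin> {u, v}"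
    and K: "arcset K c d" "K \<inter> (P1 \<union> P2 \<union> P3) = {c, d}"
    and N: "arcset N s t" "s \<noteq> t" "N \<inter> (P1 \<union> P2 \<union> P3) = {s, t}" "N \<inter> K = {}"
    and s: "s \<in> P1 \<union> P2 \<Longrightarrow> s \<in> P1a \<union> P2a - {c, d}"
    and t: "t \<in> P1 \<union> P2 \<Longrightarrow> t \<in> P1b \<union> P2b - {c, d}"
    and D: "\<forall>w\<in>N - {s, t}. \<forall>q\<in>P3 - {u, v}. \<not> connected_component (- (P1 \<union> P2)) w q"
  shows False
proof -
  have cl: "closed P1" "closed P2" "closed P3" "closed K" using P K arcset_closed by auto
  have inP: "c \<in> P1" "d \<in> P2" "u \<in> P1a" "u \<in> P2a" "v \<in> P1b" "v \<in> P2b" "c \<in> P1a" "c \<in> P1b" "d \<in> P2a" "d \<in> P2b"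
    using P1 P2 arcset_ends by blast+
  have cdn: "c \<noteq> d" "c \<notin> P2 \<union> P3" "d \<notin> P1 \<union> P3" using inP cd I by blast+
  have up: "v \<notin> P1a" "u \<notin> P1b" "v \<notin> P2a" "u \<notin> P2b"
    using inP P1(3) P2(3) cd by (metis IntI insert_iff empty_iff)+
  note Ne = arcset_endless[OF N(1,2)]
  note Ke = arcset_endless[OF K(1) cdn(1)]
  obtain n where n: "n \<in> N - {s, t}" using Ne(2) by blast
  obtain k where k: "k \<in> K - {c, d}" using Ke(2) by blast
  obtain q where q: "q \<in> P3 - {u, v}" using arcset_endless(2)[OF P(3,4)] by blast
  have stN: "s \<in> N" "t \<in> N" using N arcset_ends by auto
  \<comment> \<open>An end of \<open>N\<close> on \<open>P3\<close> away from \<open>u\<close> and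
    \<open>v\<close> would connect \<open>N\<close> to \<open>P3\<close> off
    \<open>P1 \<union> P2\<close>, contrary to \<open>D\<close>.\<close>
  have stP: "s \<in> P1 \<union> P2" "t \<in> P1 \<union> P2"
  proof -
    have "x \<in> P1 \<union> P2" if x: "x \<in> {s, t}" for x
    proof (rule ccontr)
      assume nx: "x \<notin> P1 \<union> P2"
      then have x3: "x \<in> P3 - {u, v}" using N(3) x inP P1(4) P2(4) by blast
      have "connected_component (- (P1 \<union> P2)) n x"
        by (rule closure_connected_component[of "N - {s, t}"]) (use Ne(1,3) N(3) nx n x stN cl in auto)
      then show False using D n x3 by blast
    qed
    then show "s \<in> P1 \<union> P2" "t \<in> P1 \<union> P2" by auto
  qed
  have Kd: "\<forall>w\<in>K - {c, d}. \<forall>q\<in>P3 - {u, v}. \<not> connected_component (- (P1 \<union> P2)) w q"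
  proof -
    have cc: "connected_component (- J) k x"
      if "x \<in> {c, d}" "x \<notin> J" "J \<subseteq> P1 \<union> P2 \<union> P3" "closed J" for x J
      by (rule closure_connected_component[of "K - {c, d}"]) (use Ke K that k in auto)
    have KW: "(K - {c, d}) \<inter> (P1 \<union> P2 \<union> P3) = {}" using K(2) by blast
    have "connected_component (- (P1 \<union> P3)) k d" "connected_component (- (P2 \<union> P3)) k c"
      using cdn cl by (intro cc; auto)+
    moreover have "d \<in> P2 - {u, v}" "c \<in> P1 - {u, v}" using inP cd by auto
    ultimately show ?thesis using theta[OF P I Ke(1) KW] k by blast
  qed
  have nk: "connected_component (- (P1 \<union> P2)) n k"
  proof (rule Jordan_same_side[OF P(1,2,4) I(1), where z = q])
    show "\<not> connected_component (- (P1 \<union> P2)) n q" using D n q by blast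
    show "\<not> connected_component (- (P1 \<union> P2)) k q" using Kd k q by blast
    show "n \<notin> P1 \<union> P2" using n N by blast
    show "k \<notin> P1 \<union> P2" using k K by blast
    show "q \<notin> P1 \<union> P2" using q I by blast
  qed
  \<comment> \<open>The halves of the curve cut at \<open>c\<close> and \<open>d\<close>:
    \<open>Na\<close> passes through \<open>u\<close> and \<open>Nb\<close> through
    \<open>v\<close>.\<close>
  define Na where "Na = P1a \<union> P2a"
  define Nb where "Nb = P1b \<union> P2b"
  have sub: "P1a \<subseteq> P1" "P1b \<subseteq> P1" "P2a \<subseteq> P2" "P2b \<subseteq> P2" using P1(4) P2(4) by auto
  have sub2: "P1a \<inter> P2a \<subseteq> {u, v}" "P1b \<inter> P2b \<subseteq> {u, v}" "P1a \<inter> P2b \<subseteq> {u, v}" "P2a \<inter> P1b \<subseteq> {u, v}"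
    unfolding I(1)[symmetric] using sub by auto
  have "P1a \<inter> P2a = {u}" using sub2(1) inP(3,4) up(1) by auto
  then have Na: "arcset Na c d" unfolding Na_def
    using arcset_join[OF arcset_sym[OF P1(1)] P2(1)] by simp
  have "P1b \<inter> P2b = {v}" using sub2(2) inP(5,6) up(2) by auto
  then have Nb: "arcset Nb c d" unfolding Nb_def
    using arcset_join[OF P1(2) arcset_sym[OF P2(2)]] by simp
  have "P1a \<inter> P2b = {}" "P2a \<inter> P1b = {}" using sub2(3,4) up by auto
  then have NN: "Na \<inter> Nb = {c, d}" unfolding Na_def Nb_def using P1(3) P2(3) by blast
  have NU: "Na \<union> Nb = P1 \<union> P2" unfolding Na_def Nb_def using P1(4) P2(4) by blast
  have NaK: "Na \<inter> K = {c, d}" "Nb \<inter> K = {c, d}"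
    unfolding Na_def Nb_def using K(2) inP(7-10) sub by blast+
  have NW: "(N - {s, t}) \<inter> (Na \<union> Nb \<union> K) = {}" using NU N(3,4) by blast
  have cc: "connected_component (- J) n x" if "x \<in> {s, t}" "x \<notin> J" "J \<subseteq> Na \<union> Nb \<union> K" "closed J" for x J
    by (rule closure_connected_component[of "N - {s, t}"]) (use Ne NW n stN that in auto)
  have sN: "s \<in> Na - {c, d}" "t \<in> Nb - {c, d}" using s t stP unfolding Na_def Nb_def by auto
  have "s \<notin> Nb \<union> K" "t \<notin> Na \<union> K" using sN NN N(4) stN by auto
  then have "connected_component (- (Na \<union> K)) n t" "connected_component (- (Nb \<union> K)) n s"
    using Na Nb K(1) arcset_closed by (intro cc; auto)+
  moreover have "connected_component (- (Na \<union> Nb)) n k" using nk NU by simp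
  ultimately show False using theta[OF Na Nb K(1) cdn(1) NN NaK Ne(1) NW] n k sN by blast
qed

text \<open>The point \<open>g i j\<close> is where the edge \<open>ij\<close> enters the blob of
  \<open>i\<close>. Tripods in the blobs of \<open>a\<close> and \<open>b\<close>, continued through
  the blobs of \<open>c\<close>, \<open>d\<close>, \<open>e\<close>, give a theta graph from
  \<open>u\<close> to \<open>v\<close>. The edge \<open>ab\<close>, prolonged inside its blobs, is a
  chord \<open>N\<close> of it. By \<open>theta\<close> it misses one path \<open>P z\<close>; the
  edge between the two other middle blobs then gives a chord that has to cross
  \<open>N\<close>.\<close>

lemma no_K5_arcsets:
  fixes A :: "'a \<Rightarrow> complex set" and G :: "'a set \<Rightarrow> complex set" and g :: "'a \<Rightarrow> 'a \<Rightarrow> complex"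
  assumes V: "V = {a, b, c, d, e}" "distinct [a, b, c, d, e]"
    and pc: "\<And>i. i \<in> V \<Longrightarrow> path_connected (A i)"
    and dj: "\<And>i j. i \<in> V \<Longrightarrow> j \<in> V \<Longrightarrow> i \<noteq> j \<Longrightarrow> A i \<inter> A j = {}"
    and G: "\<And>i j. i \<in> V \<Longrightarrow> j \<in> V \<Longrightarrow> i \<noteq> j \<Longrightarrow> arcset (G {i, j}) (g i j) (g j i)"
    and GA: "\<And>i j. i \<in> V \<Longrightarrow> j \<in> V \<Longrightarrow> i \<noteq> j \<Longrightarrow> G {i, j} \<inter> A i = {g i j}"
    and GA': "\<And>i j k. i \<in> V \<Longrightarrow> j \<in> V \<Longrightarrow> k \<in> V \<Longrightarrow> i \<noteq> j \<Longrightarrow> k \<notin> {i, j} \<Longrightarrow> G {i, j} \<inter> A k = {}"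
    and GG: "\<And>i j k l. i \<in> V \<Longrightarrow> j \<in> V \<Longrightarrow> k \<in> V \<Longrightarrow> l \<in> V \<Longrightarrow> i \<noteq> j \<Longrightarrow> k \<noteq> l \<Longrightarrow>
           {i, j} \<noteq> {k, l} \<Longrightarrow> G {i, j} \<inter> G {k, l} \<subseteq> \<Union> (A ` ({i, j} \<inter> {k, l}))"
  shows False
proof -
  define X where "X = {c, d, e}"
  have XV: "x \<in> V" "x \<noteq> a" "x \<noteq> b" if "x \<in> X" for x using that V by (auto simp: X_def)
  have abV: "a \<in> V" "b \<in> V" "a \<noteq> b" using V by auto
  have gA: "g i j \<in> A i" if "i \<in> V" "j \<in> V" "i \<noteq> j" for i j using GA[OF that] by auto
  have tri: "\<exists>u L. (\<forall>x\<in>X. arcset (L x) u (g i x) \<and> L x \<subseteq> A i) \<and>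
      (\<forall>x\<in>X. \<forall>y\<in>X. x \<noteq> y \<longrightarrow> L x \<inter> L y = {u})" if i: "i \<in> {a, b}" for i
  proof -
    have iV: "i \<in> V" using i V by auto
    have gi: "g i c \<in> A i" "g i d \<in> A i" "g i e \<in> A i" using i V by (auto intro!: gA)
    obtain u L1 L2 L3 where L: "arcset L1 u (g i c)" "arcset L2 u (g i d)" "arcset L3 u (g i e)"
      "L1 \<subseteq> A i" "L2 \<subseteq> A i" "L3 \<subseteq> A i" "L1 \<inter> L2 = {u}" "L1 \<inter> L3 = {u}" "L2 \<inter> L3 = {u}"
      using tripod[OF pc[OF iV] gi] .
    show ?thesis
      by (rule exI[of _ u], rule exI[of _ "\<lambda>x. if x = c then L1 else if x = d then L2 else L3"])
        (use L V(2) in \<open>auto simp: X_def Int_commute\<close>)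
  qed
  obtain u L where L0: "(\<forall>x\<in>X. arcset (L x) u (g a x) \<and> L x \<subseteq> A a) \<and>
      (\<forall>x\<in>X. \<forall>y\<in>X. x \<noteq> y \<longrightarrow> L x \<inter> L y = {u})"
    using tri[of a] by auto
  have L: "\<And>x. x \<in> X \<Longrightarrow> arcset (L x) u (g a x)" "\<And>x. x \<in> X \<Longrightarrow> L x \<subseteq> A a"
    "\<And>x y. x \<in> X \<Longrightarrow> y \<in> X \<Longrightarrow> x \<noteq> y \<Longrightarrow> L x \<inter> L y = {u}" using L0 by auto
  obtain v R where R0: "(\<forall>x\<in>X. arcset (R x) v (g b x) \<and> R x \<subseteq> A b) \<and>
      (\<forall>x\<in>X. \<forall>y\<in>X. x \<noteq> y \<longrightarrow> R x \<inter> R y = {v})"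
    using tri[of b] by auto
  have R: "\<And>x. x \<in> X \<Longrightarrow> arcset (R x) v (g b x)" "\<And>x. x \<in> X \<Longrightarrow> R x \<subseteq> A b"
    "\<And>x y. x \<in> X \<Longrightarrow> y \<in> X \<Longrightarrow> x \<noteq> y \<Longrightarrow> R x \<inter> R y = {v}" using R0 by auto
  have "\<exists>M. arcset M (g x a) (g x b) \<and> M \<subseteq> A x" if x: "x \<in> X" for x
    using path_connected_arcset[OF pc[of x] gA[of x a] gA[of x b]] XV[OF x] abV by metis
  then obtain M where M: "\<And>x. x \<in> X \<Longrightarrow> arcset (M x) (g x a) (g x b)" "\<And>x. x \<in> X \<Longrightarrow> M x \<subseteq> A x"
    by metis
  have uv: "u \<in> A a" "v \<in> A b" "u \<noteq> v"
  proof -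
    have c: "c \<in> X" by (simp add: X_def)
    show "u \<in> A a" "v \<in> A b" using arcset_ends[OF L(1)[OF c]] arcset_ends[OF R(1)[OF c]] L(2)[OF c] R(2)[OF c] by auto
    then show "u \<noteq> v" using dj[OF abV] by auto
  qed
  have uvX: "u \<in> L x" "v \<in> R x" "g a x \<in> L x" "g b x \<in> R x" "g x a \<in> M x" "g x b \<in> M x" if "x \<in> X" for x
    using L(1)[OF that] R(1)[OF that] M(1)[OF that] arcset_ends by auto
  have dab: "A a \<inter> A b = {}" using dj[OF abV] .
  have dX: "A a \<inter> A x = {}" "A b \<inter> A x = {}" if "x \<in> X" for x
    using dj[of a x] dj[of b x] XV[OF that] abV by auto
  have dXX: "A x \<inter> A y = {}" if "x \<in> X" "y \<in> X" "x \<noteq> y" for x y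
    using dj[of x y] XV that by auto
  have Ga: "arcset (G {a, x}) (g a x) (g x a)" "arcset (G {b, x}) (g b x) (g x b)" 
    "G {a, x} \<inter> A a = {g a x}" "G {a, x} \<inter> A x = {g x a}" "G {a, x} \<inter> A b = {}"
    "G {b, x} \<inter> A b = {g b x}" "G {b, x} \<inter> A x = {g x b}" "G {b, x} \<inter> A a = {}"
    if "x \<in> X" for x
    using that XV[OF that] abV GA[of a x] GA[of x a] GA[of b x] GA[of x b] GA'[of a x b] GA'[of b x a]
      G[of a x] G[of b x]
    by (auto simp: insert_commute[of x])
  have Gay: "G {a, x} \<inter> A y = {}" "G {b, x} \<inter> A y = {}" if "x \<in> X" "y \<in> X" "x \<noteq> y" for x y
    using that XV abV by (intro GA'; auto)+
  have Gab: "G {a, x} \<inter> G {b, x} \<subseteq> A x" if "x \<in> X" for x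
    using GG[of a x b x] XV[OF that] abV by (auto simp: doubleton_eq_iff)
  have Gaa: "G {a, x} \<inter> G {a, y} \<subseteq> A a" "G {b, x} \<inter> G {b, y} \<subseteq> A b" "G {a, x} \<inter> G {b, y} = {}"
    if "x \<in> X" "y \<in> X" "x \<noteq> y" for x y
    using GG[of a x a y] GG[of b x b y] GG[of a x b y] XV[OF that(1)] XV[OF that(2)] that(3) abV
    by (auto simp: doubleton_eq_iff)
  define LG where "LG x = L x \<union> G {a, x}" for x
  define RG where "RG x = R x \<union> G {b, x}" for x
  have LG: "arcset (LG x) u (g x a)" "LG x \<inter> A x = {g x a}" "LG x \<inter> A b = {}" "LG x \<inter> A a = L x" if "x \<in> X" for x
  proof -
    have "L x \<inter> G {a, x} = {g a x}" using L(2)[OF that] uvX[OF that] Ga(3)[OF that] by blast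
    then show "arcset (LG x) u (g x a)" unfolding LG_def using arcset_join[OF L(1)[OF that] Ga(1)[OF that]] by simp
    have 0: "L x \<inter> A x = {}" "L x \<inter> A b = {}" "L x \<inter> A a = L x"
      using L(2)[OF that] dX[OF that] dab by auto
    show "LG x \<inter> A x = {g x a}" "LG x \<inter> A b = {}" "LG x \<inter> A a = L x"
      using uvX[OF that] by (simp_all add: LG_def Int_Un_distrib2 0 Ga[OF that] insert_absorb)
  qed
  have RG: "arcset (RG x) v (g x b)" "RG x \<inter> A x = {g x b}" "RG x \<inter> A a = {}" "RG x \<inter> A b = R x" if "x \<in> X" for x
  proof -
    have "R x \<inter> G {b, x} = {g b x}" using R(2)[OF that] uvX[OF that] Ga(6)[OF that] by blast
    then show "arcset (RG x) v (g x b)" unfolding RG_def using arcset_join[OF R(1)[OF that] Ga(2)[OF that]] by simp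
    have 0: "R x \<inter> A x = {}" "R x \<inter> A a = {}" "R x \<inter> A b = R x"
      using R(2)[OF that] dX[OF that] dab by auto
    show "RG x \<inter> A x = {g x b}" "RG x \<inter> A a = {}" "RG x \<inter> A b = R x"
      using uvX[OF that] by (simp_all add: RG_def Int_Un_distrib2 0 Ga[OF that] insert_absorb)
  qed
  have LRx: "LG x \<inter> RG x \<subseteq> A x" if "x \<in> X" for x
  proof -
    have "L x \<inter> R x = {}" "L x \<inter> G {b, x} = {}" "G {a, x} \<inter> R x = {}"
      using L(2)[OF that] R(2)[OF that] Ga(5,8)[OF that] dab by auto
    then show ?thesis using Gab[OF that] by (simp add: LG_def RG_def Int_Un_distrib Int_Un_distrib2)
  qed
  have LGA: "LG x \<inter> A y = {}" "RG x \<inter> A y = {}" if "x \<in> X" "y \<in> X" "x \<noteq> y" for x y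
    unfolding LG_def RG_def using L(2)[OF that(1)] R(2)[OF that(1)] Gay[OF that] dX[OF that(2)] by blast+
  have LL: "LG x \<inter> LG y = {u}" if xy: "x \<in> X" "y \<in> X" "x \<noteq> y" for x y
  proof -
    have "LG x \<inter> LG y \<subseteq> A a"
      unfolding LG_def using L(2)[OF xy(1)] L(2)[OF xy(2)] Gaa(1)[OF xy] by blast
    then have "LG x \<inter> LG y = (LG x \<inter> A a) \<inter> (LG y \<inter> A a)" by blast
    then show ?thesis using LG(4) L(3) xy by simp
  qed
  have RR: "RG x \<inter> RG y = {v}" if xy: "x \<in> X" "y \<in> X" "x \<noteq> y" for x y
  proof -
    have "RG x \<inter> RG y \<subseteq> A b"
      unfolding RG_def using R(2)[OF xy(1)] R(2)[OF xy(2)] Gaa(2)[OF xy] by blast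
    then have "RG x \<inter> RG y = (RG x \<inter> A b) \<inter> (RG y \<inter> A b)" by blast
    then show ?thesis using RG(4) R(3) xy by simp
  qed
  have LR: "LG x \<inter> RG y = {}" if xy: "x \<in> X" "y \<in> X" "x \<noteq> y" for x y
  proof -
    have "L x \<inter> R y = {}" "L x \<inter> G {b, y} = {}" "G {a, x} \<inter> R y = {}"
      using L(2)[OF xy(1)] R(2)[OF xy(2)] dab Ga(5)[OF xy(1)] Ga(8)[OF xy(2)] by auto
    then show ?thesis using Gaa(3)[OF xy] by (simp add: LG_def RG_def Int_Un_distrib Int_Un_distrib2)
  qed
  define P where "P x = LG x \<union> M x \<union> RG x" for x
  \<comment> \<open>Stated for an arbitrary cut point \<open>z\<close> of the middle arc: the
    trivial cut at \<open>g x a\<close> shows that \<open>P x\<close> is an arc, and the cut at the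
    foot of a chord yields the two pieces required by \<open>theta_crossing_chords\<close>.\<close>
  have halves: "arcset (LG x \<union> M1) u z \<and> arcset (M2 \<union> RG x) z v \<and> (LG x \<union> M1) \<inter> (M2 \<union> RG x) = {z}"
    if x: "x \<in> X" and S: "arcset M1 (g x a) z" "arcset M2 z (g x b)" "M1 \<union> M2 = M x" "M1 \<inter> M2 = {z}" for x z M1 M2
  proof -
    have sA: "M1 \<subseteq> A x" "M2 \<subseteq> A x" using M(2)[OF x] S(3) by auto
    have e: "g x a \<in> M1" "g x b \<in> M2" using S arcset_ends by auto
    have "LG x \<inter> M1 = {g x a}" using LG(2)[OF x] sA e by blast
    then have 1: "arcset (LG x \<union> M1) u z" using arcset_join[OF LG(1)[OF x] S(1)] by simp
    have "M2 \<inter> RG x = {g x b}" using RG(2)[OF x] sA e by blast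
    then have 2: "arcset (M2 \<union> RG x) z v" using arcset_join[OF S(2) arcset_sym[OF RG(1)[OF x]]] by simp
    have i1: "LG x \<inter> M2 \<subseteq> M1 \<inter> M2" 
    proof -
      have "LG x \<inter> M2 \<subseteq> LG x \<inter> A x" using sA(2) by auto
      then show ?thesis using LG(2)[OF x] e(1) by auto
    qed
    have i2: "M1 \<inter> RG x \<subseteq> M1 \<inter> M2" 
    proof -
      have "M1 \<inter> RG x \<subseteq> RG x \<inter> A x" using sA(1) by auto
      then show ?thesis using RG(2)[OF x] e(2) by auto
    qed
    have "LG x \<inter> RG x = (LG x \<inter> A x) \<inter> (RG x \<inter> A x)" using LRx[OF x] by blast
    then have i3: "LG x \<inter> RG x \<subseteq> M1 \<inter> M2" using LG(2)[OF x] RG(2)[OF x] e by auto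
    have "(LG x \<union> M1) \<inter> (M2 \<union> RG x) = M1 \<inter> M2" using i1 i2 i3 by blast
    then show ?thesis using 1 2 S(4) by simp
  qed
  have P: "arcset (P x) u v" if x: "x \<in> X" for x
  proof -
    obtain M1 M2 where S: "arcset M1 (g x a) (g x a)" "arcset M2 (g x a) (g x b)" "M1 \<union> M2 = M x" "M1 \<inter> M2 = {g x a}"
      using arcset_split[OF M(1)[OF x] uvX(5)[OF x]] .
    have h: "arcset (LG x \<union> M1) u (g x a)" "arcset (M2 \<union> RG x) (g x a) v" "(LG x \<union> M1) \<inter> (M2 \<union> RG x) = {g x a}"
      using halves[OF x S] by auto
    have "P x = (LG x \<union> M1) \<union> (M2 \<union> RG x)" unfolding P_def using S(3) by blast
    then show ?thesis using arcset_join[OF h] by simp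
  qed
  have PP: "P x \<inter> P y = {u, v}" if xy: "x \<in> X" "y \<in> X" "x \<noteq> y" for x y
  proof -
    have yx: "y \<in> X" "x \<in> X" "y \<noteq> x" using xy by auto
    have "LG x \<inter> M y = {}" "RG x \<inter> M y = {}" "M x \<inter> M y = {}" "M x \<inter> LG y = {}" "M x \<inter> RG y = {}"
      using LGA[OF xy] LGA[OF yx] M(2)[OF xy(1)] M(2)[OF xy(2)] dXX[OF xy] by auto
    moreover have "RG x \<inter> LG y = {}" using LR[OF yx] by auto
    ultimately have "P x \<inter> P y = (LG x \<inter> LG y) \<union> (RG x \<inter> RG y)"
      by (simp add: P_def Int_Un_distrib Int_Un_distrib2 LR[OF xy])
    then show ?thesis using LL[OF xy] RR[OF xy] by auto
  qed
  have PA: "P x \<inter> A x = M x" "P x \<inter> A a = L x" "P x \<inter> A b = R x" if x: "x \<in> X" for x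
  proof -
    have "M x \<inter> A x = M x" "M x \<inter> A a = {}" "M x \<inter> A b = {}" using M(2)[OF x] dX[OF x] by auto
    then show "P x \<inter> A x = M x" "P x \<inter> A a = L x" "P x \<inter> A b = R x"
      using uvX[OF x] by (simp_all add: P_def Int_Un_distrib2 LG(2-4)[OF x] RG(2-4)[OF x] insert_absorb)
  qed
  have PAy: "P x \<inter> A y = {}" if xy: "x \<in> X" "y \<in> X" "x \<noteq> y" for x y
  proof -
    have "M x \<inter> A y = {}" using M(2)[OF xy(1)] dXX[OF xy] by auto
    then show ?thesis by (simp add: P_def Int_Un_distrib2 LGA[OF xy])
  qed
  define \<Theta> where "\<Theta> = P c \<union> P d \<union> P e"
  have Th: "\<Theta> = (\<Union>x\<in>X. P x)" by (auto simp: \<Theta>_def X_def)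
  have ThA: "\<Theta> \<inter> A x = M x" if "x \<in> X" for x
    unfolding Th using PA(1)[OF that] PAy[OF _ that] that by blast
  define La where "La = (\<Union>x\<in>X. L x)"
  define Rb where "Rb = (\<Union>x\<in>X. R x)"
  have ThAa: "\<Theta> \<inter> A a = La" "\<Theta> \<inter> A b = Rb" unfolding Th La_def Rb_def using PA(2,3) by blast+
  have GabP: "G {a, b} \<inter> P x \<subseteq> A a \<union> A b" if "x \<in> X" for x
  proof -
    have "G {a, b} \<inter> G {a, x} \<subseteq> A a" "G {a, b} \<inter> G {b, x} \<subseteq> A b"
      using GG[of a b a x] GG[of a b b x] XV[OF that] abV by (auto simp: doubleton_eq_iff)
    moreover have "G {a, b} \<inter> A x = {}" using GA'[of a b x] XV[OF that] abV by auto
    ultimately show ?thesis unfolding P_def LG_def RG_def using L(2)[OF that] R(2)[OF that] M(2)[OF that] by blast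
  qed
  have gab: "arcset (G {a, b}) (g a b) (g b a)" "G {a, b} \<inter> A a = {g a b}" "G {a, b} \<inter> A b = {g b a}"
    using G[of a b] GA[of a b] GA[of b a] abV by (auto simp: insert_commute)
  \<comment> \<open>Inside its two blobs the edge \<open>ab\<close> is continued only until it first
    meets the tripods. The ends \<open>s\<close> and \<open>t\<close> may then lie on any leg,
    including the one that belongs to \<open>P z\<close>.\<close>
  have "closed La" "closed Rb" unfolding La_def Rb_def
    using arcset_closed[OF L(1)] arcset_closed[OF R(1)] by (auto simp: X_def)
  moreover have "A a \<inter> La \<noteq> {}" "A b \<inter> Rb \<noteq> {}"
    unfolding La_def Rb_def using L(2)[of c] R(2)[of c] uvX[of c] by (auto simp: X_def)
  ultimately obtain Ha s Hb t where Ha: "arcset Ha (g a b) s" "Ha \<subseteq> A a" "Ha \<inter> La = {s}"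
    and Hb: "arcset Hb (g b a) t" "Hb \<subseteq> A b" "Hb \<inter> Rb = {t}"
    using path_connected_hit[OF pc[OF abV(1)] gA[of a b]] path_connected_hit[OF pc[OF abV(2)] gA[of b a]] abV
    by metis
  have gH: "g a b \<in> Ha" "s \<in> Ha" "g b a \<in> Hb" "t \<in> Hb" using Ha Hb arcset_ends by auto
  define N where "N = Ha \<union> G {a, b} \<union> Hb"
  have "Ha \<inter> G {a, b} = {g a b}" using Ha(2) gab(2) gH by blast
  then have HG: "arcset (Ha \<union> G {a, b}) s (g b a)" using arcset_join[OF arcset_sym[OF Ha(1)] gab(1)] by simp
  have "(Ha \<union> G {a, b}) \<inter> Hb = {g b a}" using Ha(2) Hb(2) dab gab(3) gH by blast
  then have N: "arcset N s t" unfolding N_def using arcset_join[OF HG Hb(1)] by simp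
  have st: "s \<noteq> t" using gH Ha(2) Hb(2) dab by blast
  have NTh: "N \<inter> \<Theta> = {s, t}"
  proof -
    have "G {a, b} \<inter> \<Theta> \<subseteq> (Ha \<inter> \<Theta>) \<union> (Hb \<inter> \<Theta>)"
    proof
      fix z assume z: "z \<in> G {a, b} \<inter> \<Theta>"
      then have "z \<in> A a \<union> A b" using GabP unfolding Th by auto
      then have "z \<in> {g a b, g b a}" using z gab(2,3) by auto
      then show "z \<in> (Ha \<inter> \<Theta>) \<union> (Hb \<inter> \<Theta>)" using z gH by auto
    qed
    then have "N \<inter> \<Theta> = (Ha \<inter> \<Theta>) \<union> (Hb \<inter> \<Theta>)" unfolding N_def by blast
    moreover have "Ha \<inter> \<Theta> = Ha \<inter> La" "Hb \<inter> \<Theta> = Hb \<inter> Rb" using ThAa Ha(2) Hb(2) by blast+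
    ultimately show ?thesis using Ha(3) Hb(3) by auto
  qed
  have NA: "N \<inter> A x = {}" if "x \<in> X" for x
    unfolding N_def using Ha(2) Hb(2) dX[OF that] GA'[of a b x] abV XV[OF that] by blast
  have cross: False if xy: "x \<in> X" "y \<in> X" "z \<in> X" "x \<noteq> y" "x \<noteq> z" "y \<noteq> z" "P x \<union> P y \<union> P z = \<Theta>"
    and D: "\<forall>w\<in>N - {s, t}. \<forall>q\<in>P z - {u, v}. \<not> connected_component (- (P x \<union> P y)) w q" for x y z
  proof -
    have hit: "\<exists>H r. arcset H (g i j) r \<and> H \<subseteq> A i \<and> H \<inter> M i = {r}" if "i \<in> X" "j \<in> X" "i \<noteq> j" for i j
    proof -
      have "A i \<inter> M i \<noteq> {}" using M(2)[OF that(1)] uvX(5)[OF that(1)] by blast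
      then show ?thesis
        using path_connected_hit[OF pc[OF XV(1)[OF that(1)]] gA[OF XV(1)[OF that(1)] XV(1)[OF that(2)] that(3)]
          arcset_closed[OF M(1)[OF that(1)]]] by metis
    qed
    obtain H1 p where H1: "arcset H1 (g x y) p" "H1 \<subseteq> A x" "H1 \<inter> M x = {p}" using hit[of x y] xy by auto
    obtain H2 q where H2: "arcset H2 (g y x) q" "H2 \<subseteq> A y" "H2 \<inter> M y = {q}" using hit[of y x] xy by auto
    have gx: "arcset (G {x, y}) (g x y) (g y x)" "G {x, y} \<inter> A x = {g x y}" "G {x, y} \<inter> A y = {g y x}"
      using G[of x y] GA[of x y] GA[of y x] XV xy by (auto simp: insert_commute)
    have gh: "g x y \<in> H1" "p \<in> H1" "g y x \<in> H2" "q \<in> H2" using H1 H2 arcset_ends by auto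
    have dxy: "A x \<inter> A y = {}" using dXX xy by auto
    define K where "K = H1 \<union> G {x, y} \<union> H2"
    have "H1 \<inter> G {x, y} = {g x y}" using H1(2) gx(2) gh by blast
    then have HG: "arcset (H1 \<union> G {x, y}) p (g y x)" using arcset_join[OF arcset_sym[OF H1(1)] gx(1)] by simp
    have "(H1 \<union> G {x, y}) \<inter> H2 = {g y x}" using H1(2) H2(2) dxy gx(3) gh by blast
    then have K: "arcset K p q" unfolding K_def using arcset_join[OF HG H2(1)] by simp
    have GP: "G {x, y} \<inter> P w \<subseteq> A x \<union> A y" if w: "w \<in> X" for w
    proof -
      have "G {x, y} \<inter> G {a, w} \<subseteq> A x \<union> A y" "G {x, y} \<inter> G {b, w} \<subseteq> A x \<union> A y"
        using GG[of x y a w] GG[of x y b w] XV[OF w] XV[OF xy(1)] XV[OF xy(2)] abV xy(4)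
        by (auto simp: doubleton_eq_iff)
      moreover have "G {x, y} \<inter> A a = {}" "G {x, y} \<inter> A b = {}"
        using GA'[of x y a] GA'[of x y b] XV[OF xy(1)] XV[OF xy(2)] abV xy(4) by auto
      moreover have "G {x, y} \<inter> M w \<subseteq> A x \<union> A y"
        using GA'[of x y w] XV[OF xy(1)] XV[OF xy(2)] XV[OF w] M(2)[OF w] xy(4) by blast
      ultimately show ?thesis unfolding P_def LG_def RG_def using L(2)[OF w] R(2)[OF w] by blast
    qed
    have KTh: "K \<inter> \<Theta> = {p, q}"
    proof -
      have "G {x, y} \<inter> \<Theta> \<subseteq> (H1 \<inter> \<Theta>) \<union> (H2 \<inter> \<Theta>)"
      proof
        fix z assume z: "z \<in> G {x, y} \<inter> \<Theta>"
        then have "z \<in> A x \<union> A y" using GP unfolding Th by auto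
        then have "z \<in> {g x y, g y x}" using z gx(2,3) by auto
        then show "z \<in> (H1 \<inter> \<Theta>) \<union> (H2 \<inter> \<Theta>)" using z gh by auto
      qed
      then have "K \<inter> \<Theta> = (H1 \<inter> \<Theta>) \<union> (H2 \<inter> \<Theta>)" unfolding K_def by blast
      moreover have "H1 \<inter> \<Theta> = H1 \<inter> M x" "H2 \<inter> \<Theta> = H2 \<inter> M y" using ThA[OF xy(1)] ThA[OF xy(2)] H1(2) H2(2) by blast+
      ultimately show ?thesis using H1(3) H2(3) by auto
    qed
    have "G {a, b} \<inter> G {x, y} = {}" using GG[of a b x y] XV xy abV by (auto simp: doubleton_eq_iff)
    moreover have "G {x, y} \<inter> A a = {}" "G {x, y} \<inter> A b = {}"
      using GA'[of x y a] GA'[of x y b] XV[OF xy(1)] XV[OF xy(2)] abV xy(4) by auto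
    ultimately have NG: "N \<inter> G {x, y} = {}" unfolding N_def using Ha(2) Hb(2) by blast
    have NK: "N \<inter> K = {}" unfolding K_def using NG NA[OF xy(1)] NA[OF xy(2)] H1(2) H2(2) by blast
    have pM: "p \<in> M x" "q \<in> M y" using H1 H2 by auto
    obtain M1 M2 where S: "arcset M1 (g x a) p" "arcset M2 p (g x b)" "M1 \<union> M2 = M x" "M1 \<inter> M2 = {p}"
      using arcset_split[OF M(1)[OF xy(1)] pM(1)] .
    obtain M3 M4 where T: "arcset M3 (g y a) q" "arcset M4 q (g y b)" "M3 \<union> M4 = M y" "M3 \<inter> M4 = {q}"
      using arcset_split[OF M(1)[OF xy(2)] pM(2)] .
    have hx: "arcset (LG x \<union> M1) u p" "arcset (M2 \<union> RG x) p v" "(LG x \<union> M1) \<inter> (M2 \<union> RG x) = {p}"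
      using halves[OF xy(1) S] by auto
    have hy: "arcset (LG y \<union> M3) u q" "arcset (M4 \<union> RG y) q v" "(LG y \<union> M3) \<inter> (M4 \<union> RG y) = {q}"
      using halves[OF xy(2) T] by auto
    have pq: "p \<in> A x" "q \<in> A y" using pM M(2) xy by auto
    have pquv: "p \<notin> {u, v}" "q \<notin> {u, v}" using pq uv dX[OF xy(1)] dX[OF xy(2)] by auto
    have Px: "(LG x \<union> M1) \<union> (M2 \<union> RG x) = P x" "(LG y \<union> M3) \<union> (M4 \<union> RG y) = P y"
      unfolding P_def using S(3) T(3) by blast+
    \<comment> \<open>Since \<open>s\<close> is in the blob of \<open>a\<close> and \<open>t\<close>
      in the blob of \<open>b\<close>, the feet \<open>p\<close> and \<open>q\<close> of the second
      chord separate them on \<open>P x \<union> P y\<close>.\<close>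
    have sa: "s \<in> A a" "t \<in> A b" using gH Ha(2) Hb(2) by auto
    have sne: "s \<notin> {p, q}" "t \<notin> {p, q}" using sa pq dX[OF xy(1)] dX[OF xy(2)] by auto
    have nA: "(M2 \<union> RG x) \<inter> A a = {}" "(M4 \<union> RG y) \<inter> A a = {}" "(LG x \<union> M1) \<inter> A b = {}" "(LG y \<union> M3) \<inter> A b = {}"
    proof -
      have "M2 \<inter> A a = {}" "M1 \<inter> A b = {}" using S(3) M(2)[OF xy(1)] dX[OF xy(1)] by auto
      moreover have "M4 \<inter> A a = {}" "M3 \<inter> A b = {}" using T(3) M(2)[OF xy(2)] dX[OF xy(2)] by auto
      ultimately show "(M2 \<union> RG x) \<inter> A a = {}" "(M4 \<union> RG y) \<inter> A a = {}"
        "(LG x \<union> M1) \<inter> A b = {}" "(LG y \<union> M3) \<inter> A b = {}"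
        using RG(3)[OF xy(1)] RG(3)[OF xy(2)] LG(3)[OF xy(1)] LG(3)[OF xy(2)] by (simp_all add: Int_Un_distrib2)
    qed
    have s: "s \<in> P x \<union> P y \<Longrightarrow> s \<in> (LG x \<union> M1) \<union> (LG y \<union> M3) - {p, q}"
      using sne(1) sa(1) nA(1,2) unfolding Px[symmetric] by blast
    have t: "t \<in> P x \<union> P y \<Longrightarrow> t \<in> (M2 \<union> RG x) \<union> (M4 \<union> RG y) - {p, q}"
      using sne(2) sa(2) nA(3,4) unfolding Px[symmetric] by blast
    show False
      by (rule theta_crossing_chords[OF P[OF xy(1)] P[OF xy(2)] P[OF xy(3)] uv(3) PP[OF xy(1,2,4)] PP[OF xy(1,3,5)] PP[OF xy(2,3,6)]
        hx Px(1) hy Px(2) pquv K _ N st _ NK s t D]) (use xy(7) KTh NTh in auto)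
  qed
  have cX: "c \<in> X" "d \<in> X" "e \<in> X" "c \<noteq> d" "c \<noteq> e" "d \<noteq> e" using V by (auto simp: X_def)
  have "(N - {s, t}) \<inter> (P c \<union> P d \<union> P e) = {}" using NTh unfolding \<Theta>_def by blast
  note th = theta[OF P[OF cX(1)] P[OF cX(2)] P[OF cX(3)] uv(3) PP[OF cX(1,2,4)] PP[OF cX(1,3,5)] PP[OF cX(2,3,6)]
      arcset_endless(1)[OF N st] this]
  then show False
    apply (elim disjE)
    subgoal by (rule cross[of c d e]) (use cX in \<open>auto simp: \<Theta>_def\<close>)
    subgoal by (rule cross[of c e d]) (use cX in \<open>auto simp: \<Theta>_def\<close>)
    subgoal by (rule cross[of d e c]) (use cX in \<open>auto simp: \<Theta>_def\<close>)
    done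
qed

section \<open>Drawings with blobs for vertices\<close>

definition graph :: "'a set \<Rightarrow> 'a set set \<Rightarrow> bool" where
  "graph V E \<longleftrightarrow> finite V \<and> (\<forall>e\<in>E. e \<subseteq> V \<and> card e = 2)"

definition contract :: "'a \<Rightarrow> 'a \<Rightarrow> 'a set set \<Rightarrow> 'a set set" where
  "contract u v E = (\<lambda>e. (\<lambda>x. if x = v then u else x) ` e) ` (E - {{u, v}})"

text \<open>Curves are arbitrary paths: they may re-enter the blobs of their own ends, and two of
  them may cross inside the blob of a common vertex. Exactly these freedoms make the notion stable
  under contraction.\<close>

definition blob_drawing :: "'a set \<Rightarrow> 'a set set \<Rightarrow> ('a \<Rightarrow> complex set) \<Rightarrow> ('a set \<Rightarrow> real \<Rightarrow> complex) \<Rightarrow> bool" where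
  "blob_drawing V E A \<gamma> \<longleftrightarrow>
     (\<forall>v\<in>V. compact (A v) \<and> path_connected (A v)) \<and>
     (\<forall>u\<in>V. \<forall>v\<in>V. u \<noteq> v \<longrightarrow> A u \<inter> A v = {}) \<and>
     (\<forall>e\<in>E. path (\<gamma> e) \<and> (\<forall>w\<in>V - e. path_image (\<gamma> e) \<inter> A w = {}) \<and>
        (\<exists>u v. e = {u, v} \<and> pathstart (\<gamma> e) \<in> A u \<and> pathfinish (\<gamma> e) \<in> A v)) \<and>
     (\<forall>e\<in>E. \<forall>e'\<in>E. e \<noteq> e' \<longrightarrow> path_image (\<gamma> e) \<inter> path_image (\<gamma> e') \<subseteq> \<Union> (A ` (e \<inter> e')))"

definition blob_planar :: "'a set \<Rightarrow> 'a set set \<Rightarrow> bool" where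
  "blob_planar V E \<longleftrightarrow> graph V E \<and> (\<exists>A \<gamma>. blob_drawing V E A \<gamma>)"

section \<open>Subgraphs and contractions of blob drawings\<close>

lemma blob_drawingD:
  assumes "blob_drawing V E A \<gamma>"
  shows "v \<in> V \<Longrightarrow> compact (A v) \<and> path_connected (A v)"
    "u \<in> V \<Longrightarrow> v \<in> V \<Longrightarrow> u \<noteq> v \<Longrightarrow> A u \<inter> A v = {}"
    "e \<in> E \<Longrightarrow> path (\<gamma> e)"
    "e \<in> E \<Longrightarrow> w \<in> V - e \<Longrightarrow> path_image (\<gamma> e) \<inter> A w = {}"
    "e \<in> E \<Longrightarrow> \<exists>u v. e = {u, v} \<and> pathstart (\<gamma> e) \<in> A u \<and> pathfinish (\<gamma> e) \<in> A v"
    "e \<in> E \<Longrightarrow> e' \<in> E \<Longrightarrow> e \<noteq> e' \<Longrightarrow> path_image (\<gamma> e) \<inter> path_image (\<gamma> e') \<subseteq> \<Union> (A ` (e \<inter> e'))"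
proof -
  note d = assms[unfolded blob_drawing_def]
  note d1 = conjunct1[OF d] and d2 = conjunct1[OF conjunct2[OF d]]
    and d3 = conjunct1[OF conjunct2[OF conjunct2[OF d]]] and d4 = conjunct2[OF conjunct2[OF conjunct2[OF d]]]
  show "v \<in> V \<Longrightarrow> compact (A v) \<and> path_connected (A v)" by (rule bspec[OF d1])
  show "u \<in> V \<Longrightarrow> v \<in> V \<Longrightarrow> u \<noteq> v \<Longrightarrow> A u \<inter> A v = {}" by (rule d2[rule_format])
  show "e \<in> E \<Longrightarrow> path (\<gamma> e)" by (rule conjunct1[OF bspec[OF d3]])
  show "e \<in> E \<Longrightarrow> w \<in> V - e \<Longrightarrow> path_image (\<gamma> e) \<inter> A w = {}"
    by (rule bspec[OF conjunct1[OF conjunct2[OF bspec[OF d3]]]])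
  show "e \<in> E \<Longrightarrow> \<exists>u v. e = {u, v} \<and> pathstart (\<gamma> e) \<in> A u \<and> pathfinish (\<gamma> e) \<in> A v"
    by (rule conjunct2[OF conjunct2[OF bspec[OF d3]]])
  show "e \<in> E \<Longrightarrow> e' \<in> E \<Longrightarrow> e \<noteq> e' \<Longrightarrow> path_image (\<gamma> e) \<inter> path_image (\<gamma> e') \<subseteq> \<Union> (A ` (e \<inter> e'))"
    by (rule d4[rule_format])
qed

lemma graph_edgeE:
  assumes "graph V E" "e \<in> E"
  obtains u v where "e = {u, v}" "u \<noteq> v" "u \<in> V" "v \<in> V"
proof -
  have "card e = 2" "e \<subseteq> V" using assms by (auto simp: graph_def)
  then show ?thesis using that by (auto simp: card_2_iff)
qed

lemma planar_imp_blob_planar: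
  assumes "planar_graph V E" "finite V"
  shows "blob_planar V E"
proof -
  obtain p :: "'a \<Rightarrow> complex" and \<gamma> where inj: "inj_on p V" and
    e: "\<And>e. e \<in> E \<Longrightarrow> \<exists>u v. u \<in> V \<and> v \<in> V \<and> u \<noteq> v \<and> e = {u, v} \<and>
              arc (\<gamma> e) \<and> pathstart (\<gamma> e) = p u \<and> pathfinish (\<gamma> e) = p v \<and>
              (\<forall>w\<in>V. p w \<in> path_image (\<gamma> e) \<longrightarrow> w = u \<or> w = v)" and
    ee: "\<And>e e'. e \<in> E \<Longrightarrow> e' \<in> E \<Longrightarrow> e \<noteq> e' \<Longrightarrow> path_image (\<gamma> e) \<inter> path_image (\<gamma> e') \<subseteq> p ` (e \<inter> e')"
    using assms(1) unfolding planar_graph_def by metis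
  have g: "graph V E" unfolding graph_def using assms(2) e by fastforce
  define A where "A v = {p v}" for v
  have 1: "\<forall>v\<in>V. compact (A v) \<and> path_connected (A v)" by (simp add: A_def)
  have 2: "\<forall>u\<in>V. \<forall>v\<in>V. u \<noteq> v \<longrightarrow> A u \<inter> A v = {}" using inj by (auto simp: A_def inj_on_def)
  have 3: "\<forall>e\<in>E. path (\<gamma> e) \<and> (\<forall>w\<in>V - e. path_image (\<gamma> e) \<inter> A w = {}) \<and>
           (\<exists>u v. e = {u, v} \<and> pathstart (\<gamma> e) \<in> A u \<and> pathfinish (\<gamma> e) \<in> A v)"
  proof
    fix f assume "f \<in> E"
    then obtain u v where uv: "u \<in> V" "v \<in> V" "u \<noteq> v" "f = {u, v}"
              "arc (\<gamma> f)" "pathstart (\<gamma> f) = p u" "pathfinish (\<gamma> f) = p v"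
              "\<forall>w\<in>V. p w \<in> path_image (\<gamma> f) \<longrightarrow> w = u \<or> w = v" using e by metis
    then show "path (\<gamma> f) \<and> (\<forall>w\<in>V - f. path_image (\<gamma> f) \<inter> A w = {}) \<and>
           (\<exists>u v. f = {u, v} \<and> pathstart (\<gamma> f) \<in> A u \<and> pathfinish (\<gamma> f) \<in> A v)"
      by (auto simp: A_def arc_imp_path)
  qed
  have 4: "\<forall>e\<in>E. \<forall>e'\<in>E. e \<noteq> e' \<longrightarrow> path_image (\<gamma> e) \<inter> path_image (\<gamma> e') \<subseteq> \<Union> (A ` (e \<inter> e'))"
    using ee unfolding A_def by blast
  have "blob_drawing V E A \<gamma>" unfolding blob_drawing_def by (intro conjI 1 2 3 4)
  then show ?thesis unfolding blob_planar_def using g by blast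
qed

lemma blob_planar_subgraph:
  assumes "blob_planar V E" "V' \<subseteq> V" "E' \<subseteq> E" "\<And>e. e \<in> E' \<Longrightarrow> e \<subseteq> V'"
  shows "blob_planar V' E'"
proof -
  have "graph V E" using assms by (simp add: blob_planar_def)
  then have g: "graph V' E'" using assms(2-4) finite_subset[OF assms(2)] by (auto simp: graph_def)
  obtain A \<gamma> where "blob_drawing V E A \<gamma>" using assms(1) unfolding blob_planar_def by blast
  note A = blob_drawingD[OF this]
  have "blob_drawing V' E' A \<gamma>" unfolding blob_drawing_def
  proof (intro conjI ballI impI)
    fix e assume "e \<in> E'"
    then have e: "e \<in> E" using assms(3) by blast
    show "path (\<gamma> e)" by (rule A(3)[OF e])
    show "path_image (\<gamma> e) \<inter> A w = {}" if "w \<in> V' - e" for w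
      using A(4)[OF e, of w] that assms(2) by blast
    show "\<exists>u v. e = {u, v} \<and> pathstart (\<gamma> e) \<in> A u \<and> pathfinish (\<gamma> e) \<in> A v" by (rule A(5)[OF e])
    fix e' assume "e' \<in> E'" "e \<noteq> e'"
    then show "path_image (\<gamma> e) \<inter> path_image (\<gamma> e') \<subseteq> \<Union> (A ` (e \<inter> e'))" using A(6)[OF e, of e'] assms(3) by blast
  qed (use A(1,2) assms(2) in \<open>simp_all add: subset_iff\<close>)
  then show ?thesis unfolding blob_planar_def using g by blast
qed

lemma graph_contract:
  assumes "graph V E" "{u, v} \<in> E" "u \<noteq> v"
  shows "graph (V - {v}) (contract u v E)"
  unfolding graph_def
proof (intro conjI ballI)
  show "finite (V - {v})" using assms by (simp add: graph_def)
  have uV: "u \<in> V" using assms by (auto simp: graph_def)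
  fix e assume "e \<in> contract u v E"
  then obtain f where f: "f \<in> E" "f \<noteq> {u, v}" "e = (\<lambda>x. if x = v then u else x) ` f"
    by (auto simp: contract_def)
  obtain x y where xy: "f = {x, y}" "x \<noteq> y" "x \<in> V" "y \<in> V" using graph_edgeE[OF assms(1) f(1)] .
  show "e \<subseteq> V - {v}" using f xy uV assms by auto
  have "e = {if x = v then u else x, if y = v then u else y}" using f(3) xy(1) by simp
  moreover have "(if x = v then u else x) \<noteq> (if y = v then u else y)" using f(2) xy(1,2) by (auto split: if_splits)
  ultimately show "card e = 2" by simp
qed

text \<open>The merged vertex receives the blob \<open>A u \<union> J \<union> A v\<close>, where
  \<open>J\<close> is the curve of the contracted edge; all other blobs and curves stay. A curve
  that crossed \<open>J\<close> did so inside the blob of \<open>u\<close> or \<open>v\<close>,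
  which is now part of the new blob.\<close>

lemma blob_planar_contract:
  assumes "blob_planar V E" "{u, v} \<in> E" "u \<noteq> v"
  shows "blob_planar (V - {v}) (contract u v E)"
proof -
  define \<phi> where "\<phi> x = (if x = v then u else x)" for x
  have g: "graph V E" using assms by (simp add: blob_planar_def)
  obtain A \<gamma> where "blob_drawing V E A \<gamma>" using assms(1) unfolding blob_planar_def by blast
  note A = blob_drawingD[OF this]
  have uv: "u \<in> V" "v \<in> V" using g assms(2) by (auto simp: graph_def)
  define J where "J = path_image (\<gamma> {u, v})"
  define A' where "A' x = (if x = u then A u \<union> J \<union> A v else A x)" for x
  have J: "compact J" "path_connected J" unfolding J_def
    using A(3)[OF assms(2)] by (auto simp: compact_path_image path_connected_path_image)
  have Ju: "J \<inter> A u \<noteq> {}" "J \<inter> A v \<noteq> {}"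
  proof -
    obtain x y where xy: "{u, v} = {x, y}" "pathstart (\<gamma> {u, v}) \<in> A x" "pathfinish (\<gamma> {u, v}) \<in> A y"
      using A(5)[OF assms(2)] by blast
    have "J \<inter> A x \<noteq> {}" "J \<inter> A y \<noteq> {}"
      using xy pathstart_in_path_image[of "\<gamma> {u, v}"] pathfinish_in_path_image[of "\<gamma> {u, v}"] unfolding J_def by blast+
    then show "J \<inter> A u \<noteq> {}" "J \<inter> A v \<noteq> {}" using xy(1) by (auto simp: doubleton_eq_iff)
  qed
  have Au: "compact (A u)" "path_connected (A u)" "compact (A v)" "path_connected (A v)"
    using A(1)[OF uv(1)] A(1)[OF uv(2)] by simp_all
  have "A u \<inter> J \<noteq> {}" using Ju(1) by (simp add: Int_commute)
  then have pcJ: "path_connected (A u \<union> J)" by (rule path_connected_Un[OF Au(2) J(2)])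
  have "(A u \<union> J) \<inter> A v \<noteq> {}" using Ju(2) by (simp add: Int_Un_distrib2)
  then have pcu: "path_connected (A u \<union> J \<union> A v)" by (rule path_connected_Un[OF pcJ Au(4)])
  have 1: "\<forall>x\<in>V - {v}. compact (A' x) \<and> path_connected (A' x)"
  proof
    fix x assume "x \<in> V - {v}"
    then show "compact (A' x) \<and> path_connected (A' x)"
      using A(1)[of x] pcu compact_Un[OF compact_Un[OF Au(1) J(1)] Au(3)] by (simp add: A'_def)
  qed
  have Jw: "J \<inter> A w = {}" if "w \<in> V" "w \<noteq> u" "w \<noteq> v" for w
    using A(4)[OF assms(2), of w] that by (auto simp: J_def)
  have disj: "A' u \<inter> A x = {}" if "x \<in> V" "x \<noteq> u" "x \<noteq> v" for x
    using A(2)[of u x] A(2)[of v x] uv Jw[OF that] that by (auto simp: A'_def)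
  have 2: "\<forall>x\<in>V - {v}. \<forall>y\<in>V - {v}. x \<noteq> y \<longrightarrow> A' x \<inter> A' y = {}"
  proof (intro ballI impI)
    fix x y assume xy: "x \<in> V - {v}" "y \<in> V - {v}" "x \<noteq> y"
    show "A' x \<inter> A' y = {}"
    proof (cases "x = u \<or> y = u")
      case True
      then show ?thesis using disj[of x] disj[of y] xy by (auto simp: A'_def)
    next
      case False
      then show ?thesis using A(2)[of x y] xy by (simp add: A'_def)
    qed
  qed
  \<comment> \<open>Edges from \<open>u\<close> and from \<open>v\<close> to a common neighbour
    become parallel; \<open>\<psi>\<close> keeps one original curve for each edge of the contracted
    graph.\<close>
  define \<psi> where "\<psi> e = (SOME f. f \<in> E - {{u, v}} \<and> \<phi> ` f = e)" for e
  have ct: "contract u v E = (\<lambda>e. \<phi> ` e) ` (E - {{u, v}})"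
    unfolding contract_def \<phi>_def by (rule refl)
  have psi: "\<psi> e \<in> E" "\<psi> e \<noteq> {u, v}" "\<phi> ` \<psi> e = e" if "e \<in> contract u v E" for e
  proof -
    have "\<exists>f. f \<in> E - {{u, v}} \<and> \<phi> ` f = e" using that unfolding ct by blast
    then have "\<psi> e \<in> E - {{u, v}} \<and> \<phi> ` \<psi> e = e" unfolding \<psi>_def by (rule someI_ex)
    then show "\<psi> e \<in> E" "\<psi> e \<noteq> {u, v}" "\<phi> ` \<psi> e = e" by auto
  qed
  have AA: "A x \<subseteq> A' (\<phi> x)" for x by (auto simp: A'_def \<phi>_def)
  have 3: "path (\<gamma> (\<psi> e)) \<and> (\<forall>w\<in>(V - {v}) - e. path_image (\<gamma> (\<psi> e)) \<inter> A' w = {}) \<and>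
           (\<exists>x y. e = {x, y} \<and> pathstart (\<gamma> (\<psi> e)) \<in> A' x \<and> pathfinish (\<gamma> (\<psi> e)) \<in> A' y)"
    if e: "e \<in> contract u v E" for e
  proof (intro conjI ballI)
    note p = psi[OF e]
    show "path (\<gamma> (\<psi> e))" using A(3) p by blast
    obtain x y where xy: "\<psi> e = {x, y}" "pathstart (\<gamma> (\<psi> e)) \<in> A x" "pathfinish (\<gamma> (\<psi> e)) \<in> A y"
      using A(5)[OF p(1)] by blast
    have "e = {\<phi> x, \<phi> y}" using p(3) xy(1) by auto
    then show "\<exists>x y. e = {x, y} \<and> pathstart (\<gamma> (\<psi> e)) \<in> A' x \<and> pathfinish (\<gamma> (\<psi> e)) \<in> A' y"
      using xy AA by blast
    fix w assume w: "w \<in> (V - {v}) - e"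
    show "path_image (\<gamma> (\<psi> e)) \<inter> A' w = {}"
    proof (cases "w = u")
      \<comment> \<open>The edge has no vertex in common with \<open>{u, v}\<close>, so the
        permitted crossings with \<open>J\<close> form an empty set.\<close>
      case True
      then have nuv: "u \<notin> \<psi> e" "v \<notin> \<psi> e" using w p(3) by (force simp: \<phi>_def)+
      then have "path_image (\<gamma> (\<psi> e)) \<inter> J \<subseteq> {}"
        using A(6)[OF p(1) assms(2) p(2)] unfolding J_def by auto
      moreover have "path_image (\<gamma> (\<psi> e)) \<inter> A u = {}" "path_image (\<gamma> (\<psi> e)) \<inter> A v = {}"
        using A(4)[OF p(1)] uv nuv by auto
      ultimately show ?thesis using True by (auto simp: A'_def)
    next
      case False
      then have "w \<notin> \<psi> e" using w p(3) by (force simp: \<phi>_def)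
      then show ?thesis using A(4)[OF p(1), of w] w False by (simp add: A'_def)
    qed
  qed
  have 4: "path_image (\<gamma> (\<psi> e)) \<inter> path_image (\<gamma> (\<psi> e')) \<subseteq> \<Union> (A' ` (e \<inter> e'))"
    if e: "e \<in> contract u v E" "e' \<in> contract u v E" "e \<noteq> e'" for e e'
  proof -
    have "\<psi> e \<noteq> \<psi> e'" using psi(3)[OF e(1)] psi(3)[OF e(2)] e(3) by metis
    then have "path_image (\<gamma> (\<psi> e)) \<inter> path_image (\<gamma> (\<psi> e')) \<subseteq> \<Union> (A ` (\<psi> e \<inter> \<psi> e'))"
      using A(6) psi e by blast
    also have "\<dots> \<subseteq> \<Union> (A' ` (e \<inter> e'))"
    proof
      fix z assume "z \<in> \<Union> (A ` (\<psi> e \<inter> \<psi> e'))"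
      then obtain x where x: "x \<in> \<psi> e" "x \<in> \<psi> e'" "z \<in> A x" by blast
      then have "\<phi> x \<in> e" "\<phi> x \<in> e'" using psi(3)[OF e(1)] psi(3)[OF e(2)] by blast+
      then show "z \<in> \<Union> (A' ` (e \<inter> e'))" using AA x(3) by blast
    qed
    finally show ?thesis .
  qed
  have "blob_drawing (V - {v}) (contract u v E) A' (\<lambda>e. \<gamma> (\<psi> e))"
    unfolding blob_drawing_def using 1 2 3 4 by simp
  then show ?thesis unfolding blob_planar_def using graph_contract[OF g assms(2,3)] by blast
qed

text \<open>Reduces to \<open>no_K5_arcsets\<close>: every curve contains an arc between its two
  blobs, which can be trimmed until it meets each of them in one point.\<close>

lemma blob_planar_no_K5:
  assumes "card V = 5"
  shows "\<not> blob_planar V {e. e \<subseteq> V \<and> card e = 2}"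
proof
  assume g: "blob_planar V {e. e \<subseteq> V \<and> card e = 2}"
  define E where "E = {e. e \<subseteq> V \<and> card e = 2}"
  have ijE: "{i, j} \<in> E" if "i \<in> V" "j \<in> V" "i \<noteq> j" for i j using that by (auto simp: E_def)
  obtain A \<gamma> where "blob_drawing V E A \<gamma>" using g unfolding blob_planar_def E_def[symmetric] by blast
  note A = blob_drawingD[OF this]
  define Q where "Q e \<Gamma> \<longleftrightarrow> \<Gamma> \<subseteq> path_image (\<gamma> e) \<and>
      (\<exists>x y p q. e = {x, y} \<and> x \<noteq> y \<and> arcset \<Gamma> p q \<and> \<Gamma> \<inter> A x = {p} \<and> \<Gamma> \<inter> A y = {q})" for e \<Gamma>
  have "\<exists>\<Gamma>. Q e \<Gamma>" if e: "e \<in> E" for e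
  proof -
    obtain x y where xy: "e = {x, y}" "pathstart (\<gamma> e) \<in> A x" "pathfinish (\<gamma> e) \<in> A y" using A(5)[OF e] by blast
    have "card e = 2" "e \<subseteq> V" using e by (auto simp: E_def)
    then have xyV: "x \<noteq> y" "x \<in> V" "y \<in> V" using xy(1) by (auto simp: card_insert_if split: if_splits)
    obtain T where T: "arcset T (pathstart (\<gamma> e)) (pathfinish (\<gamma> e))" "T \<subseteq> path_image (\<gamma> e)"
      using path_connected_arcset[OF path_connected_path_image[OF A(3)[OF e]] pathstart_in_path_image pathfinish_in_path_image] .
    have cl: "closed (A x)" "closed (A y)" using A(1) xyV compact_imp_closed by auto
    obtain S1 q where S1: "arcset S1 (pathstart (\<gamma> e)) q" "S1 \<subseteq> T" "S1 \<inter> A y = {q}"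
      using arcset_first_hit[OF T(1) cl(2) xy(3)] .
    \<comment> \<open>Trimming backwards from \<open>q\<close> keeps \<open>q\<close>, so the
      contact with \<open>A y\<close> remains a single point while the one with \<open>A x\<close>
      becomes one.\<close>
    obtain S2 p where S2: "arcset S2 q p" "S2 \<subseteq> S1" "S2 \<inter> A x = {p}"
      using arcset_first_hit[OF arcset_sym[OF S1(1)] cl(1) xy(2)] .
    have "q \<in> S2" using S2 arcset_ends by blast
    then have "S2 \<inter> A y = {q}" using S1(3) S2(2) by auto
    moreover have "S2 \<subseteq> path_image (\<gamma> e)" using S1(2) S2(2) T(2) by simp
    ultimately have "Q e S2" unfolding Q_def
      by (intro conjI exI[of _ x] exI[of _ y] exI[of _ p] exI[of _ q]) (use xy(1) xyV(1) S2(3) arcset_sym[OF S2(1)] in simp_all)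
    then show ?thesis by blast
  qed
  then obtain G where "\<forall>e\<in>E. Q e (G e)" using bchoice[of E Q] by blast
  then have GQ: "Q e (G e)" if "e \<in> E" for e using that by (rule bspec)
  have G1: "G e \<subseteq> path_image (\<gamma> e)" if "e \<in> E" for e
    using GQ[OF that] unfolding Q_def by (elim conjE)
  have G2: "\<exists>x y p q. e = {x, y} \<and> x \<noteq> y \<and> arcset (G e) p q \<and> G e \<inter> A x = {p} \<and> G e \<inter> A y = {q}" if "e \<in> E" for e
    using GQ[OF that] unfolding Q_def by (elim conjE)
  define g where "g i j = the_elem (G {i, j} \<inter> A i)" for i j
  have gij: "arcset (G {i, j}) (g i j) (g j i) \<and> G {i, j} \<inter> A i = {g i j}" if ij: "i \<in> V" "j \<in> V" "i \<noteq> j" for i j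
  proof -
    obtain x y p q where h: "{i, j} = {x, y}" "x \<noteq> y" "arcset (G {i, j}) p q" "G {i, j} \<inter> A x = {p}" "G {i, j} \<inter> A y = {q}"
      using G2[OF ijE[OF ij]] by blast
    have "(i = x \<and> j = y) \<or> (i = y \<and> j = x)" using h(1) by (auto simp: doubleton_eq_iff)
    then have "(G {i, j} \<inter> A i = {p} \<and> G {i, j} \<inter> A j = {q}) \<or> (G {i, j} \<inter> A i = {q} \<and> G {i, j} \<inter> A j = {p})"
      using h(4,5) by metis
    moreover have "g i j = the_elem (G {i, j} \<inter> A i)" "g j i = the_elem (G {i, j} \<inter> A j)"
      by (simp_all add: g_def insert_commute)
    ultimately show ?thesis using h(3) arcset_sym[OF h(3)] by auto
  qed
  have fV: "finite V" using assms card.infinite by fastforce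
  obtain xs where xs: "set xs = V" "distinct xs" using finite_distinct_list[OF fV] by blast
  then have "length xs = 5" using assms distinct_card by metis
  then obtain a b c d e where abc: "xs = [a, b, c, d, e]" by (auto simp: numeral_eq_Suc length_Suc_conv)
  have V: "V = {a, b, c, d, e}" using xs(1) unfolding abc by simp
  have V': "distinct [a, b, c, d, e]" using xs(2) unfolding abc .
  show False
  proof (rule no_K5_arcsets[OF V V', of A G g])
    fix i j k l
    show "path_connected (A i)" if "i \<in> V" using A(1) that by blast
    assume V: "i \<in> V" "j \<in> V"
    show "i \<noteq> j \<Longrightarrow> A i \<inter> A j = {}" using A(2) V by blast
    show "i \<noteq> j \<Longrightarrow> arcset (G {i, j}) (g i j) (g j i)" using gij V by blast
    show "i \<noteq> j \<Longrightarrow> G {i, j} \<inter> A i = {g i j}" using gij V by blast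
    assume k: "k \<in> V"
    show "i \<noteq> j \<Longrightarrow> k \<notin> {i, j} \<Longrightarrow> G {i, j} \<inter> A k = {}" using A(4)[OF ijE[of i j], of k] V k G1[OF ijE[of i j]] by blast
    assume l: "l \<in> V" "i \<noteq> j" "k \<noteq> l" "{i, j} \<noteq> {k, l}"
    show "G {i, j} \<inter> G {k, l} \<subseteq> \<Union> (A ` ({i, j} \<inter> {k, l}))"
      using A(6)[OF ijE[OF V l(2)] ijE[OF k l(1) l(3)] l(4)] G1[OF ijE[OF V l(2)]] G1[OF ijE[OF k l(1) l(3)]] by fast
  qed
qed

section \<open>Edges and triangles in minor-closed classes without a complete graph\<close>

lemma graph_finite_edges: "graph V E \<Longrightarrow> finite E"
  unfolding graph_def by (metis Pow_iff finite_Pow_iff finite_subset subsetI)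

lemma graph_subset: "graph V E \<Longrightarrow> E' \<subseteq> E \<Longrightarrow> graph V E'"
  unfolding graph_def by blast

section \<open>Degrees, neighbourhoods and the cost of a contraction\<close>

definition degree :: "'a set set \<Rightarrow> 'a \<Rightarrow> nat" where
  "degree E v = card {e \<in> E. v \<in> e}"

definition nbrs :: "'a set set \<Rightarrow> 'a \<Rightarrow> 'a set" where
  "nbrs E v = {w. {v, w} \<in> E}"

lemma sum_degree:
  assumes "finite E" "finite S"
  shows "(\<Sum>v\<in>S. degree E v) = (\<Sum>e\<in>E. card (e \<inter> S))"
proof -
  have "(\<Sum>v\<in>S. degree E v) = (\<Sum>v\<in>S. \<Sum>e\<in>E. if v \<in> e then 1 else 0)"
    unfolding degree_def using assms by (simp add: sum.If_cases Int_def)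
  also have "\<dots> = (\<Sum>e\<in>E. \<Sum>v\<in>S. if v \<in> e then 1 else 0)" by (rule sum.swap)
  also have "\<dots> = (\<Sum>e\<in>E. card (e \<inter> S))"
    using assms by (intro sum.cong refl) (simp add: sum.If_cases Int_def conj_commute)
  finally show ?thesis .
qed

lemma handshake:
  assumes "graph V E"
  shows "(\<Sum>v\<in>V. degree E v) = 2 * card E"
proof -
  have "(\<Sum>v\<in>V. degree E v) = (\<Sum>e\<in>E. card (e \<inter> V))"
    using assms graph_finite_edges by (intro sum_degree) (auto simp: graph_def)
  also have "\<dots> = (\<Sum>e\<in>E. 2)"
    using assms by (intro sum.cong refl) (auto simp: graph_def Int_absorb2)
  finally show ?thesis by simp
qed

lemma nbrs_sub:
  assumes "graph V E"
  shows "nbrs E v \<subseteq> V" "v \<notin> nbrs E v" "finite (nbrs E v)"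
proof -
  show 1: "nbrs E v \<subseteq> V" "v \<notin> nbrs E v" using assms by (auto simp: nbrs_def graph_def)
  show "finite (nbrs E v)" using 1(1) assms finite_subset by (auto simp: graph_def)
qed

lemma degree_card_nbrs:
  assumes "graph V E"
  shows "degree E v = card (nbrs E v)"
proof -
  have "{e \<in> E. v \<in> e} = (\<lambda>w. {v, w}) ` nbrs E v"
  proof
    show "{e \<in> E. v \<in> e} \<subseteq> (\<lambda>w. {v, w}) ` nbrs E v"
    proof
      fix e assume e: "e \<in> {e \<in> E. v \<in> e}"
      then obtain x y where "e = {x, y}" using graph_edgeE[OF assms] by blast
      then have "\<exists>w. e = {v, w}" using e by auto
      then show "e \<in> (\<lambda>w. {v, w}) ` nbrs E v" using e by (auto simp: nbrs_def)
    qed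
  qed (auto simp: nbrs_def)
  moreover have "inj_on (\<lambda>w. {v, w}) (nbrs E v)" by (auto simp: inj_on_def doubleton_eq_iff)
  ultimately show ?thesis unfolding degree_def by (simp add: card_image)
qed

text \<open>Contraction loses the edge \<open>uv\<close> and, for each common neighbour
  \<open>w\<close>, one of \<open>uw\<close> and \<open>vw\<close>, which coincide afterwards. On
  the set \<open>S\<close> of the remaining edges, with all such \<open>vw\<close> removed, the map
  is injective.\<close>

lemma card_contract:
  assumes "graph V E" "{u, v} \<in> E" "u \<noteq> v"
  shows "card E \<le> card (contract u v E) + 1 + card (nbrs E u \<inter> nbrs E v)"
proof -
  let ?f = "\<lambda>e. (\<lambda>x. if x = v then u else x) ` e"
  let ?N = "nbrs E u \<inter> nbrs E v"
  define S where "S = E - {{u, v}} - (\<lambda>w. {v, w}) ` ?N"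
  have fE: "finite E" using assms graph_finite_edges by auto
  have fN: "finite ?N" using nbrs_sub[OF assms(1)] by auto
  have "inj_on ?f S"
  proof (rule inj_onI)
    fix e e' assume S: "e \<in> S" "e' \<in> S" and eq: "?f e = ?f e'"
    have eE: "e \<in> E" "e' \<in> E" "e \<noteq> {u, v}" "e' \<noteq> {u, v}" using S by (auto simp: S_def)
    \<comment> \<open>An edge at \<open>v\<close> can share its image only with an edge
      \<open>{u, w}\<close> when it is \<open>{v, w}\<close> itself; then \<open>w\<close> is a
      common neighbour and \<open>{v, w}\<close> has been removed from \<open>S\<close>.\<close>
    have *: "f = f'" if ff: "f \<in> S" "f' \<in> S" "v \<in> f" "v \<notin> f'" "?f f = ?f f'" for f f'
    proof -
      have fE: "f \<in> E" "f \<noteq> {u, v}" "f' \<in> E" using that by (auto simp: S_def)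
      obtain x y where xy: "f = {x, y}" "x \<noteq> y" using graph_edgeE[OF assms(1) fE(1)] by metis
      then obtain w where w: "f = {v, w}" "w \<noteq> v" using ff(3) by (metis insertE insert_commute singletonD)
      have "?f f' = f'" using that(4) by auto
      then have "f' = {u, w}" using w that(5) by auto
      then have "w \<in> ?N" using fE w by (auto simp: nbrs_def)
      then have "f \<in> (\<lambda>w. {v, w}) ` ?N" using w(1) by blast
      then show ?thesis using that(1) by (simp add: S_def)
    qed
    consider "v \<in> e" "v \<notin> e'" | "v \<notin> e" "v \<in> e'" | "v \<notin> e" "v \<notin> e'" | "v \<in> e" "v \<in> e'" by blast
    then show "e = e'"
    proof cases
      case 1 then show ?thesis using *[OF S _ _ eq] by blast
    next
      case 2 then show ?thesis using *[OF S(2,1) _ _ eq[symmetric]] by blast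
    next
      case 3
      then have "?f e = e" "?f e' = e'" by auto
      then show ?thesis using eq by simp
    next
      case 4
      obtain w where w: "e = {v, w}" "w \<noteq> v"
        using graph_edgeE[OF assms(1) eE(1)] 4(1) by (metis insertE insert_commute singletonD)
      obtain w' where w': "e' = {v, w'}" "w' \<noteq> v"
        using graph_edgeE[OF assms(1) eE(2)] 4(2) by (metis insertE insert_commute singletonD)
      have "w \<noteq> u" "w' \<noteq> u" using eE w w' by auto
      moreover have "{u, w} = {u, w'}" using eq w w' by auto
      ultimately show ?thesis using w w' by (auto simp: doubleton_eq_iff)
    qed
  qed
  then have "card S = card (?f ` S)" by (simp add: card_image)
  also have "\<dots> \<le> card (contract u v E)"
    unfolding contract_def by (rule card_mono) (use fE in \<open>auto simp: S_def\<close>)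
  finally have 1: "card S \<le> card (contract u v E)" .
  have "E \<subseteq> S \<union> ({{u, v}} \<union> (\<lambda>w. {v, w}) ` ?N)" unfolding S_def by auto
  then have "card E \<le> card (S \<union> ({{u, v}} \<union> (\<lambda>w. {v, w}) ` ?N))"
    using fN fE by (intro card_mono) (auto simp: S_def)
  also have "\<dots> \<le> card S + card ({{u, v}} \<union> (\<lambda>w. {v, w}) ` ?N)" by (rule card_Un_le)
  also have "card ({{u, v}} \<union> (\<lambda>w. {v, w}) ` ?N) \<le> 1 + card ((\<lambda>w. {v, w}) ` ?N)"
    using card_Un_le[of "{{u, v}}"] by simp
  also have "card ((\<lambda>w. {v, w}) ` ?N) \<le> card ?N" using fN by (rule card_image_le)
  finally show ?thesis using 1 by simp
qed

section \<open>Mader's edge bound for small complete minors\<close>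

definition minor_closed :: "('a set \<Rightarrow> 'a set set \<Rightarrow> bool) \<Rightarrow> bool" where
  "minor_closed P \<longleftrightarrow> (\<forall>V E. P V E \<longrightarrow> graph V E) \<and>
     (\<forall>V E V' E'. P V E \<longrightarrow> V' \<subseteq> V \<longrightarrow> E' \<subseteq> E \<longrightarrow> (\<forall>e\<in>E'. e \<subseteq> V') \<longrightarrow> P V' E') \<and>
     (\<forall>V E u v. P V E \<longrightarrow> {u, v} \<in> E \<longrightarrow> u \<noteq> v \<longrightarrow> P (V - {v}) (contract u v E))"

definition pairs :: "'a set \<Rightarrow> 'a set set" where
  "pairs S = {e. e \<subseteq> S \<and> card e = 2}"

text \<open>The class of graphs that stay in \<open>P\<close> after adding an apex \<open>a\<close>.
  It contains the link of every vertex of a graph in \<open>P\<close>, is again minor-closed, and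
  excludes a complete graph with one vertex fewer. This lets the edge bound for links come from
  induction on the order of the excluded graph.\<close>

definition cone :: "('a set \<Rightarrow> 'a set set \<Rightarrow> bool) \<Rightarrow> 'a \<Rightarrow> 'a set \<Rightarrow> 'a set set \<Rightarrow> bool" where
  "cone P a V E \<longleftrightarrow> a \<notin> V \<and> graph V E \<and> P (insert a V) (E \<union> (\<lambda>x. {a, x}) ` V)"

lemma minor_closedD:
  assumes "minor_closed P"
  shows "P V E \<Longrightarrow> graph V E"
    "P V E \<Longrightarrow> V' \<subseteq> V \<Longrightarrow> E' \<subseteq> E \<Longrightarrow> (\<And>e. e \<in> E' \<Longrightarrow> e \<subseteq> V') \<Longrightarrow> P V' E'"
    "P V E \<Longrightarrow> {u, v} \<in> E \<Longrightarrow> u \<noteq> v \<Longrightarrow> P (V - {v}) (contract u v E)"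
proof -
  note m = assms[unfolded minor_closed_def]
  show "P V E \<Longrightarrow> graph V E" by (rule conjunct1[OF m, rule_format])
  show "P V E \<Longrightarrow> V' \<subseteq> V \<Longrightarrow> E' \<subseteq> E \<Longrightarrow> (\<And>e. e \<in> E' \<Longrightarrow> e \<subseteq> V') \<Longrightarrow> P V' E'"
    by (rule conjunct1[OF conjunct2[OF m], rule_format])
  show "P V E \<Longrightarrow> {u, v} \<in> E \<Longrightarrow> u \<noteq> v \<Longrightarrow> P (V - {v}) (contract u v E)"
    by (rule conjunct2[OF conjunct2[OF m], rule_format])
qed

lemma minor_closed_blob_planar: "minor_closed blob_planar"
  unfolding minor_closed_def
proof (intro conjI allI impI)
  show "blob_planar V E \<Longrightarrow> graph V E" for V :: "'a set" and E by (simp add: blob_planar_def)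
  show "blob_planar V' E'" if "blob_planar V E" "V' \<subseteq> V" "E' \<subseteq> E" "\<forall>e\<in>E'. e \<subseteq> V'" for V E and V' :: "'a set" and E'
    by (rule blob_planar_subgraph[OF that(1-3)]) (use that(4) in simp)
qed (rule blob_planar_contract)

lemma graph_inter_pairs: "finite V \<Longrightarrow> graph V (E \<inter> pairs V)"
  by (auto simp: graph_def pairs_def)

lemma minor_closed_cone:
  assumes P: "minor_closed P"
  shows "minor_closed (cone P a)"
  unfolding minor_closed_def
proof (intro conjI allI impI)
  fix V E assume c: "cone P a V E"
  show g: "graph V E" using c by (simp add: cone_def)
  have a: "a \<notin> V" and PE: "P (insert a V) (E \<union> (\<lambda>x. {a, x}) ` V)" using c by (auto simp: cone_def)
  show "cone P a V' E'" if s: "V' \<subseteq> V" "E' \<subseteq> E" "\<forall>e\<in>E'. e \<subseteq> V'" for V' E'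
  proof -
    have "P (insert a V') (E' \<union> (\<lambda>x. {a, x}) ` V')"
      by (rule minor_closedD(2)[OF P PE]) (use s in auto)
    moreover have "graph V' E'" using g s finite_subset[OF s(1)] by (auto simp: graph_def)
    ultimately show ?thesis using a s by (auto simp: cone_def)
  qed
  fix u v assume uv: "{u, v} \<in> E" "u \<noteq> v"
  have uvV: "u \<in> V" "v \<in> V" using uv g by (auto simp: graph_def)
  let ?E = "E \<union> (\<lambda>x. {a, x}) ` V"
  let ?g = "\<lambda>x. if x = v then u else x"
  have 1: "P (insert a V - {v}) (contract u v ?E)"
    by (rule minor_closedD(3)[OF P PE]) (use uv in auto)
  have 2: "insert a V - {v} = insert a (V - {v})" using a uvV by auto
  have gc: "graph (V - {v}) (contract u v E)" by (rule graph_contract[OF g uv])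
  have 3: "contract u v E \<union> (\<lambda>x. {a, x}) ` (V - {v}) \<subseteq> contract u v ?E"
  proof -
    have "{a, x} \<in> contract u v ?E" if "x \<in> V - {v}" for x
    proof -
      have "?g ` {a, x} = {a, x}" using that a uvV by auto
      moreover have "{a, x} \<in> ?E - {{u, v}}" using that a uvV by (auto simp: doubleton_eq_iff)
      ultimately show ?thesis unfolding contract_def by (metis (no_types, lifting) imageI)
    qed
    moreover have "contract u v E \<subseteq> contract u v ?E" unfolding contract_def by auto
    ultimately show ?thesis by auto
  qed
  have "P (insert a (V - {v})) (contract u v E \<union> (\<lambda>x. {a, x}) ` (V - {v}))"
    by (rule minor_closedD(2)[OF P 1[unfolded 2] _ 3]) (use gc in \<open>auto simp: graph_def\<close>)
  then show "cone P a (V - {v}) (contract u v E)" using a gc by (simp add: cone_def)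
qed

lemma cone_no_complete:
  assumes "\<And>S. card S = Suc k \<Longrightarrow> \<not> P S (pairs S)" "card S = k" "0 < k"
  shows "\<not> cone P a S (pairs S)"
proof
  assume c: "cone P a S (pairs S)"
  then have a: "a \<notin> S" and p: "P (insert a S) (pairs S \<union> (\<lambda>x. {a, x}) ` S)" by (auto simp: cone_def)
  have fin: "finite S" using assms card_ge_0_finite by auto
  have "pairs (insert a S) = pairs S \<union> (\<lambda>x. {a, x}) ` S"
  proof
    show "pairs (insert a S) \<subseteq> pairs S \<union> (\<lambda>x. {a, x}) ` S"
    proof
      fix e assume e: "e \<in> pairs (insert a S)"
      then obtain x y where xy: "e = {x, y}" "x \<noteq> y" by (auto simp: pairs_def card_2_iff)
      show "e \<in> pairs S \<union> (\<lambda>x. {a, x}) ` S"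
      proof (cases "a \<in> e")
        case True
        then have "\<exists>z. e = {a, z} \<and> z \<noteq> a" using xy by (metis insertE insert_commute singletonD)
        then show ?thesis using e by (auto simp: pairs_def)
      next
        case False
        then show ?thesis using e by (auto simp: pairs_def)
      qed
    qed
    show "pairs S \<union> (\<lambda>x. {a, x}) ` S \<subseteq> pairs (insert a S)"
      using a by (auto simp: pairs_def card_insert_if)
  qed
  moreover have "card (insert a S) = Suc k" using a fin assms(2) by simp
  ultimately show False using assms(1) p by metis
qed

lemma nbrs_cone:
  assumes P: "minor_closed P" "P V E" and v: "v \<in> V"
  shows "cone P v (nbrs E v) (E \<inter> pairs (nbrs E v))"
proof -
  have g: "graph V E" using P minor_closedD by blast
  note n = nbrs_sub[OF g, of v]
  have "P (insert v (nbrs E v)) (E \<inter> pairs (nbrs E v) \<union> (\<lambda>x. {v, x}) ` nbrs E v)"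
    by (rule minor_closedD(2)[OF P]) (use n v in \<open>auto simp: nbrs_def pairs_def\<close>)
  then show ?thesis using n graph_inter_pairs[OF n(3)] by (simp add: cone_def)
qed

text \<open>Mader's argument: an edge lying in fewer than \<open>k\<close> triangles can be contracted at the cost of
  at most \<open>k\<close> edges; if there is none, every neighbourhood has minimum degree \<open>k\<close>.\<close>

lemma mader_step:
  fixes P :: "'a set \<Rightarrow> 'a set set \<Rightarrow> bool"
  assumes P: "minor_closed P" and k: "1 \<le> k" "k \<le> 3"
    and link: "\<And>V E v. P V E \<Longrightarrow> v \<in> V \<Longrightarrow> k - 1 \<le> card (nbrs E v) \<Longrightarrow>
       2 * card (E \<inter> pairs (nbrs E v)) + (k - 1) * k \<le> 2 * (k - 1) * card (nbrs E v)"
  shows "P V E \<Longrightarrow> k \<le> card V \<Longrightarrow> 2 * card E + k * (k + 1) \<le> 2 * k * card V"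
proof (induction "card V" arbitrary: V E rule: less_induct)
  case less
  have g: "graph V E" using less.prems P minor_closedD by blast
  have fV: "finite V" using g by (simp add: graph_def)
  show ?case
  proof (cases "card V = k")
    \<comment> \<open>On \<open>k\<close> vertices the bound is the number of edges of the complete
      graph.\<close>
    case True
    have "E \<subseteq> pairs V" using g by (auto simp: graph_def pairs_def)
    moreover have "card (pairs V) = k choose 2" unfolding pairs_def using n_subsets[OF fV, of 2] True by simp
    moreover have "finite (pairs V)" unfolding pairs_def using fV by auto
    ultimately have "card E \<le> k choose 2" using card_mono by metis
    moreover have "even (k * (k - 1))" by (cases k) auto
    then have "2 * (k choose 2) = k * (k - 1)" unfolding choose_two by (rule dvd_mult_div_cancel)
    ultimately have "2 * card E \<le> k * (k - 1)" by linarith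
    moreover have "k * (k - 1) + k * (k + 1) = 2 * k * k" using k by (cases k) (auto simp: algebra_simps)
    ultimately show ?thesis using True by simp
  next
    case False
    then have nk: "k + 1 \<le> card V" using less.prems by simp
    show ?thesis
    proof (rule ccontr)
      assume big: "\<not> ?thesis"
      have "even (k * (k + 1))" by simp
      then obtain h where h: "k * (k + 1) = 2 * h" by (metis dvdE)
      have hk: "h \<le> k * card V" 
      proof -
        have "k * (k + 1) \<le> k * card V" using nk by (intro mult_left_mono) auto
        then show ?thesis using h by linarith
      qed
      have "2 * (k * card V) < 2 * card E + 2 * h" using big unfolding h by (simp add: mult.assoc)
      then have "k * card V - h + 1 \<le> card E" using hk by linarith
      \<comment> \<open>Cutting down to exactly one edge above the bound turns it into an equation,
        which the final degree count for \<open>k = 3\<close> relies on.\<close>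
      then obtain F where F: "F \<subseteq> E" "card F = k * card V - h + 1"
        by (meson obtain_subset_with_card_n)
      then have cF: "card F + h = k * card V + 1" using hk by simp
      have PF: "P V F"
        by (rule minor_closedD(2)[OF P less.prems(1) _ F(1)]) (use F g in \<open>auto simp: graph_def\<close>)
      have gF: "graph V F" using graph_subset[OF g F(1)] .
      have smaller: "card F' + h \<le> k * (card V - 1)" if "P (V - {v}) F'" "v \<in> V" for F' v
      proof -
        have c: "card (V - {v}) = card V - 1" using that(2) fV by simp
        then have "card (V - {v}) < card V" "k \<le> card (V - {v})" using nk by auto
        then have "2 * card F' + k * (k + 1) \<le> 2 * k * card (V - {v})" using less.hyps that(1) by blast
        then show ?thesis using h c by simp
      qed
      have kV: "k * (card V - 1) + k = k * card V" using nk by (cases "card V") auto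
      have noiso: "nbrs F v \<noteq> {}" if v: "v \<in> V" for v
      proof
        assume iso: "nbrs F v = {}"
        have "e \<subseteq> V - {v}" if e: "e \<in> F" for e
        proof -
          obtain x y where xy: "e = {x, y}" "x \<in> V" "y \<in> V" using graph_edgeE[OF gF e] by metis
          then have "v \<noteq> x" "v \<noteq> y" using iso that by (auto simp: nbrs_def insert_commute)
          then show ?thesis using xy by auto
        qed
        then have "P (V - {v}) F" by (intro minor_closedD(2)[OF P PF]) auto
        then show False using smaller[OF _ v] cF kV by fastforce
      qed
      \<comment> \<open>An edge in fewer than \<open>k\<close> triangles could be contracted at a
        loss of at most \<open>k\<close> edges, leaving a smaller graph still above its
        bound.\<close>
      have many: "k \<le> card (nbrs F u \<inter> nbrs F v)" if e: "{u, v} \<in> F" "u \<noteq> v" for u v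
      proof (rule ccontr)
        assume "\<not> k \<le> card (nbrs F u \<inter> nbrs F v)"
        then have "card F \<le> card (contract u v F) + k" using card_contract[OF gF e] by simp
        moreover have "card (contract u v F) + h \<le> k * (card V - 1)"
          by (rule smaller[OF minor_closedD(3)[OF P PF e]]) (use gF e in \<open>auto simp: graph_def\<close>)
        ultimately show False using cF kV by linarith
      qed
      \<comment> \<open>With d the degree of \<open>v\<close>, the link has minimum degree at least
        \<open>k\<close>, hence at least kd/2 edges, while \<open>link\<close> bounds its edges by
        (k - 1)d - (k - 1)k/2.\<close>
      have key: "k * card (nbrs F v) + (k - 1) * k \<le> 2 * (k - 1) * card (nbrs F v)" if v: "v \<in> V" for v
      proof -
        let ?N = "nbrs F v" and ?H = "F \<inter> pairs (nbrs F v)"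
        have gH: "graph ?N ?H" using graph_inter_pairs nbrs_sub[OF gF] by metis
        have dH: "k \<le> degree ?H w" if w: "w \<in> ?N" for w
        proof -
          have e: "{v, w} \<in> F" using w by (simp add: nbrs_def)
          have vw: "v \<noteq> w" using w nbrs_sub(2)[OF gF] by metis
          have "nbrs F v \<inter> nbrs F w \<subseteq> nbrs ?H w"
            using w nbrs_sub(2)[OF gF, of w] by (auto simp: nbrs_def pairs_def card_insert_if)
          then have "card (nbrs F v \<inter> nbrs F w) \<le> card (nbrs ?H w)"
            using nbrs_sub(3)[OF gH] card_mono by blast
          then show ?thesis using many[OF e vw] degree_card_nbrs[OF gH] by (metis le_trans)
        qed
        obtain w where w: "w \<in> ?N" using noiso[OF v] by blast
        have "nbrs ?H w \<subseteq> ?N" using nbrs_sub(1)[OF gH] .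
        then have "degree ?H w \<le> card ?N"
          using degree_card_nbrs[OF gH] card_mono[OF nbrs_sub(3)[OF gF]] by metis
        then have "k - 1 \<le> card ?N" using dH[OF w] by simp
        then have l: "2 * card ?H + (k - 1) * k \<le> 2 * (k - 1) * card ?N" using link[OF PF v] by blast
        have "k * card ?N = (\<Sum>w\<in>?N. k)" by simp
        also have "\<dots> \<le> (\<Sum>w\<in>?N. degree ?H w)" using dH by (rule sum_mono)
        also have "\<dots> = 2 * card ?H" by (rule handshake[OF gH])
        finally show ?thesis using l by linarith
      qed
      \<comment> \<open>For \<open>k = 1\<close> the inequality \<open>key\<close> forces degree 0,
        excluded by \<open>noiso\<close>; for \<open>k = 2\<close> it reads 2d + 2 \<le> 2d. For
        \<open>k = 3\<close> it only gives d \<ge> 6, but then \<open>F\<close> has at least 3n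
        edges, n being the number of vertices, while by its choice it has 3n - 5.\<close>
      consider "k = 1" | "k = 2" | "k = 3" using k by linarith
      then show False
      proof cases
        case 1
        obtain v where v: "v \<in> V" using nk by fastforce
        then have "card (nbrs F v) = 0" using key[OF v] 1 by simp
        then show False using noiso[OF v] nbrs_sub(3)[OF gF] by auto
      next
        case 2
        obtain v where v: "v \<in> V" using nk by fastforce
        show False using key[OF v] 2 by simp
      next
        case 3
        have "6 \<le> degree F v" if "v \<in> V" for v using key[OF that] 3 degree_card_nbrs[OF gF] by simp
        then have "(\<Sum>v\<in>V. 6) \<le> (\<Sum>v\<in>V. degree F v)" by (rule sum_mono)
        then have "6 * card V \<le> 2 * card F" using handshake[OF gF] by simp
        moreover have "card F + 6 = 3 * card V + 1" using cF h 3 by simp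
        ultimately show False by linarith
      qed
    qed
  qed
qed

text \<open>Excluding the complete graph on \<open>k + 2\<close> vertices gives at most kn - k(k +
  1)/2 edges: none, n - 1, 2n - 3, 3n - 6 for k = 0, 1, 2, 3. Doubling avoids fractions. The class
  \<open>P\<close> varies in the induction because the links live in
  \<open>cone P v\<close>.\<close>

lemma mader_bound:
  fixes P :: "'a set \<Rightarrow> 'a set set \<Rightarrow> bool"
  assumes "k \<le> 3" "minor_closed P" "\<And>S. card S = k + 2 \<Longrightarrow> \<not> P S (pairs S)" "P V E" "k \<le> card V"
  shows "2 * card E + k * (k + 1) \<le> 2 * k * card V"
  using assms
proof (induction k arbitrary: P V E)
  case 0
  have g: "graph V E" using 0 minor_closedD by blast
  have "E = {}"
  proof (rule ccontr)
    assume "E \<noteq> {}"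
    then obtain e where e: "e \<in> E" by blast
    have c: "e \<subseteq> V" "card e = 2" using e g by (auto simp: graph_def)
    have fe: "finite e" by (rule card_ge_0_finite) (use c in simp)
    have "f = e" if "f \<subseteq> e" "card f = 2" for f
      by (rule card_subset_eq[OF fe that(1)]) (use c that in simp)
    then have "pairs e = {e}" using c by (auto simp: pairs_def)
    moreover have "P e {e}" by (rule minor_closedD(2)[OF 0(2,4) c(1)]) (use e in auto)
    ultimately show False using 0(3)[of e] c by simp
  qed
  then show ?case by simp
next
  case (Suc k)
  show ?case
  proof (rule mader_step[OF Suc.prems(2) _ Suc.prems(1) _ Suc.prems(4,5)])
    fix V E v assume h: "P V E" "v \<in> V" "Suc k - 1 \<le> card (nbrs E v)"
    have "2 * card (E \<inter> pairs (nbrs E v)) + k * (k + 1) \<le> 2 * k * card (nbrs E v)"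
    proof (rule Suc.IH[of "cone P v"])
      show "k \<le> 3" using Suc.prems by simp
      show "minor_closed (cone P v)" by (rule minor_closed_cone[OF Suc.prems(2)])
      show "\<not> cone P v S (pairs S)" if "card S = k + 2" for S
        by (rule cone_no_complete[OF _ that]) (use Suc.prems(3) in auto)
      show "cone P v (nbrs E v) (E \<inter> pairs (nbrs E v))" by (rule nbrs_cone[OF Suc.prems(2) h(1,2)])
      show "k \<le> card (nbrs E v)" using h by simp
    qed
    then show "2 * card (E \<inter> pairs (nbrs E v)) + (Suc k - 1) * Suc k \<le> 2 * (Suc k - 1) * card (nbrs E v)" by simp
  qed simp
qed

lemma card_edges_blob_planar:
  assumes "blob_planar V E" "3 \<le> card V"
  shows "card E + 6 \<le> 3 * card V"
proof -
  have "2 * card E + 3 * (3 + 1) \<le> 2 * 3 * card V"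
    by (rule mader_bound[OF _ minor_closed_blob_planar _ assms]) (use blob_planar_no_K5 in \<open>auto simp: pairs_def\<close>)
  then show ?thesis by simp
qed

text \<open>Together with the apex \<open>v\<close>, a complete graph on four vertices in the link
  class would be a \<open>K_5\<close>, so Mader's bound applies with \<open>k = 2\<close>.\<close>

lemma card_link_edges_blob_planar:
  assumes "blob_planar V E" "v \<in> V" "2 \<le> card (nbrs E v)"
  shows "card (E \<inter> pairs (nbrs E v)) + 3 \<le> 2 * card (nbrs E v)"
proof -
  have "2 * card (E \<inter> pairs (nbrs E v)) + 2 * (2 + 1) \<le> 2 * 2 * card (nbrs E v)"
  proof (rule mader_bound[of 2 "cone blob_planar v"])
    show "\<not> cone blob_planar v S (pairs S)" if "card S = 2 + 2" for S
      by (rule cone_no_complete[OF _ that]) (use blob_planar_no_K5 in \<open>auto simp: pairs_def\<close>)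
  qed (use nbrs_cone[OF minor_closed_blob_planar assms(1,2)] minor_closed_cone[OF minor_closed_blob_planar] assms(3) in auto)
  then show ?thesis by simp
qed

section \<open>Counting triangles in planar graphs\<close>

definition triangle_sets :: "nat set set \<Rightarrow> nat set set" where
  "triangle_sets C = {T. card T = 3 \<and> (\<forall>x\<in>T. \<forall>y\<in>T. x \<noteq> y \<longrightarrow> {x, y} \<in> C)}"

lemma triangles_eq: "triangles C = card (triangle_sets C)"
  by (simp add: triangles_def triangle_sets_def)

lemma triangle_sets_sub:
  assumes "graph V E" "T \<in> triangle_sets E"
  shows "T \<subseteq> V"
proof
  fix x assume x: "x \<in> T"
  have T: "card T = 3" "\<forall>x\<in>T. \<forall>y\<in>T. x \<noteq> y \<longrightarrow> {x, y} \<in> E" using assms by (auto simp: triangle_sets_def)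
  have "\<exists>y\<in>T. y \<noteq> x"
  proof (rule ccontr)
    assume "\<not> ?thesis"
    then have "T \<subseteq> {x}" by blast
    then have "card T \<le> 1" using card_mono[of "{x}" T] by simp
    then show False using T by simp
  qed
  then obtain y where "y \<in> T" "x \<noteq> y" by blast
  then have "{x, y} \<in> E" using T x by blast
  then show "x \<in> V" using assms by (auto simp: graph_def)
qed

lemma triangle_sets_finite: "graph V E \<Longrightarrow> finite (triangle_sets E)"
  using triangle_sets_sub[of V E] by (metis PowI finite_Pow_iff finite_subset graph_def subsetI)

lemma triangles_at:
  assumes "graph V E"
  shows "card {T \<in> triangle_sets E. v \<in> T} \<le> card (E \<inter> pairs (nbrs E v))"
proof (rule card_inj_on_le[of "\<lambda>T. T - {v}"])
  show "inj_on (\<lambda>T. T - {v}) {T \<in> triangle_sets E. v \<in> T}"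
    by (rule inj_onI) (metis (mono_tags, lifting) insert_Diff mem_Collect_eq)
  show "finite (E \<inter> pairs (nbrs E v))" using graph_finite_edges[OF assms] by simp
  show "(\<lambda>T. T - {v}) ` {T \<in> triangle_sets E. v \<in> T} \<subseteq> E \<inter> pairs (nbrs E v)"
  proof
    fix e assume "e \<in> (\<lambda>T. T - {v}) ` {T \<in> triangle_sets E. v \<in> T}"
    then obtain T where T: "card T = 3" "\<forall>x\<in>T. \<forall>y\<in>T. x \<noteq> y \<longrightarrow> {x, y} \<in> E" "v \<in> T" "e = T - {v}"
      by (auto simp: triangle_sets_def)
    have fT: "finite T" by (rule card_ge_0_finite) (use T(1) in simp)
    then have c2: "card e = 2" using T by simp
    then obtain x y where xy: "e = {x, y}" "x \<noteq> y" by (auto simp: card_2_iff)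
    then have "x \<in> T" "y \<in> T" "x \<noteq> v" "y \<noteq> v" using T(4) by auto
    then have "{x, y} \<in> E" "{v, x} \<in> E" "{v, y} \<in> E" using T(2,3) xy(2) by metis+
    then show "e \<in> E \<inter> pairs (nbrs E v)" using xy c2 by (auto simp: pairs_def nbrs_def)
  qed
qed

lemma sum_triangles_at:
  assumes "graph V E"
  shows "(\<Sum>v\<in>V. card {T \<in> triangle_sets E. v \<in> T}) = 3 * triangles E"
proof -
  have fV: "finite V" using assms by (simp add: graph_def)
  have "(\<Sum>v\<in>V. degree (triangle_sets E) v) = (\<Sum>T\<in>triangle_sets E. card (T \<inter> V))"
    using sum_degree[OF triangle_sets_finite[OF assms] fV] .
  also have "\<dots> = (\<Sum>T\<in>triangle_sets E. 3)"
    using triangle_sets_sub[OF assms] by (intro sum.cong refl) (auto simp: Int_absorb2 triangle_sets_def)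
  finally show ?thesis by (simp add: degree_def triangles_eq)
qed

text \<open>A vertex of degree at most 1 lies in no triangle and is deleted by induction. Otherwise
  the link bound 2d - 3 is available at every vertex; summing it counts each triangle three times
  and each edge four times.\<close>

lemma triangles_blob_planar:
  fixes V :: "nat set"
  shows "blob_planar V E \<Longrightarrow> triangles E \<le> 3 * card V"
proof (induction "card V" arbitrary: V E rule: less_induct)
  case less
  have g: "graph V E" using less.prems by (simp add: blob_planar_def)
  have fV: "finite V" using g by (simp add: graph_def)
  show ?case
  proof (cases "\<exists>v\<in>V. card (nbrs E v) \<le> 1")
    case True
    then obtain v where v: "v \<in> V" "card (nbrs E v) \<le> 1" by blast
    let ?E = "E \<inter> pairs (V - {v})"
    have b: "blob_planar (V - {v}) ?E"
      by (rule blob_planar_subgraph[OF less.prems]) (auto simp: pairs_def)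
    have "triangle_sets E \<subseteq> triangle_sets ?E"
    proof
      fix T assume T: "T \<in> triangle_sets E"
      have "v \<notin> T"
      proof
        assume vT: "v \<in> T"
        have c: "card T = 3" using T by (simp add: triangle_sets_def)
        have "finite T" by (rule card_ge_0_finite) (use c in simp)
        then have "card (T - {v}) = 2" using c vT by simp
        moreover have "T - {v} \<subseteq> nbrs E v" using T vT by (auto simp: nbrs_def triangle_sets_def)
        ultimately show False using v(2) card_mono[OF nbrs_sub(3)[OF g], of "T - {v}" v] by linarith
      qed
      then have "T \<subseteq> V - {v}" using triangle_sets_sub[OF g T] by auto
      then show "T \<in> triangle_sets ?E" using T by (auto simp: triangle_sets_def pairs_def card_insert_if)
    qed
    then have "triangles E \<le> triangles ?E"
      unfolding triangles_eq using triangle_sets_finite[of "V - {v}" ?E] b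
      by (intro card_mono) (auto simp: blob_planar_def)
    also have "\<dots> \<le> 3 * card (V - {v})"
      by (rule less.hyps[OF _ b]) (rule card_Diff1_less[OF fV v(1)])
    also have "\<dots> \<le> 3 * card V" using fV by (simp add: card_mono)
    finally show ?thesis .
  next
    case False
    then have d2: "2 \<le> card (nbrs E v)" if "v \<in> V" for v using that by fastforce
    show ?thesis
    proof (cases "V = {}")
      case True
      have "T \<notin> triangle_sets E" for T
      proof
        assume T: "T \<in> triangle_sets E"
        then have "T = {}" using triangle_sets_sub[OF g T] True by simp
        then show False using T by (simp add: triangle_sets_def)
      qed
      then have "triangle_sets E = {}" by blast
      then show ?thesis by (simp add: triangles_eq)
    next
      case False
      then obtain v where v: "v \<in> V" by blast
      have "insert v (nbrs E v) \<subseteq> V" "v \<notin> nbrs E v" "finite (nbrs E v)" using nbrs_sub[OF g] v by auto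
      then have "card (nbrs E v) + 1 \<le> card V" using card_mono[OF fV, of "insert v (nbrs E v)"] by simp
      then have "3 \<le> card V" using d2[OF v] by simp
      then have m: "card E + 6 \<le> 3 * card V" using card_edges_blob_planar[OF less.prems] by blast
      have "3 * triangles E + 3 * card V = (\<Sum>v\<in>V. card {T \<in> triangle_sets E. v \<in> T} + 3)"
        using sum_triangles_at[OF g] by (simp add: sum.distrib)
      also have "\<dots> \<le> (\<Sum>v\<in>V. 2 * degree E v)"
      proof (rule sum_mono)
        fix v assume v: "v \<in> V"
        show "card {T \<in> triangle_sets E. v \<in> T} + 3 \<le> 2 * degree E v"
          using triangles_at[OF g, of v] card_link_edges_blob_planar[OF less.prems v d2[OF v]] degree_card_nbrs[OF g, of v]
          by linarith
      qed
      also have "\<dots> = 2 * (2 * card E)" using handshake[OF g] by (simp flip: sum_distrib_left)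
      finally show ?thesis using m by linarith
    qed
  qed
qed

section \<open>The game\<close>

lemma Kn_edges_pairs: "Kn_edges n = pairs {0..<n}"
proof
  show "Kn_edges n \<subseteq> pairs {0..<n}" by (auto simp: Kn_edges_def pairs_def)
  show "pairs {0..<n} \<subseteq> Kn_edges n"
  proof
    fix e assume "e \<in> pairs {0..<n}"
    then have e: "e \<subseteq> {0..<n}" "card e = 2" by (auto simp: pairs_def)
    then obtain u v where "e = {u, v}" "u \<noteq> v" by (auto simp: card_2_iff)
    then show "e \<in> Kn_edges n" using e by (auto simp: Kn_edges_def)
  qed
qed

lemma finite_Kn: "finite (Kn_edges n)"
  unfolding Kn_edges_pairs pairs_def by simp

lemma card_Kn: "card (Kn_edges n) = n choose 2"
  unfolding Kn_edges_pairs pairs_def using n_subsets[of "{0..<n}" 2] by simp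

lemma doubleton_in_Kn: "{u, v} \<in> Kn_edges n \<longleftrightarrow> u < n \<and> v < n \<and> u \<noteq> v"
  by (auto simp: Kn_edges_pairs pairs_def card_insert_if)

lemma constr_moves_finite: "finite (constr_moves n C B)"
  unfolding constr_moves_def using finite_Kn by (rule rev_finite_subset) auto

lemma planar_graph_empty: "planar_graph (V :: nat set) {}"
  unfolding planar_graph_def
  by (intro exI[of _ "\<lambda>v. of_nat v"]) (auto simp: inj_on_def)

section \<open>The upper bound on the value\<close>

lemma triangles_planar:
  assumes "planar_graph {0..<n} C"
  shows "triangles C \<le> 3 * n"
  using triangles_blob_planar[OF planar_imp_blob_planar[OF assms]] by simp

lemma pcb_val_le:
  "planar_graph {0..<n} C \<Longrightarrow> pcb_val n k t C B \<le> 3 * n"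
proof (induction k arbitrary: t C B)
  case 0
  then show ?case using triangles_planar by simp
next
  case (Suc k)
  note tri = triangles_planar[OF Suc.prems]
  show ?case
  proof (cases t)
    case True
    have "pcb_val n k False (insert e C) B \<le> 3 * n" if "e \<in> constr_moves n C B" for e
      using Suc.IH that by (auto simp: constr_moves_def)
    then show ?thesis using True tri constr_moves_finite by auto
  next
    case False
    show ?thesis
    proof (cases "constr_moves n C B = {} \<or> Kn_edges n - C - B = {}")
      case True
      then show ?thesis using \<open>\<not> t\<close> tri by auto
    next
      case False
      then obtain f where f: "f \<in> Kn_edges n - C - B" by blast
      have "finite ((\<lambda>e. pcb_val n k True C (insert e B)) ` (Kn_edges n - C - B))" using finite_Kn by auto
      then have "Min ((\<lambda>e. pcb_val n k True C (insert e B)) ` (Kn_edges n - C - B)) \<le> pcb_val n k True C (insert f B)"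
        using f by (intro Min_le) auto
      also have "\<dots> \<le> 3 * n" using Suc by blast
      finally show ?thesis using False \<open>\<not> t\<close> by simp
    qed
  qed
qed

lemma g_PCB_K3_le: "g_PCB_K3 n \<le> 3 * n"
  unfolding g_PCB_K3_def by (rule pcb_val_le[OF planar_graph_empty])

lemma graph_Kn_subset: "C \<subseteq> Kn_edges n \<Longrightarrow> graph {0..<n} C"
  by (auto simp: Kn_edges_pairs pairs_def graph_def)

section \<open>Monotone scores and forcing strategies\<close>

lemma triangle_sets_mono: "C \<subseteq> C' \<Longrightarrow> triangle_sets C \<subseteq> triangle_sets C'"
  by (auto simp: triangle_sets_def)

lemma triangles_mono: "C \<subseteq> C' \<Longrightarrow> C' \<subseteq> Kn_edges n \<Longrightarrow> triangles C \<le> triangles C'"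
  unfolding triangles_eq
  by (rule card_mono[OF triangle_sets_finite[OF graph_Kn_subset] triangle_sets_mono])

text \<open>Constructor's graph only grows, so a strategy may stop as soon as the desired count is
  reached and leave the rest of the game to arbitrary legal play.\<close>

lemma triangles_le_pcb_val:
  "C \<subseteq> Kn_edges n \<Longrightarrow> triangles C \<le> pcb_val n k t C B"
proof (induction k arbitrary: t C B)
  case (Suc k)
  show ?case
  proof (cases "constr_moves n C B = {}")
    case True
    then show ?thesis by (cases t) auto
  next
    case ne: False
    show ?thesis
    proof (cases t)
      case True
      obtain e where e: "e \<in> constr_moves n C B" using ne by blast
      then have eC: "insert e C \<subseteq> Kn_edges n" using Suc.prems by (auto simp: constr_moves_def)
      have "triangles C \<le> triangles (insert e C)" by (rule triangles_mono[OF _ eC]) auto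
      also have "\<dots> \<le> pcb_val n k False (insert e C) B" by (rule Suc.IH[OF eC])
      also have "\<dots> \<le> Max ((\<lambda>e. pcb_val n k False (insert e C) B) ` constr_moves n C B)"
        using e constr_moves_finite by (intro Max_ge) auto
      finally show ?thesis using True ne by simp
    next
      case False
      show ?thesis
      proof (cases "Kn_edges n - C - B = {}")
        case True
        then show ?thesis using False by simp
      next
        case un: False
        have "triangles C \<le> Min ((\<lambda>e. pcb_val n k True C (insert e B)) ` (Kn_edges n - C - B))"
          using un finite_Kn Suc.IH[OF Suc.prems] by (intro Min.boundedI) auto
        then show ?thesis using False un ne by simp
      qed
    qed
  qed
qed simp

text \<open>Constructor, who is to move, can force a position with \<open>Q\<close> (on her turn).\<close>

inductive force :: "nat \<Rightarrow> (nat set set \<Rightarrow> nat set set \<Rightarrow> bool) \<Rightarrow> nat set set \<Rightarrow> nat set set \<Rightarrow> bool"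
  for n Q where
  base: "Q C B \<Longrightarrow> force n Q C B"
| step: "e \<in> constr_moves n C B \<Longrightarrow> Kn_edges n - insert e C - B \<noteq> {} \<Longrightarrow>
    (\<And>f. f \<in> Kn_edges n - insert e C - B \<Longrightarrow> force n Q (insert e C) (insert f B)) \<Longrightarrow> force n Q C B"

lemma force_trans:
  assumes "force n Q C B" "\<And>C B. Q C B \<Longrightarrow> force n R C B"
  shows "force n R C B"
  using assms(1)
proof induction
  case (base C B)
  then show ?case by (rule assms(2))
next
  case (step e C B)
  show ?case by (rule force.step[OF step.hyps(1,2) step.IH])
qed

text \<open>Reconciles \<open>force\<close> with the stopping rule of the game and with the fuel: as
  long as \<open>k\<close> bounds the number of unclaimed edges, the fuel cannot run out before the
  strategy has finished.\<close>

lemma force_imp_pcb_val: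
  assumes "force n Q C B" "\<And>C B. Q C B \<Longrightarrow> L \<le> triangles C"
  shows "C \<subseteq> Kn_edges n \<Longrightarrow> card (Kn_edges n - C - B) \<le> k \<Longrightarrow> L \<le> pcb_val n k True C B"
  using assms(1)
proof (induction arbitrary: k rule: force.induct)
  case (base C B)
  then show ?case using assms(2) triangles_le_pcb_val le_trans by metis
next
  case (step e C B)
  have e: "e \<in> Kn_edges n - C - B" using step.hyps(1) by (auto simp: constr_moves_def)
  have fin: "finite (Kn_edges n - C - B)" using finite_Kn by auto
  define C' where "C' = insert e C"
  have C': "C' \<subseteq> Kn_edges n" using e step.prems by (auto simp: C'_def)
  have "Kn_edges n - C' - B \<subset> Kn_edges n - C - B" using e by (auto simp: C'_def)
  then have lt: "card (Kn_edges n - C' - B) < card (Kn_edges n - C - B)" using fin psubset_card_mono by blast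
  obtain f0 where f0: "f0 \<in> Kn_edges n - C' - B" using step.hyps(2) by (auto simp: C'_def)
  then have "0 < card (Kn_edges n - C' - B)" using finite_Kn by (auto simp: card_gt_0_iff)
  \<comment> \<open>Her own move and at least one possible answer are still unclaimed, so the fuel
    covers a whole round.\<close>
  then obtain k' where k: "k = Suc (Suc k')" using lt step.prems(2)
    by (metis Suc_lessE gr0_conv_Suc less_le_trans not_less_eq_eq not0_implies_Suc le_zero_eq less_nat_zero_code)
  have "L \<le> pcb_val n (Suc k') False C' B"
  proof (cases "constr_moves n C' B = {}")
    \<comment> \<open>The game ends here, before Blocker's answer. The derivation for a hypothetical
      answer \<open>f0\<close> must then be \<open>base\<close>, since \<open>step\<close> would
      give Constructor another move; so the goal already holds for \<open>C'\<close>.\<close>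
    case True
    have "force n Q C' (insert f0 B)" using step.hyps(3) f0 by (simp add: C'_def)
    then have "L \<le> triangles C'"
    proof cases
      case base
      then show ?thesis using assms(2) by blast
    next
      case (step e')
      then have "e' \<in> constr_moves n C' B" by (auto simp: constr_moves_def)
      then show ?thesis using True by simp
    qed
    then show ?thesis using True by simp
  next
    case False
    have "L \<le> pcb_val n k' True C' (insert f B)" if f: "f \<in> Kn_edges n - C' - B" for f
    proof -
      have "Kn_edges n - C' - insert f B \<subset> Kn_edges n - C' - B" using f by auto
      then have "card (Kn_edges n - C' - insert f B) < card (Kn_edges n - C' - B)"
        using finite_Kn psubset_card_mono by (metis finite_Diff)
      then have "card (Kn_edges n - C' - insert f B) \<le> k'" using lt step.prems(2) k by simp
      then show ?thesis using step.IH f C' by (simp add: C'_def)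
    qed
    then have "L \<le> Min ((\<lambda>f. pcb_val n k' True C' (insert f B)) ` (Kn_edges n - C' - B))"
      using f0 finite_Kn by (intro Min.boundedI) auto
    then show ?thesis using False f0 by auto
  qed
  also have "\<dots> \<le> Max ((\<lambda>e. pcb_val n (Suc k') False (insert e C) B) ` constr_moves n C B)"
    unfolding C'_def using step.hyps(1) constr_moves_finite by (intro Max_ge) auto
  finally show ?case using k step.hyps(1) by auto
qed

lemma force_g_PCB_K3:
  assumes "force n Q {} {}" "\<And>C B. Q C B \<Longrightarrow> L \<le> triangles C"
  shows "L \<le> g_PCB_K3 n"
  unfolding g_PCB_K3_def by (rule force_imp_pcb_val[OF assms]) auto

text \<open>The bound on the number of claimed edges leaves Blocker an edge to answer with. This is
  the second premise of \<open>force.step\<close>, without which its universal premise could hold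
  vacuously.\<close>

lemma force_move:
  assumes e: "e \<in> Kn_edges n" "e \<notin> C" "e \<notin> B" "planar_graph {0..<n} (insert e C)"
    and c: "card C + card B + 1 < n choose 2"
    and fin: "finite C" "finite B"
    and f: "\<And>f. f \<in> Kn_edges n \<Longrightarrow> f \<notin> insert e C \<Longrightarrow> f \<notin> B \<Longrightarrow> force n Q (insert e C) (insert f B)"
  shows "force n Q C B"
proof (rule force.step)
  show "e \<in> constr_moves n C B" using e by (simp add: constr_moves_def)
  show "Kn_edges n - insert e C - B \<noteq> {}"
  proof
    assume "Kn_edges n - insert e C - B = {}"
    then have "Kn_edges n \<subseteq> insert e C \<union> B" by blast
    then have "card (Kn_edges n) \<le> card (insert e C \<union> B)" using fin by (intro card_mono) auto
    also have "\<dots> \<le> card (insert e C) + card B" by (rule card_Un_le)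
    also have "\<dots> \<le> card C + card B + 1" using card_insert_le_m1 fin by (simp add: card_insert_if)
    finally show False using c card_Kn by simp
  qed
qed (use f in blast)

text \<open>Averaging: each edge of \<open>F\<close> contributes at most 2 to the sum of the degrees
  over \<open>S\<close>. The estimate is kept as a product to stay in the natural numbers.\<close>

lemma low_degree:
  assumes "finite S" "S \<noteq> {}" "finite F" "\<And>e. e \<in> F \<Longrightarrow> card e = 2"
  obtains v where "v \<in> S" "card S * degree F v \<le> 2 * card F"
proof -
  have "\<exists>v\<in>S. card S * degree F v \<le> 2 * card F"
  proof (rule ccontr)
    assume n: "\<not> ?thesis"
    have "card S * (2 * card F) = (\<Sum>v\<in>S. 2 * card F)" by simp
    also have "\<dots> < (\<Sum>v\<in>S. card S * degree F v)" using n assms(1,2) by (intro sum_strict_mono) auto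
    also have "\<dots> = card S * (\<Sum>e\<in>F. card (e \<inter> S))" using sum_degree[OF assms(3,1)] by (simp flip: sum_distrib_left)
    also have "\<dots> \<le> card S * (\<Sum>e\<in>F. 2)"
    proof (intro mult_left_mono sum_mono)
      fix e assume e: "e \<in> F"
      have "finite e" by (rule card_ge_0_finite) (use assms(4)[OF e] in simp)
      then show "card (e \<inter> S) \<le> 2" using card_mono[of e "e \<inter> S"] assms(4)[OF e] by auto
    qed simp
    finally show False by simp
  qed
  then show ?thesis using that by blast
qed

section \<open>Straight-line drawings with marked empty triangles\<close>

lemma barycentric_zero:
  fixes a b c :: complex
  assumes nc: "\<not> collinear {a, b, c}" and "x + y + z = 0" "x *\<^sub>R a + y *\<^sub>R b + z *\<^sub>R c = 0"
  shows "x = 0 \<and> y = 0 \<and> z = 0"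
proof -
  have ac: "a \<noteq> c" using nc collinear_3_expand[of a b c] by blast
  have y: "y = 0"
  proof (rule ccontr)
    assume y: "y \<noteq> 0"
    have "y *\<^sub>R b = (- x) *\<^sub>R a + (- z) *\<^sub>R c" using assms(3) by (simp add: algebra_simps add_eq_0_iff)
    then have "(1 / y) *\<^sub>R (y *\<^sub>R b) = (1 / y) *\<^sub>R ((- x) *\<^sub>R a + (- z) *\<^sub>R c)" by simp
    moreover have "(1 / y) *\<^sub>R (y *\<^sub>R b) = b" using y by simp
    moreover have "(1 / y) *\<^sub>R ((- x) *\<^sub>R a + (- z) *\<^sub>R c) = (- x / y) *\<^sub>R a + (- z / y) *\<^sub>R c"
      unfolding scaleR_add_right scaleR_scaleR by simp
    ultimately have b: "b = (- x / y) *\<^sub>R a + (- z / y) *\<^sub>R c" by metis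
    have z: "- z / y = 1 - (- x / y)" using assms(2) y by (simp add: field_simps)
    have "b = (- x / y) *\<^sub>R a + (1 - (- x / y)) *\<^sub>R c" using b unfolding z .
    then show False using nc collinear_3_expand[of a b c] by blast
  qed
  then have "z = - x" using assms(2) by simp
  then have "x *\<^sub>R (a - c) = 0" using assms(3) y by (simp add: algebra_simps)
  then show ?thesis using ac y \<open>z = - x\<close> by simp
qed

lemma barycentric_unique:
  fixes a b c :: complex
  assumes nc: "\<not> collinear {a, b, c}" and s: "x + y + z = 1" "x' + y' + z' = 1"
    and e: "x *\<^sub>R a + y *\<^sub>R b + z *\<^sub>R c = x' *\<^sub>R a + y' *\<^sub>R b + z' *\<^sub>R c"
  shows "x = x' \<and> y = y' \<and> z = z'"
proof -
  have "(x - x') *\<^sub>R a + (y - y') *\<^sub>R b + (z - z') *\<^sub>R c = 0" using e by (simp add: algebra_simps)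
  moreover have "(x - x') + (y - y') + (z - z') = 0" using s by simp
  ultimately show ?thesis using barycentric_zero[OF nc, of "x - x'" "y - y'" "z - z'"] by simp
qed

definition centroid :: "complex \<Rightarrow> complex \<Rightarrow> complex \<Rightarrow> complex" where
  "centroid a b c = (1/3) *\<^sub>R a + (1/3) *\<^sub>R b + (1/3) *\<^sub>R c"

lemma centroid_perm: "centroid a b c = centroid b a c" "centroid a b c = centroid a c b"
  by (simp_all add: centroid_def)

lemma interior_triangle:
  fixes a b c :: complex
  assumes "\<not> collinear {a, b, c}"
  shows "interior (convex hull {a, b, c}) =
    {v. \<exists>x y z. 0 < x \<and> 0 < y \<and> 0 < z \<and> x + y + z = 1 \<and> x *\<^sub>R a + y *\<^sub>R b + z *\<^sub>R c = v}"
  by (rule interior_convex_hull_3_minimal[OF assms]) simp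

lemma vertex_notin_interior:
  fixes a b c :: complex
  assumes nc: "\<not> collinear {a, b, c}"
  shows "c \<notin> interior (convex hull {a, b, c})"
proof
  assume "c \<in> interior (convex hull {a, b, c})"
  then obtain x y z where "0 < x" "0 < y" "0 < z" "x + y + z = 1" "x *\<^sub>R a + y *\<^sub>R b + z *\<^sub>R c = 0 *\<^sub>R a + 0 *\<^sub>R b + 1 *\<^sub>R c"
    unfolding interior_triangle[OF nc] by auto
  then show False using barycentric_unique[OF nc, of x y z 0 0 1] by simp
qed

lemma centroid_interior:
  assumes nc: "\<not> collinear {a, b, c}"
  shows "centroid a b c \<in> interior (convex hull {a, b, c})"
  unfolding interior_triangle[OF nc] centroid_def by (auto intro!: exI[of _ "1/3"])

lemma centroid_not_collinear:
  assumes nc: "\<not> collinear {a, b, c}"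
  shows "\<not> collinear {a, b, centroid a b c}"
proof
  assume "collinear {a, b, centroid a b c}"
  then consider "a = centroid a b c" | u where "b = u *\<^sub>R a + (1 - u) *\<^sub>R centroid a b c"
    using collinear_3_expand by blast
  then show False
  proof cases
    case 1
    then have "1 *\<^sub>R a + 0 *\<^sub>R b + 0 *\<^sub>R c = (1/3) *\<^sub>R a + (1/3) *\<^sub>R b + (1/3) *\<^sub>R c" by (simp add: centroid_def)
    then show False using barycentric_unique[OF nc, of 1 0 0 "1/3" "1/3" "1/3"] by simp
  next
    case 2
    then have "0 *\<^sub>R a + 1 *\<^sub>R b + 0 *\<^sub>R c = (u + (1-u)/3) *\<^sub>R a + ((1-u)/3) *\<^sub>R b + ((1-u)/3) *\<^sub>R c"
      by (simp add: centroid_def algebra_simps)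
    then show False using barycentric_unique[OF nc, of 0 1 0 "u + (1-u)/3" "(1-u)/3" "(1-u)/3"] by (auto simp: field_simps)
  qed
qed

text \<open>In barycentric coordinates the sector at the side \<open>ab\<close> consists of points
  whose \<open>c\<close>-coordinate is strictly the smallest. Disjointness of sectors and spokes
  becomes a comparison of coordinates.\<close>

lemma interior_subtriangle:
  assumes nc: "\<not> collinear {a, b, c}" and v: "v \<in> interior (convex hull {a, b, centroid a b c})"
  obtains x y z where "x + y + z = 1" "v = x *\<^sub>R a + y *\<^sub>R b + z *\<^sub>R c" "z < x" "z < y"
proof -
  obtain x y z where xyz: "0 < x" "0 < y" "0 < z" "x + y + z = 1" "x *\<^sub>R a + y *\<^sub>R b + z *\<^sub>R centroid a b c = v"
    using v unfolding interior_triangle[OF centroid_not_collinear[OF nc]] by blast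
  have "v = (x + z/3) *\<^sub>R a + (y + z/3) *\<^sub>R b + (z/3) *\<^sub>R c"
    unfolding xyz(5)[symmetric] centroid_def by (simp add: algebra_simps)
  moreover have "(x + z/3) + (y + z/3) + z/3 = 1" using xyz by simp
  ultimately show ?thesis using that[of "x + z/3" "y + z/3" "z/3"] xyz by simp
qed

text \<open>On a spoke two coordinates are equal and the third, that of \<open>s\<close>, is at
  least as large, so the \<open>c\<close>-coordinate is never the strict minimum.\<close>

lemma subtriangle_spoke_disjoint:
  assumes nc: "\<not> collinear {a, b, c}" and s: "s \<in> {a, b, c}"
  shows "interior (convex hull {a, b, centroid a b c}) \<inter> closed_segment (centroid a b c) s = {}"
proof (rule ccontr)
  assume "\<not> ?thesis"
  then obtain v where v: "v \<in> interior (convex hull {a, b, centroid a b c})" "v \<in> closed_segment (centroid a b c) s" by blast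
  obtain x y z where xyz: "x + y + z = 1" "v = x *\<^sub>R a + y *\<^sub>R b + z *\<^sub>R c" "z < x" "z < y"
    using interior_subtriangle[OF nc v(1)] .
  obtain u where u: "0 \<le> u" "u \<le> 1" "v = (1 - u) *\<^sub>R centroid a b c + u *\<^sub>R s" using v(2) by (auto simp: closed_segment_def)
  define r where "r = (1 - u) / 3"
  have v3: "v = r *\<^sub>R a + r *\<^sub>R b + r *\<^sub>R c + u *\<^sub>R s" unfolding u(3) centroid_def r_def by (simp add: algebra_simps)
  have r3: "r + r + r + u = 1" by (simp add: r_def field_simps)
  consider "s = a" | "s = b" | "s = c" using s by blast
  then show False
  proof cases
    case 1
    then have "v = (r + u) *\<^sub>R a + r *\<^sub>R b + r *\<^sub>R c" using v3 by (simp add: algebra_simps)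
    then show False using barycentric_unique[OF nc xyz(1), of "r + u" r r] xyz r3 by simp
  next
    case 2
    then have "v = r *\<^sub>R a + (r + u) *\<^sub>R b + r *\<^sub>R c" using v3 by (simp add: algebra_simps)
    then show False using barycentric_unique[OF nc xyz(1), of r "r + u" r] xyz r3 by simp
  next
    case 3
    then have "v = r *\<^sub>R a + r *\<^sub>R b + (r + u) *\<^sub>R c" using v3 by (simp add: algebra_simps)
    then show False using barycentric_unique[OF nc xyz(1), of r r "r + u"] xyz r3 u by simp
  qed
qed

lemma subtriangles_disjoint:
  assumes nc: "\<not> collinear {a, b, c}"
  shows "interior (convex hull {a, b, centroid a b c}) \<inter> interior (convex hull {a, c, centroid a b c}) = {}"
proof (rule ccontr)
  assume "\<not> ?thesis"
  then obtain v where v: "v \<in> interior (convex hull {a, b, centroid a b c})"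
     "v \<in> interior (convex hull {a, c, centroid a c b})" using centroid_perm by auto
  have nc': "\<not> collinear {a, c, b}" using nc by (simp add: insert_commute)
  obtain x y z where 1: "x + y + z = 1" "v = x *\<^sub>R a + y *\<^sub>R b + z *\<^sub>R c" "z < x" "z < y"
    using interior_subtriangle[OF nc v(1)] .
  obtain x' z' y' where 2: "x' + z' + y' = 1" "v = x' *\<^sub>R a + z' *\<^sub>R c + y' *\<^sub>R b" "y' < x'" "y' < z'"
    using interior_subtriangle[OF nc' v(2)] .
  have "x = x' \<and> y = y' \<and> z = z'"
    by (rule barycentric_unique[OF nc 1(1)]) (use 1 2 in \<open>simp_all add: algebra_simps\<close>)
  then show False using 1 2 by simp
qed

section \<open>Straight-line drawings and insertion into an empty triangle\<close>

abbreviation seg :: "(nat \<Rightarrow> complex) \<Rightarrow> nat set \<Rightarrow> complex set" where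
  "seg p e \<equiv> convex hull (p ` e)"

abbreviation tri_int :: "(nat \<Rightarrow> complex) \<Rightarrow> nat set \<Rightarrow> complex set" where
  "tri_int p t \<equiv> interior (convex hull (p ` t))"

text \<open>The set \<open>F\<close> holds the triangles in which a vertex may be inserted next. A
  triangle is recorded by its corners and is empty in the drawing, whether or not its sides belong
  to \<open>E\<close>.\<close>

definition drawing :: "nat set \<Rightarrow> nat set set \<Rightarrow> (nat \<Rightarrow> complex) \<Rightarrow> nat set set \<Rightarrow> bool" where
  "drawing U E p F \<longleftrightarrow> inj_on p U \<and> graph U E \<and>
     (\<forall>e\<in>E. \<forall>w\<in>U. p w \<in> seg p e \<longrightarrow> w \<in> e) \<and>
     (\<forall>e\<in>E. \<forall>e'\<in>E. e \<noteq> e' \<longrightarrow> seg p e \<inter> seg p e' \<subseteq> p ` (e \<inter> e')) \<and>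
     (\<forall>t\<in>F. t \<subseteq> U \<and> card t = 3 \<and> \<not> collinear (p ` t) \<and> tri_int p t \<inter> p ` U = {} \<and>
        (\<forall>e\<in>E. tri_int p t \<inter> seg p e = {})) \<and>
     (\<forall>t\<in>F. \<forall>t'\<in>F. t \<noteq> t' \<longrightarrow> tri_int p t \<inter> tri_int p t' = {})"

lemma drawingD:
  assumes "drawing U E p F"
  shows "inj_on p U" "graph U E"
    "e \<in> E \<Longrightarrow> w \<in> U \<Longrightarrow> p w \<in> seg p e \<Longrightarrow> w \<in> e"
    "e \<in> E \<Longrightarrow> e' \<in> E \<Longrightarrow> e \<noteq> e' \<Longrightarrow> seg p e \<inter> seg p e' \<subseteq> p ` (e \<inter> e')"
    "t \<in> F \<Longrightarrow> t \<subseteq> U" "t \<in> F \<Longrightarrow> card t = 3" "t \<in> F \<Longrightarrow> \<not> collinear (p ` t)"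
    "t \<in> F \<Longrightarrow> tri_int p t \<inter> p ` U = {}"
    "t \<in> F \<Longrightarrow> e \<in> E \<Longrightarrow> tri_int p t \<inter> seg p e = {}"
    "t \<in> F \<Longrightarrow> t' \<in> F \<Longrightarrow> t \<noteq> t' \<Longrightarrow> tri_int p t \<inter> tri_int p t' = {}"
proof -
  note d = assms[unfolded drawing_def]
  note d2 = conjunct2[OF d] note d3 = conjunct2[OF d2] note d4 = conjunct2[OF d3] note d5 = conjunct2[OF d4]
  show "inj_on p U" "graph U E" by (rule conjunct1[OF d], rule conjunct1[OF d2])
  show "e \<in> E \<Longrightarrow> w \<in> U \<Longrightarrow> p w \<in> seg p e \<Longrightarrow> w \<in> e" by (rule conjunct1[OF d3, rule_format])
  show "e \<in> E \<Longrightarrow> e' \<in> E \<Longrightarrow> e \<noteq> e' \<Longrightarrow> seg p e \<inter> seg p e' \<subseteq> p ` (e \<inter> e')"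
    by (rule conjunct1[OF d4, rule_format])
  note f = bspec[OF conjunct1[OF d5]]
  show "t \<in> F \<Longrightarrow> t \<subseteq> U" "t \<in> F \<Longrightarrow> card t = 3" "t \<in> F \<Longrightarrow> \<not> collinear (p ` t)"
    "t \<in> F \<Longrightarrow> tri_int p t \<inter> p ` U = {}" "t \<in> F \<Longrightarrow> e \<in> E \<Longrightarrow> tri_int p t \<inter> seg p e = {}"
    using f[of t] by simp_all
  show "t \<in> F \<Longrightarrow> t' \<in> F \<Longrightarrow> t \<noteq> t' \<Longrightarrow> tri_int p t \<inter> tri_int p t' = {}"
    by (rule conjunct2[OF d5, rule_format])
qed

text \<open>Passes from a drawing with auxiliary vertices to planarity on the vertex set of the
  game: edges outside \<open>E'\<close> are dropped, and game vertices outside \<open>U\<close> are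
  placed beyond the drawing.\<close>

lemma drawing_planar:
  assumes d: "drawing U E p F" and E: "E' \<subseteq> E" "E' \<subseteq> Kn_edges n"
  shows "planar_graph {0..<n} E'"
proof -
  note g = drawingD(2)[OF d] and inj = drawingD(1)[OF d] and ew = drawingD(3)[OF d] and ee = drawingD(4)[OF d]
  have fU: "finite U" using g by (simp add: graph_def)
  have "bounded (convex hull (p ` U))" using fU by (simp add: bounded_convex_hull finite_imp_bounded)
  then obtain R where R: "\<And>z. z \<in> convex hull (p ` U) \<Longrightarrow> norm z \<le> R" by (auto simp: bounded_iff)
  \<comment> \<open>Vertices outside \<open>U\<close> go to distinct points of the real axis beyond
    the radius \<open>R\<close> of the drawing.\<close>
  define q where "q v = (if v \<in> U then p v else of_real (\<bar>R\<bar> + 1 + real v))" for v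
  have far: "q v \<notin> convex hull (p ` U)" if "v \<notin> U" for v
  proof
    assume "q v \<in> convex hull (p ` U)"
    then have "norm (q v) \<le> R" by (rule R)
    moreover have "norm (q v) = \<bar>R\<bar> + 1 + real v" using that by (simp add: q_def del: of_real_add)
    ultimately show False by linarith
  qed
  have in_hull: "q v \<in> convex hull (p ` U)" if "v \<in> U" for v using that by (simp add: q_def hull_inc)
  have injq: "inj q"
  proof (rule injI)
    fix u v assume e: "q u = q v"
    then have "u \<in> U \<longleftrightarrow> v \<in> U" using far in_hull by metis
    then show "u = v" using e inj by (auto simp: q_def inj_on_def simp del: of_real_add split: if_splits)
  qed
  define \<gamma> where "\<gamma> e = linepath (q (Min e)) (q (Max e))" for e
  have gam: "path_image (\<gamma> e) = seg p e \<and> (\<exists>u v. u \<in> U \<and> v \<in> U \<and> u \<noteq> v \<and> e = {u, v} \<and> arc (\<gamma> e) \<and> pathstart (\<gamma> e) = q u \<and> pathfinish (\<gamma> e) = q v)"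
    if e: "e \<in> E" for e
  proof -
    obtain u v where uv0: "e = {u, v}" "u \<noteq> v" "u \<in> U" "v \<in> U" using graph_edgeE[OF g e] .
    define a b where "a = min u v" and "b = max u v"
    have uv: "e = {a, b}" "a < b" "a \<in> U" "b \<in> U" using uv0 by (auto simp: a_def b_def min_def max_def)
    have mm: "Min e = a" "Max e = b" using uv by auto
    have "q a = p a" "q b = p b" using uv by (auto simp: q_def)
    then have "path_image (\<gamma> e) = seg p e" unfolding \<gamma>_def mm using uv(1) by (simp add: segment_convex_hull)
    moreover have "q a \<noteq> q b" using uv(2) injq by (auto dest: injD)
    then have "arc (\<gamma> e)" unfolding \<gamma>_def mm by simp
    ultimately show ?thesis using uv by (intro conjI exI[of _ a] exI[of _ b]) (auto simp: \<gamma>_def mm)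
  qed
  have segU: "seg p e \<subseteq> convex hull (p ` U)" if "e \<in> E" for e
    using that g by (intro hull_mono) (auto simp: graph_def)
  have 1: "\<exists>u v. u \<in> {0..<n} \<and> v \<in> {0..<n} \<and> u \<noteq> v \<and> e = {u, v} \<and> arc (\<gamma> e) \<and> pathstart (\<gamma> e) = q u \<and> pathfinish (\<gamma> e) = q v \<and>
     (\<forall>w\<in>{0..<n}. q w \<in> path_image (\<gamma> e) \<longrightarrow> w = u \<or> w = v)" if e: "e \<in> E'" for e
  proof -
    have eE: "e \<in> E" and eK: "e \<in> Kn_edges n" using e E by auto
    obtain u v where uv: "u \<in> U" "v \<in> U" "u \<noteq> v" "e = {u, v}" "arc (\<gamma> e)" "pathstart (\<gamma> e) = q u" "pathfinish (\<gamma> e) = q v"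
      using gam[OF eE] by blast
    have "w \<in> e" if "q w \<in> path_image (\<gamma> e)" for w
    proof -
      have s: "q w \<in> seg p e" using that gam[OF eE] by simp
      then have "w \<in> U" using far segU[OF eE] by blast
      then show ?thesis using ew[OF eE] s by (simp add: q_def)
    qed
    then show ?thesis using uv eK by (intro exI[of _ u] exI[of _ v]) (auto simp: doubleton_in_Kn)
  qed
  have 2: "path_image (\<gamma> e) \<inter> path_image (\<gamma> e') \<subseteq> q ` (e \<inter> e')" if e: "e \<in> E'" "e' \<in> E'" "e \<noteq> e'" for e e'
  proof -
    have eE: "e \<in> E" "e' \<in> E" using e E by auto
    have "q ` (e \<inter> e') = p ` (e \<inter> e')" using eE g by (intro image_cong) (auto simp: q_def graph_def)
    then show ?thesis using ee[OF eE e(3)] gam eE by simp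
  qed
  show ?thesis unfolding planar_graph_def
    by (intro exI[of _ q] exI[of _ \<gamma>] conjI ballI impI 1 2 inj_on_subset[OF injq]) simp
qed

lemma drawing_triangle:
  assumes "distinct [a, b, c]"
  shows "\<exists>p. drawing {a, b, c} {} p {{a, b, c}}"
proof -
  define p where "p v = (if v = a then 0 else if v = b then 1 else \<i>)" for v
  have pv: "p a = 0" "p b = 1" "p c = \<i>" using assms by (auto simp: p_def)
  have nc: "\<not> collinear {0, 1, \<i>}"
  proof
    assume "collinear {0, 1, \<i>}"
    then obtain u where "1 = u *\<^sub>R 0 + (1 - u) *\<^sub>R \<i>" using collinear_3_expand[of 0 1 \<i>] by auto
    then have "Re 1 = Re ((1 - u) *\<^sub>R \<i>)" by simp
    then show False by simp
  qed
  have "0 \<notin> interior (convex hull {0, 1, \<i>})" "1 \<notin> interior (convex hull {0, 1, \<i>})" "\<i> \<notin> interior (convex hull {0, 1, \<i>})"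
    using vertex_notin_interior[of 1 \<i> 0] vertex_notin_interior[of 0 \<i> 1] vertex_notin_interior[of 0 1 \<i>] nc
    by (auto simp: insert_commute)
  then have "drawing {a, b, c} {} p {{a, b, c}}"
    unfolding drawing_def using pv nc assms by (auto simp: inj_on_def graph_def)
  then show ?thesis by blast
qed

text \<open>The new vertex sits at the centroid of \<open>t\<close>. Apart from the corners of
  \<open>t\<close>, its spokes run inside the empty interior \<open>T\<close>, so nothing old is
  disturbed; the three sectors are new empty triangles that replace \<open>t\<close>.\<close>

lemma drawing_insert:
  assumes d: "drawing U E p F" and t: "t \<in> F" and w: "w \<notin> U"
  shows "\<exists>p'. drawing (insert w U) (E \<union> (\<lambda>v. {w, v}) ` t) p' ((F - {t}) \<union> (\<lambda>v. insert w (t - {v})) ` t)"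
proof -
  note g = drawingD(2)[OF d] and inj = drawingD(1)[OF d] and ew = drawingD(3)[OF d] and ee = drawingD(4)[OF d]
    and F = drawingD(5-9)[OF d] and FF = drawingD(10)[OF d]
  have tU: "t \<subseteq> U" using F(1)[OF t] .
  obtain x y z where xyz: "t = {x, y, z}" "x \<noteq> y" "x \<noteq> z" "y \<noteq> z" using F(2)[OF t] by (auto simp: card_3_iff)
  define q where "q = centroid (p x) (p y) (p z)"
  define p' where "p' = p(w := q)"
  define T where "T = tri_int p t"
  have nct: "\<not> collinear {p x, p y, p z}" using F(3)[OF t] xyz(1) by simp
  have qT: "q \<in> T" unfolding T_def q_def using centroid_interior[OF nct] xyz(1) by simp
  \<comment> \<open>all statements about the three sectors follow from one, by symmetry of the centroid\<close>
  define R where "R a b c \<longleftrightarrow> t = {a, b, c} \<and> distinct [a, b, c] \<and> \<not> collinear {p a, p b, p c} \<and>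
      q = centroid (p a) (p b) (p c)" for a b c
  have R1: "R x y z" unfolding R_def q_def using xyz nct by simp
  have Rs: "R a c b" "R b a c" if "R a b c" for a b c
    using that centroid_perm[of "p a" "p b" "p c"] unfolding R_def by (simp_all add: insert_commute)
  have sym: "\<exists>a b. R a b v" if "v \<in> t" for v
    using that R1 Rs(1)[OF R1] Rs(1)[OF Rs(2)[OF R1]] xyz(1) by blast
  have p'U: "p' ` S = p ` S" if "S \<subseteq> U" for S
    using that w by (intro image_cong) (auto simp: p'_def)
  have p'w: "p' w = q" by (simp add: p'_def)
  have eU: "e \<subseteq> U" if "e \<in> E" for e using that g by (auto simp: graph_def)
  have segE: "seg p' e = seg p e" if "e \<in> E" for e using p'U[OF eU[OF that]] by simp
  have innF: "tri_int p' s = tri_int p s" if "s \<in> F" for s using p'U[OF F(1)[OF that]] by simp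
  have qU: "q \<notin> p ` U" using qT F(4)[OF t] unfolding T_def by blast
  have vt: "p' v = p v" if "v \<in> t" for v using that tU w by (auto simp: p'_def)
  have newseg: "seg p' {w, v} = closed_segment q (p v)" if "v \<in> t" for v
    using vt[OF that] p'w by (simp add: segment_convex_hull)
  \<comment> \<open>By convexity, the open segment from an interior point to a corner stays in the
    interior.\<close>
  have newsub: "seg p' {w, v} \<subseteq> insert (p v) T" if v: "v \<in> t" for v
  proof -
    have "p v \<in> convex hull (p ` t)" using v by (simp add: hull_inc)
    then have "p v \<in> closure (convex hull (p ` t))" using closure_subset by blast
    then have "open_segment q (p v) \<subseteq> T"
      using in_interior_closure_convex_segment[OF convex_convex_hull] qT unfolding T_def by blast
    then show ?thesis using newseg[OF v] qT closed_segment_eq_open[of q "p v"] by auto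
  qed
  let ?U = "insert w U" and ?N = "(\<lambda>v. {w, v}) ` t" and ?G = "(\<lambda>v. insert w (t - {v})) ` t"
  have sector: "tri_int p' (insert w (t - {v})) \<subseteq> T \<and> \<not> collinear (p' ` insert w (t - {v})) \<and> card (insert w (t - {v})) = 3 \<and>
      (\<forall>s\<in>t. tri_int p' (insert w (t - {v})) \<inter> seg p' {w, s} = {}) \<and>
      (\<forall>v'\<in>t. v' \<noteq> v \<longrightarrow> tri_int p' (insert w (t - {v})) \<inter> tri_int p' (insert w (t - {v'})) = {})" if v: "v \<in> t" for v
  proof -
    obtain a b where "R a b v" using sym[OF v] by blast
    then obtain c where abc: "t = {a, b, c}" "c = v" "distinct [a, b, c]" "\<not> collinear {p a, p b, p c}" "q = centroid (p a) (p b) (p c)"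
      unfolding R_def by blast
    have wt: "w \<notin> t" using w tU by blast
    have abt: "a \<in> t" "b \<in> t" "c \<in> t" using abc(1) by simp_all
    have tv: "t - {v} = {a, b}" "t - {a} = {b, c}" "t - {b} = {a, c}" using abc(1-3) by auto
    have im: "p' ` insert w (t - {v}) = {p a, p b, q}"
      unfolding tv using vt[OF abt(1)] vt[OF abt(2)] p'w by (simp add: insert_commute)
    have "q \<in> convex hull (p ` t)" using qT interior_subset unfolding T_def by blast
    moreover have "p a \<in> convex hull (p ` t)" "p b \<in> convex hull (p ` t)" using abt by (simp_all add: hull_inc)
    ultimately have "{p a, p b, q} \<subseteq> convex hull (p ` t)" by simp
    then have "convex hull {p a, p b, q} \<subseteq> convex hull (p ` t)" by (simp add: hull_minimal)
    then have 1: "tri_int p' (insert w (t - {v})) \<subseteq> T" unfolding im T_def by (rule interior_mono)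
    have 2: "\<not> collinear (p' ` insert w (t - {v}))" unfolding im abc(5) by (rule centroid_not_collinear[OF abc(4)])
    have 3: "card (insert w (t - {v})) = 3" 
  proof -
    have "w \<noteq> a" "w \<noteq> b" using wt abt by auto
    then show ?thesis unfolding tv using abc(3) by simp
  qed
    have 4: "\<forall>s\<in>t. tri_int p' (insert w (t - {v})) \<inter> seg p' {w, s} = {}"
    proof
      fix s assume s: "s \<in> t"
      show "tri_int p' (insert w (t - {v})) \<inter> seg p' {w, s} = {}"
        unfolding newseg[OF s] im unfolding abc(5)
        by (rule subtriangle_spoke_disjoint[OF abc(4)]) (use s abc(1) in auto)
    qed
    have 5: "tri_int p' (insert w (t - {v})) \<inter> tri_int p' (insert w (t - {v'})) = {}" if v': "v' \<in> t" "v' \<noteq> v" for v'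
    proof -
      consider "v' = a" | "v' = b" using v' abc by auto
      then show ?thesis
      proof cases
        case 1
        have im': "p' ` insert w (t - {v'}) = {p b, p c, q}"
          unfolding 1 tv using vt[OF abt(2)] vt[OF abt(3)] p'w by (simp add: insert_commute)
        have n: "\<not> collinear {p b, p a, p c}" using abc(4) by (simp add: insert_commute)
        have q2: "q = centroid (p b) (p a) (p c)" using abc(5) centroid_perm by metis
        have "tri_int p' (insert w (t - {v})) = interior (convex hull {p b, p a, q})" unfolding im by (simp add: insert_commute)
        then show ?thesis unfolding im' using subtriangles_disjoint[OF n] q2 by simp
      next
        case 2
        have im': "p' ` insert w (t - {v'}) = {p a, p c, q}"
          unfolding 2 tv using vt[OF abt(1)] vt[OF abt(3)] p'w by (simp add: insert_commute)
        show ?thesis unfolding im im' using subtriangles_disjoint[OF abc(4)] abc(5) by simp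
      qed
    qed
    show ?thesis using 1 2 3 4 5 by blast
  qed
  have TF: "T \<inter> p ` U = {}" "\<And>e. e \<in> E \<Longrightarrow> T \<inter> seg p e = {}" "\<And>s. s \<in> F - {t} \<Longrightarrow> T \<inter> tri_int p s = {}"
    unfolding T_def using F(4)[OF t] F(5)[OF t] FF[OF t] by blast+
  have A1: "inj_on p' ?U"
  proof -
    have "inj_on p' U" using inj w by (auto simp: inj_on_def p'_def)
    then show ?thesis using qU p'w p'U[of U] by (auto simp: inj_on_insert w)
  qed
  have A2: "graph ?U (E \<union> ?N)"
    using g tU w by (auto simp: graph_def card_insert_if)
  have spoke: "u = s" if "u \<in> U" "s \<in> t" "p u \<in> seg p' {w, s}" for u s
  proof -
    have "p u \<in> insert (p s) T" using newsub[OF that(2)] that(3) by blast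
    then have "p u = p s" using TF(1) that(1) by blast
    then show ?thesis using inj that tU by (auto dest: inj_onD)
  qed
  have A3: "u \<in> e" if e: "e \<in> E \<union> ?N" and u: "u \<in> ?U" and pu: "p' u \<in> seg p' e" for e u
  proof (cases "e \<in> E")
    case True
    have "u \<noteq> w"
    proof
      assume "u = w"
      then have "q \<in> seg p e" using pu segE[OF True] p'w by simp
      then show False using TF(2)[OF True] qT by blast
    qed
    then have "u \<in> U" "p' u = p u" using u by (auto simp: p'_def)
    then show ?thesis using ew[OF True] pu segE[OF True] by simp
  next
    case False
    then obtain s where s: "s \<in> t" "e = {w, s}" using e by blast
    show ?thesis
    proof (cases "u = w")
      case False
      then have "u \<in> U" "p' u = p u" using u by (auto simp: p'_def)
      then show ?thesis using spoke[OF _ s(1)] pu s(2) by auto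
    qed (use s in simp)
  qed
  have old_new: "seg p' e \<inter> seg p' {w, s} \<subseteq> p' ` (e \<inter> {w, s})" if e: "e \<in> E" and s: "s \<in> t" for e s
  proof
    fix z assume z: "z \<in> seg p' e \<inter> seg p' {w, s}"
    then have ze: "z \<in> seg p e" using segE[OF e] by simp
    then have "z \<notin> T" using TF(2)[OF e] by blast
    then have "z = p s" using z newsub[OF s] by blast
    moreover have "s \<in> e" using ew[OF e, of s] ze tU s calculation by blast
    ultimately show "z \<in> p' ` (e \<inter> {w, s})" using vt[OF s] by force
  qed
  have new_new: "seg p' {w, s} \<inter> seg p' {w, s'} \<subseteq> p' ` ({w, s} \<inter> {w, s'})" if s: "s \<in> t" "s' \<in> t" "s \<noteq> s'" for s s'
  proof -
    \<comment> \<open>With \<open>v\<close> the third corner, the sector opposite \<open>v\<close>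
      is a nondegenerate triangle on \<open>s\<close>, \<open>s'\<close> and the centre, so the two
      spokes meet in the centre only.\<close>
    obtain v where v: "v \<in> t" "v \<noteq> s" "v \<noteq> s'" using xyz s by (metis insert_iff)
    have "t = {s, s', v}" using v s F(2)[OF t] card_seteq[of t "{s, s', v}"] card_ge_0_finite[of t] by auto
    moreover have "w \<notin> t" using w tU by blast
    ultimately have tv: "t - {v} = {s, s'}" using v s by auto
    have "p' ` insert w (t - {v}) = {p s, q, p s'}"
      unfolding tv using vt[OF s(1)] vt[OF s(2)] p'w by (simp add: insert_commute)
    then have "\<not> collinear {p s, q, p s'}" using sector[OF v(1)] by simp
    then have "closed_segment (p s) q \<inter> closed_segment q (p s') = {q}" by (intro Int_closed_segment) simp
    then show ?thesis using newseg[OF s(1)] newseg[OF s(2)] p'w by (auto simp: closed_segment_commute)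
  qed
  have A4: "seg p' e \<inter> seg p' e' \<subseteq> p' ` (e \<inter> e')" if e: "e \<in> E \<union> ?N" "e' \<in> E \<union> ?N" "e \<noteq> e'" for e e'
  proof -
    consider "e \<in> E" "e' \<in> E" | s where "e \<in> E" "s \<in> t" "e' = {w, s}" | s where "e' \<in> E" "s \<in> t" "e = {w, s}"
      | s s' where "s \<in> t" "s' \<in> t" "e = {w, s}" "e' = {w, s'}" using e by blast
    then show ?thesis
    proof cases
      case 1
      have "p' ` (e \<inter> e') = p ` (e \<inter> e')" using eU[OF 1(1)] by (intro p'U) auto
      then show ?thesis using segE ee 1 e(3) by simp
    next
      case 2
      then show ?thesis using old_new by simp
    next
      case 3
      then show ?thesis using old_new[OF 3(1,2)] by (simp add: Int_commute)
    next
      case 4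
      then show ?thesis using new_new e(3) by auto
    qed
  qed
  have A5: "s \<subseteq> ?U \<and> card s = 3 \<and> \<not> collinear (p' ` s) \<and> tri_int p' s \<inter> p' ` ?U = {} \<and>
        (\<forall>e\<in>E \<union> ?N. tri_int p' s \<inter> seg p' e = {})" if s: "s \<in> (F - {t}) \<union> ?G" for s
  proof (cases "s \<in> F - {t}")
    case True
    then have sF: "s \<in> F" by blast
    have i: "tri_int p' s = tri_int p s" by (rule innF[OF sF])
    have Ts: "tri_int p s \<inter> T = {}" using TF(3)[OF True] by blast
    have "tri_int p' s \<inter> p' ` ?U = {}" unfolding i using F(4)[OF sF] Ts qT p'U[of U] p'w by auto
    moreover have "tri_int p' s \<inter> seg p' e = {}" if e: "e \<in> E \<union> ?N" for e
    proof (cases "e \<in> E")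
      case True
      then show ?thesis unfolding i using F(5)[OF sF True] segE[OF True] by simp
    next
      case False
      then obtain r where r: "r \<in> t" "e = {w, r}" using e by blast
      have "p r \<notin> tri_int p s" using F(4)[OF sF] r(1) tU by blast
      then show ?thesis unfolding i r(2) using newsub[OF r(1)] Ts by blast
    qed
    moreover have "s \<subseteq> ?U" "card s = 3" using F(1,2)[OF sF] by auto
    moreover have "\<not> collinear (p' ` s)" using F(3)[OF sF] p'U[OF F(1)[OF sF]] by simp
    ultimately show ?thesis by blast
  next
    case False
    then obtain v where v: "v \<in> t" "s = insert w (t - {v})" using s by blast
    note sec = sector[OF v(1), folded v(2)]
    have i: "tri_int p' s \<subseteq> T" using sec by blast
    have "q \<in> seg p' {w, v}" using newseg[OF v(1)] by simp
    then have "q \<notin> tri_int p' s" using sec v(1) by blast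
    then have "tri_int p' s \<inter> p' ` ?U = {}" using i TF(1) p'U[of U] p'w by auto
    moreover have "tri_int p' s \<inter> seg p' e = {}" if e: "e \<in> E \<union> ?N" for e
    proof (cases "e \<in> E")
      case True
      then show ?thesis using i TF(2)[OF True] segE[OF True] by auto
    next
      case False
      then show ?thesis using e sec by blast
    qed
    moreover have "s \<subseteq> ?U" using v tU by auto
    ultimately show ?thesis using sec by blast
  qed
  have A6: "tri_int p' s \<inter> tri_int p' s' = {}" if s: "s \<in> (F - {t}) \<union> ?G" "s' \<in> (F - {t}) \<union> ?G" "s \<noteq> s'" for s s'
  proof -
    have fg: "tri_int p' r \<inter> tri_int p' r' = {}" if "r \<in> F - {t}" "r' \<in> ?G" for r r'
    proof -
      have "tri_int p' r' \<subseteq> T" using that(2) sector by blast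
      then show ?thesis using TF(3)[OF that(1)] innF[of r] that(1) by blast
    qed
    consider "s \<in> F - {t}" "s' \<in> F - {t}" | "s \<in> F - {t}" "s' \<in> ?G" | "s' \<in> F - {t}" "s \<in> ?G" | "s \<in> ?G" "s' \<in> ?G"
      using s by blast
    then show ?thesis
    proof cases
      case 1
      then show ?thesis using FF[of s s'] s(3) innF by simp
    next
      case 2
      then show ?thesis by (rule fg)
    next
      case 3
      then show ?thesis using fg[OF 3] by blast
    next
      case 4
      then obtain v v' where v: "v \<in> t" "v' \<in> t" "s = insert w (t - {v})" "s' = insert w (t - {v'})" by blast
      then have "v' \<noteq> v" using s(3) by blast
      then show ?thesis using sector[OF v(1)] v by blast
    qed
  qed
  have "drawing ?U (E \<union> ?N) p' ((F - {t}) \<union> ?G)"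
    unfolding drawing_def
  proof (intro conjI)
    show "\<forall>e\<in>E \<union> ?N. \<forall>w\<in>?U. p' w \<in> seg p' e \<longrightarrow> w \<in> e" using A3 by blast
    show "\<forall>e\<in>E \<union> ?N. \<forall>e'\<in>E \<union> ?N. e \<noteq> e' \<longrightarrow> seg p' e \<inter> seg p' e' \<subseteq> p' ` (e \<inter> e')" using A4 by (intro ballI impI)
    show "\<forall>t\<in>(F - {t}) \<union> ?G. t \<subseteq> ?U \<and> card t = 3 \<and> \<not> collinear (p' ` t) \<and> tri_int p' t \<inter> p' ` ?U = {} \<and>
        (\<forall>e\<in>E \<union> ?N. tri_int p' t \<inter> seg p' e = {})" using A5 by (intro ballI)
    show "\<forall>s\<in>(F - {t}) \<union> ?G. \<forall>t'\<in>(F - {t}) \<union> ?G. s \<noteq> t' \<longrightarrow> tri_int p' s \<inter> tri_int p' t' = {}" using A6 by (intro ballI impI)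
  qed (rule A1 A2)+
  then show ?thesis by blast
qed

section \<open>Building the gadgets\<close>

fun pathE :: "nat list \<Rightarrow> nat set set" where
  "pathE [] = {}"
| "pathE [a] = {}"
| "pathE (a # b # l) = insert {a, b} (pathE (b # l))"

fun pathF :: "nat \<Rightarrow> nat list \<Rightarrow> nat set set" where
  "pathF x [] = {}"
| "pathF x [a] = {}"
| "pathF x (a # b # l) = insert {x, a, b} (pathF x (b # l))"

definition spokes :: "nat \<Rightarrow> nat list \<Rightarrow> nat set set" where
  "spokes x ls = (\<lambda>l. {x, l}) ` set ls"

definition fan :: "nat \<Rightarrow> nat list \<Rightarrow> nat set set" where
  "fan x ls = spokes x ls \<union> pathE ls"

definition verts :: "(nat \<times> nat list) list \<Rightarrow> nat list" where
  "verts gs = concat (map (\<lambda>(x, ls). x # ls) gs)"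

definition fans :: "(nat \<times> nat list) list \<Rightarrow> nat set set" where
  "fans gs = (\<Union>(x, ls)\<in>set gs. fan x ls)"

lemma verts_simps [simp]: "verts [] = []" "verts ((x, ls) # gs) = x # ls @ verts gs"
  by (auto simp: verts_def)

lemma fans_simps [simp]: "fans [] = {}" "fans ((x, ls) # gs) = fan x ls \<union> fans gs"
  by (auto simp: fans_def)

lemma pathE_Cons: "pathE l \<subseteq> pathE (a # l)"
  by (cases l) auto

lemma pathE_append2: "pathE m \<subseteq> pathE (l @ m)"
  by (induction l) (use pathE_Cons in fastforce)+

lemma pathE_append1: "pathE l \<subseteq> pathE (l @ m)"
  by (induction l rule: pathE.induct) auto

lemma pathE_sub: "e \<in> pathE l \<Longrightarrow> e \<subseteq> set l"
  by (induction l rule: pathE.induct) auto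

lemma pathF_sub: "t \<in> pathF x l \<Longrightarrow> t \<subseteq> insert x (set l)"
  by (induction x l rule: pathF.induct) auto

lemma fan_sub: "e \<in> fan x ls \<Longrightarrow> e \<subseteq> insert x (set ls)"
  unfolding fan_def spokes_def using pathE_sub by auto

lemma fans_sub: "e \<in> fans gs \<Longrightarrow> e \<subseteq> set (verts gs)"
proof (induction gs)
  case (Cons g gs)
  obtain x ls where g: "g = (x, ls)" by (cases g)
  show ?case using Cons fan_sub[of e x ls] unfolding g by auto
qed simp

lemma spokes_fan: "spokes x ls \<subseteq> fan x ls"
  by (auto simp: fan_def)

text \<open>\<open>y\<close> is the latest leaf and \<open>d\<close> a fixed auxiliary corner.
  Inserting \<open>l\<close> into \<open>{x, d, y}\<close> yields \<open>{x, y, l}\<close>, which is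
  kept as a face of the fan, and \<open>{x, d, l}\<close>, into which the next leaf goes.\<close>

lemma drawing_fan:
  assumes "drawing U E p F" "{x, d, y} \<in> F" "distinct ls" "set ls \<inter> U = {}"
  shows "\<exists>E' p' F'. drawing (U \<union> set ls) E' p' F' \<and> E \<subseteq> E' \<and> F - {{x, d, y}} \<subseteq> F' \<and>
    spokes x ls \<subseteq> E' \<and> pathE (y # ls) \<subseteq> E' \<and> pathF x (y # ls) \<subseteq> F'"
  using assms
proof (induction ls arbitrary: U E p F y)
  case Nil
  then show ?case by (intro exI[of _ E] exI[of _ p] exI[of _ F]) (auto simp: spokes_def)
next
  case (Cons l ls)
  let ?t = "{x, d, y}"
  have tU: "?t \<subseteq> U" "card ?t = 3" using drawingD(5,6)[OF Cons.prems(1,2)] by auto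
  then have ds: "x \<noteq> d" "x \<noteq> y" "d \<noteq> y" by (auto simp: card_insert_if split: if_splits)
  have lU: "l \<notin> U" "l \<notin> set ls" using Cons.prems by auto
  obtain p1 where d1: "drawing (insert l U) (E \<union> (\<lambda>v. {l, v}) ` ?t) p1 ((F - {?t}) \<union> (\<lambda>v. insert l (?t - {v})) ` ?t)"
    using drawing_insert[OF Cons.prems(1,2) lU(1)] by blast
  define E1 where "E1 = E \<union> (\<lambda>v. {l, v}) ` ?t"
  define F1 where "F1 = (F - {?t}) \<union> (\<lambda>v. insert l (?t - {v})) ` ?t"
  have d1': "drawing (insert l U) E1 p1 F1" using d1 unfolding E1_def F1_def .
  have "insert l (?t - {y}) \<in> F1" "insert l (?t - {d}) \<in> F1" unfolding F1_def by blast+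
  moreover have "insert l (?t - {y}) = {x, d, l}" "insert l (?t - {d}) = {x, y, l}" using ds by auto
  ultimately have f: "{x, d, l} \<in> F1" "{x, y, l} \<in> F1" by simp_all
  have "distinct ls" "set ls \<inter> insert l U = {}" using Cons.prems lU by auto
  from Cons.IH[OF d1' f(1) this] obtain E' p' F' where
    IH: "drawing (insert l U \<union> set ls) E' p' F'" "E1 \<subseteq> E'" "F1 - {{x, d, l}} \<subseteq> F'"
    "spokes x ls \<subseteq> E'" "pathE (l # ls) \<subseteq> E'" "pathF x (l # ls) \<subseteq> F'" by blast
  have "{x, y, l} \<noteq> {x, d, l}" using ds lU(1) tU by auto
  then have f2: "{x, y, l} \<in> F'" using f(2) IH(3) by blast
  have "s \<noteq> {x, d, l}" if "s \<in> F" for s using drawingD(5)[OF Cons.prems(1) that] lU(1) by blast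
  then have f3: "F - {?t} \<subseteq> F'" using IH(3) unfolding F1_def by blast
  have e: "{x, l} \<in> E1" "{y, l} \<in> E1" unfolding E1_def by (auto simp: insert_commute)
  have "insert l U \<union> set ls = U \<union> set (l # ls)" by auto
  moreover have "E \<subseteq> E'" using IH(2) unfolding E1_def by blast
  moreover have "spokes x (l # ls) \<subseteq> E'" using e(1) IH(2,4) by (auto simp: spokes_def)
  moreover have "pathE (y # l # ls) \<subseteq> E'" using e(2) IH(2,5) by auto
  moreover have "pathF x (y # l # ls) \<subseteq> F'" using f2 IH(6) by auto
  ultimately show ?case using IH(1) f3 by metis
qed

text \<open>A triangle on the fixed corners \<open>d0\<close> and \<open>d1\<close> is kept in
  reserve. Inserting the next hub \<open>x\<close> gives the next reserve \<open>{d0, d1, x}\<close>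
  and the triangle \<open>{x, d1, y}\<close> for the fan of \<open>x\<close>. Faces of earlier fans
  survive because they avoid \<open>d0\<close>.\<close>

lemma drawing_fans:
  assumes "distinct (verts gs)" "distinct [d0, d1, d2]" "set (verts gs) \<inter> {d0, d1, d2} = {}"
  shows "\<exists>E p F y. drawing ({d0, d1, d2} \<union> set (verts gs)) E p F \<and> {d0, d1, y} \<in> F \<and>
    fans gs \<subseteq> E \<and> (\<forall>(x, ls)\<in>set gs. pathF x ls \<subseteq> F)"
  using assms
proof (induction gs)
  case Nil
  then show ?case using drawing_triangle[of d0 d1 d2] by auto
next
  case (Cons g gs)
  obtain x ls where g: "g = (x, ls)" by (cases g)
  let ?U = "{d0, d1, d2} \<union> set (verts gs)"
  have pr: "distinct (verts gs)" "set (verts gs) \<inter> {d0, d1, d2} = {}" "x \<notin> ?U" "distinct ls" "set ls \<inter> insert x ?U = {}"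
    using Cons.prems unfolding g by auto
  obtain E p F y where IH: "drawing ?U E p F" "{d0, d1, y} \<in> F" "fans gs \<subseteq> E" "\<forall>(x, ls)\<in>set gs. pathF x ls \<subseteq> F"
    using Cons.IH[OF pr(1) Cons.prems(2) pr(2)] by blast
  let ?t = "{d0, d1, y}"
  have tU: "?t \<subseteq> ?U" "card ?t = 3" using drawingD(5,6)[OF IH(1,2)] by auto
  then have ds: "d0 \<noteq> d1" "d0 \<noteq> y" "d1 \<noteq> y" by (auto simp: card_insert_if split: if_splits)
  obtain p1 where d1: "drawing (insert x ?U) (E \<union> (\<lambda>v. {x, v}) ` ?t) p1 ((F - {?t}) \<union> (\<lambda>v. insert x (?t - {v})) ` ?t)"
    using drawing_insert[OF IH(1,2) pr(3)] by blast
  define E1 where "E1 = E \<union> (\<lambda>v. {x, v}) ` ?t"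
  define F1 where "F1 = (F - {?t}) \<union> (\<lambda>v. insert x (?t - {v})) ` ?t"
  have d1': "drawing (insert x ?U) E1 p1 F1" using d1 unfolding E1_def F1_def .
  have "insert x (?t - {y}) \<in> F1" "insert x (?t - {d0}) \<in> F1" unfolding F1_def by blast+
  moreover have "insert x (?t - {y}) = {d0, d1, x}" "insert x (?t - {d0}) = {x, d1, y}" using ds by auto
  ultimately have f: "{d0, d1, x} \<in> F1" "{x, d1, y} \<in> F1" by simp_all
  from drawing_fan[OF d1' f(2) pr(4,5)] obtain E' p' F' where
    D: "drawing (insert x ?U \<union> set ls) E' p' F'" "E1 \<subseteq> E'" "F1 - {{x, d1, y}} \<subseteq> F'"
    "spokes x ls \<subseteq> E'" "pathE (y # ls) \<subseteq> E'" "pathF x (y # ls) \<subseteq> F'" by blast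
  have "{d0, d1, x} \<noteq> {x, d1, y}" using ds pr(3) by auto
  then have 1: "{d0, d1, x} \<in> F'" using f(1) D(3) by blast
  have 2: "s \<in> F'" if s: "s \<in> F" "d0 \<notin> s" for s
  proof -
    have "s \<noteq> ?t" using s(2) by blast
    moreover have "s \<noteq> {x, d1, y}" using drawingD(5)[OF IH(1) s(1)] pr(3) by blast
    ultimately show ?thesis using D(3) s(1) unfolding F1_def by blast
  qed
  have 3: "pathF x' ls' \<subseteq> F'" if m: "(x', ls') \<in> set gs" for x' ls'
  proof
    fix s assume s: "s \<in> pathF x' ls'"
    have "insert x' (set ls') \<subseteq> set (verts gs)" using m by (force simp: verts_def)
    then have "d0 \<notin> s" using pathF_sub[OF s] pr(2) by auto
    then show "s \<in> F'" using 2 s IH(4) m by blast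
  qed
  have 4: "pathE ls \<subseteq> E'" "pathF x ls \<subseteq> F'" using D(5,6) by (cases ls; auto)+
  have 5: "fans ((x, ls) # gs) \<subseteq> E'" using 4 D(2,4) IH(3) unfolding E1_def by (auto simp: fan_def)
  have 6: "insert x ?U \<union> set ls = {d0, d1, d2} \<union> set (verts ((x, ls) # gs))" by auto
  show ?case unfolding g using D(1)[unfolded 6] 1 5 3 4(2) by (intro exI[of _ E'] exI[of _ p'] exI[of _ F'] exI[of _ x]) auto
qed

text \<open>Certifies every move of the opening: it suffices to fit Constructor's edges into
  disjoint fans for some order of the leaves. The three auxiliary corners are chosen above all
  vertices in use.\<close>

lemma fans_planar:
  assumes "distinct (verts gs)" "C \<subseteq> fans gs" "C \<subseteq> Kn_edges n"
  shows "planar_graph {0..<n} C"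
proof -
  define m where "m = Suc (Max (insert 0 (set (verts gs))))"
  have "v < m" if "v \<in> set (verts gs)" for v using that unfolding m_def by (simp add: le_imp_less_Suc)
  then have "set (verts gs) \<inter> {m, m + 1, m + 2} = {}" by fastforce
  moreover have "distinct [m, m + 1, m + 2]" by simp
  ultimately obtain E p F where "drawing ({m, m + 1, m + 2} \<union> set (verts gs)) E p F" "fans gs \<subseteq> E"
    using drawing_fans[OF assms(1)] by metis
  then show ?thesis using drawing_planar assms(2,3) by blast
qed

section \<open>Constructor's opening\<close>

definition pos :: "nat \<Rightarrow> nat \<Rightarrow> nat set set \<Rightarrow> nat set set \<Rightarrow> bool" where
  "pos n c C B \<longleftrightarrow> C \<subseteq> Kn_edges n \<and> B \<subseteq> Kn_edges n \<and> card C = c \<and> card B = c"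

lemma pos_finite: "pos n c C B \<Longrightarrow> finite C \<and> finite B"
  unfolding pos_def using finite_Kn finite_subset by blast

lemma force_pos:
  assumes p: "pos n c C B" and c: "2 * c + 1 < n choose 2"
    and e: "e \<in> Kn_edges n" "e \<notin> C" "e \<notin> B" "planar_graph {0..<n} (insert e C)"
    and f: "\<And>f. f \<notin> B \<Longrightarrow> pos n (Suc c) (insert e C) (insert f B) \<Longrightarrow> force n Q (insert e C) (insert f B)"
  shows "force n Q C B"
proof (rule force_move[OF e])
  show fin: "finite C" "finite B" using pos_finite[OF p] by auto
  show "card C + card B + 1 < n choose 2" using p c by (simp add: pos_def)
  fix f assume "f \<in> Kn_edges n" "f \<notin> insert e C" "f \<notin> B"
  moreover from this have "pos n (Suc c) (insert e C) (insert f B)" using p e fin by (simp add: pos_def)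
  ultimately show "force n Q (insert e C) (insert f B)" using f by blast
qed

text \<open>The leaves 0 to 5 carry the two paths; the other ten are left over. With k leaves and k
  Blocker edges among them, the second call of \<open>stage_path\<close> asks for 2(k + 2) < 3(k -
  3), that is k > 13; 16 satisfies this.\<close>

definition good :: "nat set set \<Rightarrow> nat \<times> nat list \<Rightarrow> bool" where
  "good C = (\<lambda>(x, ls). length ls = 16 \<and> spokes x ls \<subseteq> C \<and>
     {ls ! 0, ls ! 1} \<in> C \<and> {ls ! 1, ls ! 2} \<in> C \<and> {ls ! 3, ls ! 4} \<in> C \<and> {ls ! 4, ls ! 5} \<in> C)"

lemma good_mono: "good C g \<Longrightarrow> C \<subseteq> C' \<Longrightarrow> good C' g"
  by (auto simp: good_def)

text \<open>\<open>gs\<close> are the finished gadgets. The current one has hub \<open>x\<close>, leaves \<open>pre\<close> already arranged in rim order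
  and further leaves \<open>rs\<close> in arbitrary order; each side has made \<open>c\<close> moves, and \<open>h\<close> bounds the number of
  Blocker edges inside \<open>rs\<close>.\<close>

definition stage :: "nat \<Rightarrow> (nat \<times> nat list) list \<Rightarrow> nat \<Rightarrow> nat list \<Rightarrow> nat list \<Rightarrow> nat \<Rightarrow> nat \<Rightarrow>
    nat set set \<Rightarrow> nat set set \<Rightarrow> bool" where
  "stage n gs x pre rs c h C B \<longleftrightarrow> distinct (x # pre @ rs @ verts gs) \<and>
     set (x # pre @ rs @ verts gs) \<subseteq> {..<n} \<and> C \<subseteq> fans gs \<union> fan x pre \<union> spokes x rs \<and>
     spokes x (pre @ rs) \<subseteq> C \<and> (\<forall>g\<in>set gs. good C g) \<and> pos n c C B \<and> card {e \<in> B. e \<subseteq> set rs} \<le> h"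

lemma fan_append_sub:
  "fan x pre \<subseteq> fan x (pre @ l)" "spokes x (pre @ l) = spokes x pre \<union> spokes x l"
  using pathE_append1[of pre l] by (auto simp: fan_def spokes_def)

lemma card_Union_edges:
  assumes "B \<subseteq> Kn_edges n"
  shows "card (\<Union>B) \<le> 2 * card B" "finite (\<Union>B)"
proof -
  have fin: "finite B" using assms finite_Kn finite_subset by blast
  have e: "finite e \<and> card e = 2" if "e \<in> B" for e
  proof -
    have "card e = 2" using that assms by (auto simp: Kn_edges_pairs pairs_def)
    moreover from this have "finite e" by (intro card_ge_0_finite) simp
    ultimately show ?thesis by simp
  qed
  then show "finite (\<Union>B)" using fin by blast
  have "card (\<Union>B) \<le> (\<Sum>e\<in>B. card e)" using card_Union_le_sum_card[of B] by simp
  also have "\<dots> = 2 * card B" using e by simp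
  finally show "card (\<Union>B) \<le> 2 * card B" .
qed

text \<open>The new leaf is a vertex that Blocker has not touched, so only his answer can add a
  Blocker edge among the leaves. His c edges touch at most 2c vertices, which is where the bound on
  n comes from.\<close>

lemma stage_spoke:
  assumes s: "stage n gs x [] rs c h C B" and c: "2 * c + 1 < n choose 2"
    and n: "1 + length rs + length (verts gs) + 2 * c < n"
  shows "force n (\<lambda>C' B'. \<exists>l. stage n gs x [] (rs @ [l]) (Suc c) (Suc h) C' B') C B"
proof -
  have st: "distinct (x # rs @ verts gs)" "set (x # rs @ verts gs) \<subseteq> {..<n}" "C \<subseteq> fans gs \<union> spokes x rs"
    "spokes x rs \<subseteq> C" "\<forall>g\<in>set gs. good C g" "pos n c C B" "card {e \<in> B. e \<subseteq> set rs} \<le> h"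
    using s unfolding stage_def by (auto simp: fan_def spokes_def)
  have BK: "B \<subseteq> Kn_edges n" "card B = c" "C \<subseteq> Kn_edges n" using st(6) by (auto simp: pos_def)
  let ?A = "set (x # rs @ verts gs) \<union> \<Union>B"
  have "card ?A \<le> card (set (x # rs @ verts gs)) + card (\<Union>B)" by (rule card_Un_le)
  also have "\<dots> \<le> length (x # rs @ verts gs) + 2 * c"
    using card_Union_edges(1)[OF BK(1)] card_length[of "x # rs @ verts gs"] BK(2) by linarith
  also have "\<dots> < card {..<n}" using n by simp
  finally have lt: "card ?A < card {..<n}" .
  have "finite ?A" using card_Union_edges(2)[OF BK(1)] by simp
  then have "\<not> {..<n} \<subseteq> ?A" using lt card_mono leD by blast
  then obtain l where l: "l < n" "l \<notin> set (x # rs @ verts gs)" "l \<notin> \<Union>B" by auto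
  have d: "distinct (verts ((x, rs @ [l]) # gs))" using st(1) l(2) by auto
  have lC: "{x, l} \<notin> C"
  proof
    assume "{x, l} \<in> C"
    then have "{x, l} \<in> fans gs \<or> {x, l} \<in> spokes x rs" using st(3) by blast
    then show False using fans_sub[of "{x, l}" gs] l(2) by (auto simp: spokes_def doubleton_eq_iff)
  qed
  have lK: "{x, l} \<in> Kn_edges n" using l st(2) by (auto simp: doubleton_in_Kn)
  have Cs: "insert {x, l} C \<subseteq> fans gs \<union> spokes x (rs @ [l])" using st(3) by (auto simp: spokes_def)
  also have "\<dots> \<subseteq> fans ((x, rs @ [l]) # gs)" using spokes_fan by auto
  finally have pl: "planar_graph {0..<n} (insert {x, l} C)"
    using fans_planar[OF d] lK BK(3) by simp
  show ?thesis
  proof (rule force_pos[OF st(6) c lK lC _ pl])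
    show "{x, l} \<notin> B" using l(3) by auto
    fix f assume f: "pos n (Suc c) (insert {x, l} C) (insert f B)"
    have "{e \<in> insert f B. e \<subseteq> set (rs @ [l])} \<subseteq> insert f {e \<in> B. e \<subseteq> set rs}" using l(3) by auto
    moreover have fin: "finite {e \<in> B. e \<subseteq> set rs}" using pos_finite[OF st(6)] by simp
    ultimately have "card {e \<in> insert f B. e \<subseteq> set (rs @ [l])} \<le> card (insert f {e \<in> B. e \<subseteq> set rs})" by (intro card_mono) auto
    also have "\<dots> \<le> Suc h" using st(7) fin by (simp add: card_insert_if)
    finally have h: "card {e \<in> insert f B. e \<subseteq> set (rs @ [l])} \<le> Suc h" .
    have "distinct (x # [] @ (rs @ [l]) @ verts gs)" "set (x # [] @ (rs @ [l]) @ verts gs) \<subseteq> {..<n}"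
      using st(1,2) l(1,2) by auto
    moreover have "insert {x, l} C \<subseteq> fans gs \<union> fan x [] \<union> spokes x (rs @ [l])" using Cs by blast
    moreover have "spokes x ([] @ rs @ [l]) \<subseteq> insert {x, l} C" using st(4) by (auto simp: spokes_def)
    moreover have "\<forall>g\<in>set gs. good (insert {x, l} C) g" using st(5) good_mono[of C _ "insert {x, l} C"] by blast
    ultimately have "stage n gs x [] (rs @ [l]) (Suc c) (Suc h) (insert {x, l} C) (insert f B)"
      unfolding stage_def using f h by (intro conjI)
    then show "force n (\<lambda>C' B'. \<exists>l. stage n gs x [] (rs @ [l]) (Suc c) (Suc h) C' B') (insert {x, l} C) (insert f B)"
      by (intro force.base exI)
  qed
qed

lemma card_blocked:
  assumes "finite F"
  shows "card {v. {b, v} \<in> F} \<le> degree F b" "finite {v. {b, v} \<in> F}"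
proof -
  have inj: "inj_on (\<lambda>v. {b, v}) {v. {b, v} \<in> F}" by (auto simp: inj_on_def doubleton_eq_iff)
  have sub: "(\<lambda>v. {b, v}) ` {v. {b, v} \<in> F} \<subseteq> {e \<in> F. b \<in> e}" by auto
  show "card {v. {b, v} \<in> F} \<le> degree F b" unfolding degree_def
    by (rule card_inj_on_le[OF inj sub]) (use assms in auto)
  show "finite {v. {b, v} \<in> F}" by (rule inj_on_finite[OF inj sub]) (use assms in auto)
qed

text \<open>The middle vertex \<open>b\<close> has few Blocker edges to the other leaves, so
  suitable neighbours remain even after the answer to the first path edge. Leaves in
  \<open>rs\<close> carry only spokes, so their order around the hub is still free and the path can
  be placed next to \<open>pre\<close>.\<close>

lemma stage_path:
  assumes s: "stage n gs x pre rs c h C B" and c: "2 * c + 3 < n choose 2"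
    and rs: "6 \<le> length rs" "2 * h < 3 * length rs"
  shows "force n (\<lambda>C' B'. \<exists>a b d rs'. stage n gs x (pre @ [a, b, d]) rs' (c + 2) (h + 2) C' B' \<and>
    C \<subseteq> C' \<and> {a, b} \<in> C' \<and> {b, d} \<in> C' \<and> length rs' = length rs - 3) C B" (is "force n ?Q C B")
proof -
  have st: "distinct (x # pre @ rs @ verts gs)" "set (x # pre @ rs @ verts gs) \<subseteq> {..<n}"
    "C \<subseteq> fans gs \<union> fan x pre \<union> spokes x rs"
    "spokes x (pre @ rs) \<subseteq> C" "\<forall>g\<in>set gs. good C g" "pos n c C B" "card {e \<in> B. e \<subseteq> set rs} \<le> h"
    using s unfolding stage_def by auto
  have BK: "B \<subseteq> Kn_edges n" "C \<subseteq> Kn_edges n" using st(6) by (auto simp: pos_def)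
  have finB: "finite B" using pos_finite[OF st(6)] by simp
  let ?F = "{e \<in> B. e \<subseteq> set rs}"
  have dr: "distinct rs" using st(1) by simp
  then have cr: "card (set rs) = length rs" by (rule distinct_card)
  have e2: "card e = 2" if "e \<in> ?F" for e using that BK by (auto simp: Kn_edges_pairs pairs_def)
  have ne: "set rs \<noteq> {}" using rs by auto
  have finF: "finite ?F" using finB by simp
  obtain b where b: "b \<in> set rs" "card (set rs) * degree ?F b \<le> 2 * card ?F"
    using low_degree[OF finite_set ne finF e2] by blast
  \<comment> \<open>The average Blocker degree inside \<open>rs\<close> is at most 2h divided by the
    number of leaves, which is below 3.\<close>
  have "length rs * degree ?F b < length rs * 3" using b(2)[unfolded cr] st(7) rs(2) by linarith
  then have deg: "degree ?F b \<le> 2" by simp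
  define K where "K = {v. {b, v} \<in> ?F}"
  have K: "card K \<le> 2" "finite K" using card_blocked[of ?F b] finB deg unfolding K_def by auto
  have free: "\<exists>v\<in>set rs. v \<notin> Z" if "card Z < length rs" "finite Z" for Z
  proof (rule ccontr)
    assume "\<not> ?thesis"
    then have "card (set rs) \<le> card Z" using that(2) by (intro card_mono) auto
    then show False using that(1) cr by simp
  qed
  have "card (insert b K) < length rs" using K rs by (simp add: card_insert_if)
  then obtain a where a: "a \<in> set rs" "a \<noteq> b" "a \<notin> K" using free[of "insert b K"] K by auto
  have abB: "{a, b} \<notin> B" using a b by (auto simp: K_def insert_commute)
  have new: "{u, v} \<notin> C" if "u \<in> set rs" "v \<in> set rs" for u v
  proof
    assume "{u, v} \<in> C"
    then consider "{u, v} \<in> fans gs" | "{u, v} \<in> fan x pre" | "{u, v} \<in> spokes x rs" using st(3) by blast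
    then show False
    proof cases
      case 1
      then show ?thesis using fans_sub[OF 1] that st(1) by auto
    next
      case 2
      then show ?thesis using fan_sub[OF 2] that st(1) by auto
    next
      case 3
      then show ?thesis using that st(1) by (auto simp: spokes_def doubleton_eq_iff)
    qed
  qed
  have inK: "{u, v} \<in> Kn_edges n" if "u \<in> set rs" "v \<in> set rs" "u \<noteq> v" for u v
    using that st(2) by (auto simp: doubleton_in_Kn)
  \<comment> \<open>Reordering the leaves so that the new path comes first among them turns
    Constructor's graph into a subgraph of fans.\<close>
  have planar: "planar_graph {0..<n} C'" if l: "set l \<union> set rs' = set rs" "distinct (l @ rs')"
    and C': "C' \<subseteq> C \<union> pathE l" "C' \<subseteq> Kn_edges n" for l rs' C'
  proof (rule fans_planar[OF _ _ C'(2)])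
    show "distinct (verts ((x, pre @ l @ rs') # gs))" using st(1) l by auto
    have 1: "fan x pre \<subseteq> fan x (pre @ l @ rs')" by (rule fan_append_sub)
    have "spokes x rs = spokes x (l @ rs')" using l(1) by (simp add: spokes_def)
    then have 2: "spokes x rs \<subseteq> fan x (pre @ l @ rs')" by (auto simp: fan_def spokes_def)
    have "pathE l \<subseteq> pathE (pre @ l @ rs')" using pathE_append1[of l rs'] pathE_append2[of "l @ rs'" pre] by blast
    then have 3: "pathE l \<subseteq> fan x (pre @ l @ rs')" by (auto simp: fan_def)
    show "C' \<subseteq> fans ((x, pre @ l @ rs') # gs)" unfolding fans_simps using C'(1) st(3) 1 2 3 by blast
  qed
  have pl1: "planar_graph {0..<n} (insert {a, b} C)"
    by (rule planar[of "[a, b]" "filter (\<lambda>v. v \<notin> {a, b}) rs"]) (use a b dr BK inK[OF a(1) b(1) a(2)] in auto)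
  show ?thesis
  proof (rule force_pos[OF st(6) _ inK[OF a(1) b(1) a(2)] new[OF a(1) b(1)] abB pl1])
    show "2 * c + 1 < n choose 2" using c by simp
    fix f assume f: "pos n (Suc c) (insert {a, b} C) (insert f B)"
    let ?C1 = "insert {a, b} C" and ?B1 = "insert f B"
    have C1K: "?C1 \<subseteq> Kn_edges n" using f by (simp add: pos_def)
    define K1 where "K1 = {v. {b, v} = f}"
    have K1: "card K1 \<le> 1" "finite K1"
    proof -
      have "K1 \<subseteq> {THE v. {b, v} = f}" unfolding K1_def by (auto simp: doubleton_eq_iff intro!: the_equality[symmetric])
      then show "card K1 \<le> 1" "finite K1" using card_mono[of "{THE v. {b, v} = f}" K1] finite_subset by auto
    qed
    \<comment> \<open>Excluded for \<open>d\<close> are \<open>a\<close>, \<open>b\<close>, at most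
      two earlier Blocker neighbours of \<open>b\<close> and at most one new one: five vertices,
      hence six leaves are required.\<close>
    have "card (insert a (insert b (K \<union> K1))) \<le> 2 + card (K \<union> K1)" using K K1 by (simp add: card_insert_if)
    also have "\<dots> \<le> 5" using card_Un_le[of K K1] K K1 by linarith
    finally have "card (insert a (insert b (K \<union> K1))) < length rs" using rs by simp
    then obtain d where d: "d \<in> set rs" "d \<noteq> a" "d \<noteq> b" "d \<notin> K" "d \<notin> K1"
      using free[of "insert a (insert b (K \<union> K1))"] K K1 by auto
    have bdB: "{b, d} \<notin> ?B1" using d b by (auto simp: K_def K1_def)
    have bdC: "{b, d} \<notin> ?C1" using new[OF b(1) d(1)] d a by (auto simp: doubleton_eq_iff)
    have bdK: "{b, d} \<in> Kn_edges n" using inK[OF b(1) d(1)] d(3) by simp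
    define rs3 where "rs3 = filter (\<lambda>v. v \<notin> {a, b, d}) rs"
    have rs3: "set rs3 = set rs - {a, b, d}" "distinct rs3" using dr by (auto simp: rs3_def)
    have pl2: "planar_graph {0..<n} (insert {b, d} ?C1)"
      by (rule planar[of "[a, b, d]" rs3]) (use a b d rs3 C1K bdK in auto)
    show "force n ?Q ?C1 ?B1"
    proof (rule force_pos[OF f _ bdK bdC bdB pl2])
      show "2 * Suc c + 1 < n choose 2" using c by simp
      fix f' assume f': "pos n (Suc (Suc c)) (insert {b, d} ?C1) (insert f' ?B1)"
      let ?C2 = "insert {b, d} ?C1" and ?B2 = "insert f' ?B1"
      have lr: "length rs3 = length rs - 3"
      proof -
        have "length rs3 = card (set rs - {a, b, d})" using rs3 distinct_card by metis
        also have "\<dots> = card (set rs) - card {a, b, d}" using a b d by (intro card_Diff_subset) auto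
        also have "card {a, b, d} = 3" using a d by auto
        finally show ?thesis using cr by simp
      qed
      have "{e \<in> ?B2. e \<subseteq> set rs3} \<subseteq> insert f' (insert f ?F)" using rs3(1) by auto
      then have "card {e \<in> ?B2. e \<subseteq> set rs3} \<le> card (insert f' (insert f ?F))" using finB by (intro card_mono) auto
      also have "\<dots> \<le> h + 2" using st(7) finB by (simp add: card_insert_if)
      finally have h2: "card {e \<in> ?B2. e \<subseteq> set rs3} \<le> h + 2" .
      have "set rs = set [a, b, d] \<union> set rs3" using a b d rs3(1) by auto
      then have sp: "spokes x rs = spokes x [a, b, d] \<union> spokes x rs3" unfolding spokes_def by (simp only: image_Un)
      have "pathE [a, b, d] \<subseteq> pathE (pre @ [a, b, d])" by (rule pathE_append2)
      then have pe: "{a, b} \<in> fan x (pre @ [a, b, d])" "{b, d} \<in> fan x (pre @ [a, b, d])" by (auto simp: fan_def)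
      have "fan x pre \<subseteq> fan x (pre @ [a, b, d])" by (rule fan_append_sub)
      moreover have "spokes x [a, b, d] \<subseteq> fan x (pre @ [a, b, d])" by (auto simp: fan_def spokes_def)
      ultimately have C2: "?C2 \<subseteq> fans gs \<union> fan x (pre @ [a, b, d]) \<union> spokes x rs3"
        using st(3) sp pe by blast
      have sp2: "spokes x ((pre @ [a, b, d]) @ rs3) \<subseteq> ?C2" 
        unfolding append_assoc fan_append_sub(2)[of x pre] fan_append_sub(2)[of x "[a, b, d]" rs3] sp[symmetric]
        using st(4) unfolding fan_append_sub(2) by blast
      have dd: "distinct (x # (pre @ [a, b, d]) @ rs3 @ verts gs)" using st(1) a b d rs3 by auto
      have sn: "set (x # (pre @ [a, b, d]) @ rs3 @ verts gs) \<subseteq> {..<n}" using st(2) a b d rs3 by auto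
      have gd: "\<forall>g\<in>set gs. good ?C2 g" using st(5) good_mono[of C _ ?C2] by auto
      have f2: "pos n (c + 2) ?C2 ?B2" using f' by simp
      have "stage n gs x (pre @ [a, b, d]) rs3 (c + 2) (h + 2) ?C2 ?B2"
        unfolding stage_def by (intro conjI dd sn C2 sp2 gd f2 h2)
      then have "?Q ?C2 ?B2" using lr by blast
      then show "force n ?Q ?C2 ?B2" by (rule force.base)
    qed
  qed
qed

text \<open>A gadget takes 20 moves: 16 spokes and two edges for each of the two paths.\<close>

definition gadgets :: "nat \<Rightarrow> nat \<Rightarrow> nat set set \<Rightarrow> nat set set \<Rightarrow> bool" where
  "gadgets n k C B \<longleftrightarrow> (\<exists>gs. length gs = k \<and> distinct (verts gs) \<and> set (verts gs) \<subseteq> {..<n} \<and>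
     C \<subseteq> fans gs \<and> (\<forall>g\<in>set gs. good C g) \<and> pos n (20 * k) C B)"

lemma length_verts:
  assumes "\<forall>g\<in>set gs. good C g"
  shows "length (verts gs) = 17 * length gs"
  using assms by (induction gs) (auto simp: good_def)

lemma choose_two_ge: "100 \<le> n \<Longrightarrow> 49 * n \<le> n choose 2"
proof -
  assume "100 \<le> n"
  then have "n * 98 \<le> n * (n - 1)" by (intro mult_left_mono) auto
  then have "n * 98 div 2 \<le> n * (n - 1) div 2" by (rule div_le_mono)
  then show ?thesis unfolding choose_two by simp
qed

lemma stage_spokes:
  assumes s: "stage n gs x [] [] c 0 C B" and c: "2 * (c + k) + 1 < n choose 2"
    and n: "1 + k + length (verts gs) + 2 * (c + k) < n"
  shows "force n (\<lambda>C' B'. \<exists>rs. length rs = k \<and> stage n gs x [] rs (c + k) k C' B') C B"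
  using c n
proof (induction k)
  case 0
  then show ?case using s by (intro force.base) auto
next
  case (Suc k)
  have "force n (\<lambda>C' B'. \<exists>rs. length rs = k \<and> stage n gs x [] rs (c + k) k C' B') C B"
    using Suc by auto
  then show ?case
  proof (rule force_trans)
    fix C B assume "\<exists>rs. length rs = k \<and> stage n gs x [] rs (c + k) k C B"
    then obtain rs where rs: "length rs = k" "stage n gs x [] rs (c + k) k C B" by blast
    have "force n (\<lambda>C' B'. \<exists>l. stage n gs x [] (rs @ [l]) (Suc (c + k)) (Suc k) C' B') C B"
      by (rule stage_spoke[OF rs(2)]) (use Suc.prems rs(1) in auto)
    then show "force n (\<lambda>C' B'. \<exists>rs. length rs = Suc k \<and> stage n gs x [] rs (c + Suc k) (Suc k) C' B') C B"
    proof (rule force_trans)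
      fix C B assume "\<exists>l. stage n gs x [] (rs @ [l]) (Suc (c + k)) (Suc k) C B"
      then obtain l where "stage n gs x [] (rs @ [l]) (Suc (c + k)) (Suc k) C B" by blast
      then show "force n (\<lambda>C' B'. \<exists>rs. length rs = Suc k \<and> stage n gs x [] rs (c + Suc k) (Suc k) C' B') C B"
        using rs(1) by (intro force.base exI[of _ "rs @ [l]"]) simp
    qed
  qed
qed

text \<open>The two calls of \<open>stage_path\<close> start with 16 leaves and at most 16 Blocker
  edges among them, then with 13 leaves and at most 18; 32 < 48 and 36 < 39.\<close>

lemma gadgets_step:
  assumes g: "gadgets n k C B" and n: "100 \<le> n" "100 * Suc k \<le> n"
  shows "force n (gadgets n (Suc k)) C B"
proof -
  obtain gs where gs: "length gs = k" "distinct (verts gs)" "set (verts gs) \<subseteq> {..<n}" "C \<subseteq> fans gs"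
    "\<forall>g\<in>set gs. good C g" "pos n (20 * k) C B" using g unfolding gadgets_def by blast
  have lv: "length (verts gs) = 17 * k" using length_verts[OF gs(5)] gs(1) by simp
  have ch: "49 * n \<le> n choose 2" by (rule choose_two_ge[OF n(1)])
  have "card (set (verts gs)) < card {..<n}" using card_length[of "verts gs"] lv n by simp
  then have "\<not> {..<n} \<subseteq> set (verts gs)" using card_mono leD by blast
  then obtain x where x: "x < n" "x \<notin> set (verts gs)" by auto
  have empty: "{e \<in> B. e \<subseteq> {}} = {}" using gs(6) by (auto simp: pos_def Kn_edges_pairs pairs_def)
  have "stage n gs x [] [] (20 * k) 0 C B"
    unfolding stage_def using gs x empty by (auto simp: fan_def spokes_def)
  then have 1: "force n (\<lambda>C' B'. \<exists>rs. length rs = 16 \<and> stage n gs x [] rs (20 * k + 16) 16 C' B') C B"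
    by (rule stage_spokes) (use n ch lv in auto)
  show ?thesis
  proof (rule force_trans[OF 1])
    fix C B assume "\<exists>rs. length rs = 16 \<and> stage n gs x [] rs (20 * k + 16) 16 C B"
    then obtain rs where rs: "length rs = 16" "stage n gs x [] rs (20 * k + 16) 16 C B" by blast
    show "force n (gadgets n (Suc k)) C B"
    proof (rule force_trans[OF stage_path[OF rs(2)]])
      show "2 * (20 * k + 16) + 3 < n choose 2" using n ch by simp
      show "6 \<le> length rs" "2 * 16 < 3 * length rs" using rs by simp_all
      fix C1 B1 assume "\<exists>a b d rs'. stage n gs x ([] @ [a, b, d]) rs' (20 * k + 16 + 2) (16 + 2) C1 B1 \<and>
        C \<subseteq> C1 \<and> {a, b} \<in> C1 \<and> {b, d} \<in> C1 \<and> length rs' = length rs - 3"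
      then obtain a b d rs1 where s1: "stage n gs x ([] @ [a, b, d]) rs1 (20 * k + 16 + 2) (16 + 2) C1 B1"
        "{a, b} \<in> C1" "{b, d} \<in> C1" "length rs1 = 13" using rs(1) by auto
      show "force n (gadgets n (Suc k)) C1 B1"
      proof (rule force_trans[OF stage_path[OF s1(1)]])
        show "2 * (20 * k + 16 + 2) + 3 < n choose 2" using n ch by simp
        show "6 \<le> length rs1" "2 * (16 + 2) < 3 * length rs1" using s1 by simp_all
        fix C2 B2 assume "\<exists>a' b' d' rs'. stage n gs x (([] @ [a, b, d]) @ [a', b', d']) rs' (20 * k + 16 + 2 + 2) (16 + 2 + 2) C2 B2 \<and>
          C1 \<subseteq> C2 \<and> {a', b'} \<in> C2 \<and> {b', d'} \<in> C2 \<and> length rs' = length rs1 - 3"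
        then obtain a' b' d' rs2 where s2: "stage n gs x (([] @ [a, b, d]) @ [a', b', d']) rs2 (20 * k + 16 + 2 + 2) (16 + 2 + 2) C2 B2"
          "C1 \<subseteq> C2" "{a', b'} \<in> C2" "{b', d'} \<in> C2" "length rs2 = 10" using s1(4) by auto
        let ?pre = "[a, b, d, a', b', d']"
        let ?ls = "?pre @ rs2"
        have st: "distinct (x # ?ls @ verts gs)" "set (x # ?ls @ verts gs) \<subseteq> {..<n}"
          "C2 \<subseteq> fans gs \<union> fan x ?pre \<union> spokes x rs2"
          "spokes x ?ls \<subseteq> C2" "\<forall>g\<in>set gs. good C2 g" "pos n (20 * Suc k) C2 B2"
          using s2(1) unfolding stage_def append_Nil append_Cons append_assoc by simp_all
        have ab: "{a, b} \<in> C2" "{b, d} \<in> C2" using s1(2,3) s2(2) by auto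
        have "good C2 (x, ?ls)" unfolding good_def using st(4) ab s2(3-5) by simp
        moreover have "C2 \<subseteq> fans ((x, ?ls) # gs)"
          unfolding fans_simps using st(3) fan_append_sub(1)[of x ?pre rs2] spokes_fan[of x ?ls]
          unfolding fan_append_sub(2)[of x ?pre rs2] by blast
        ultimately have "gadgets n (Suc k) C2 B2" unfolding gadgets_def
          using st(1,2,5,6) gs(1) by (intro exI[of _ "(x, ?ls) # gs"] conjI) simp_all
        then show "force n (gadgets n (Suc k)) C2 B2" by (rule force.base)
      qed
    qed
  qed
qed

lemma force_gadgets:
  assumes "100 \<le> n" "100 * M \<le> n"
  shows "force n (gadgets n M) {} {}"
  using assms(2)
proof (induction M)
  case 0
  show ?case by (rule force.base) (auto simp: gadgets_def pos_def)
next
  case (Suc M)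
  then have "force n (gadgets n M) {} {}" by simp
  then show ?case by (rule force_trans) (use gadgets_step[OF _ assms(1) Suc.prems] in blast)
qed

section \<open>Inserting vertices\<close>

text \<open>Slots of a gadget: hub \<open>0\<close>, and the two rim paths \<open>1\<close>--\<open>2\<close>--\<open>3\<close> and \<open>4\<close>--\<open>5\<close>--\<open>6\<close>; a pair
  \<open>(b, a)\<close> below stands for the face spanned by the slots \<open>0\<close>, \<open>b\<close>, \<open>a\<close>.\<close>

definition face_slots :: "(nat \<times> nat) set" where
  "face_slots = {(2, 1), (2, 3), (5, 4), (5, 6)}"

text \<open>The drawing may contain more than Constructor's graph: auxiliary vertices that are not below \<open>n\<close>, and
  edges that were never claimed.\<close>

definition insertion_state :: "nat \<Rightarrow> nat \<Rightarrow> nat \<Rightarrow> nat set set \<Rightarrow> nat set set \<Rightarrow>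
    nat set \<Rightarrow> nat set set \<Rightarrow> (nat \<Rightarrow> complex) \<Rightarrow> nat set set \<Rightarrow> (nat \<Rightarrow> nat \<Rightarrow> nat) \<Rightarrow> bool" where
  "insertion_state n M i C B U E p F v \<longleftrightarrow> drawing U E p F \<and> C \<subseteq> E \<and> pos n (20 * M + 3 * i) C B \<and>
     card (U \<inter> {..<n}) \<le> 17 * M + i \<and> (\<forall>j<M. \<forall>m<7. v j m \<in> U \<and> v j m < n) \<and>
     (\<forall>j<M. \<forall>j'<M. \<forall>m<7. \<forall>m'<7. v j m = v j' m' \<longrightarrow> j = j' \<and> m = m') \<and>
     (\<forall>j<M. \<forall>(b, a)\<in>face_slots. {v j 0, v j b, v j a} \<in> F \<and>
        {v j 0, v j b} \<in> C \<and> {v j 0, v j a} \<in> C \<and> {v j b, v j a} \<in> C) \<and>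
     3 * i \<le> triangles C"

text \<open>No edge of \<open>C\<close> contains \<open>w\<close>, so the three triangles through
  \<open>w\<close> cannot have been counted before.\<close>

lemma triangles_new_vertex:
  assumes C': "C' = insert {w, a} (insert {w, b} (insert {w, x} C))" "C' \<subseteq> Kn_edges n"
    and C: "{x, b} \<in> C" "{x, a} \<in> C" "{b, a} \<in> C" "\<And>e. e \<in> C \<Longrightarrow> w \<notin> e"
    and d: "x \<noteq> a" "x \<noteq> b" "a \<noteq> b"
  shows "triangles C + 3 \<le> triangles C'"
proof -
  let ?N = "{{w, x, b}, {w, x, a}, {w, b, a}}"
  have w: "w \<noteq> x" "w \<noteq> a" "w \<noteq> b" using C by auto
  have tri: "{w, s, t} \<in> triangle_sets C'" if "{w, s} \<in> C'" "{w, t} \<in> C'" "{s, t} \<in> C'" "s \<noteq> t" "w \<noteq> s" "w \<noteq> t" for s t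
    using that by (auto simp: triangle_sets_def insert_commute)
  have e: "{w, x} \<in> C'" "{w, b} \<in> C'" "{w, a} \<in> C'" "{x, b} \<in> C'" "{x, a} \<in> C'" "{b, a} \<in> C'"
    using C'(1) C by auto
  have "{w, x, b} \<in> triangle_sets C'" "{w, x, a} \<in> triangle_sets C'" "{w, b, a} \<in> triangle_sets C'"
    by (rule tri; use e d w in simp)+
  then have N: "?N \<subseteq> triangle_sets C'" by blast
  have old: "triangle_sets C \<subseteq> triangle_sets C'" by (rule triangle_sets_mono) (use C'(1) in auto)
  have CK: "C \<subseteq> Kn_edges n" using C' by auto
  have "w \<notin> T" if T: "T \<in> triangle_sets C" for T
  proof
    assume wT: "w \<in> T"
    have T3: "card T = 3" "\<forall>x\<in>T. \<forall>y\<in>T. x \<noteq> y \<longrightarrow> {x, y} \<in> C" using T by (auto simp: triangle_sets_def)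
    have "\<not> T \<subseteq> {w}"
    proof
      assume "T \<subseteq> {w}"
      then have "card T \<le> card {w}" by (intro card_mono) auto
      then show False using T3(1) by simp
    qed
    then obtain y where "y \<in> T" "y \<noteq> w" by blast
    then have "{w, y} \<in> C" using T3(2) wT by metis
    then show False using C(4) by blast
  qed
  then have disj: "triangle_sets C \<inter> ?N = {}" by blast
  have neq: "{w, x, b} \<noteq> {w, x, a}" "{w, x, b} \<noteq> {w, b, a}" "{w, x, a} \<noteq> {w, b, a}"
    using d w by (metis insertE insertI1 insertI2 singletonD)+
  have "card ?N = 3" using neq by simp
  then have "card (triangle_sets C \<union> ?N) = triangles C + 3"
    unfolding triangles_eq using disj triangle_sets_finite[OF graph_Kn_subset[OF CK]] by (subst card_Un_disjoint) auto
  moreover have "card (triangle_sets C \<union> ?N) \<le> triangles C'"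
    unfolding triangles_eq using N old triangle_sets_finite[OF graph_Kn_subset[OF C'(2)]] by (intro card_mono) auto
  ultimately show ?thesis by simp
qed

lemma insertion_step:
  assumes I: "insertion_state n M i C B U E p F v"
    and deg: "2 * (20 * M + 3 * i) < M * (n - 17 * M - i)" and c: "2 * (20 * M + 3 * i) + 5 < n choose 2"
  shows "force n (\<lambda>C' B'. \<exists>U E p F v. insertion_state n M (Suc i) C' B' U E p F v) C B" (is "force n ?Q C B")
proof -
  have dr: "drawing U E p F" and CE: "C \<subseteq> E" and ps: "pos n (20 * M + 3 * i) C B"
    and cU: "card (U \<inter> {..<n}) \<le> 17 * M + i"
    and v: "\<And>j m. j < M \<Longrightarrow> m < 7 \<Longrightarrow> v j m \<in> U \<and> v j m < n"
    and inj: "\<And>j j' m m'. j < M \<Longrightarrow> j' < M \<Longrightarrow> m < 7 \<Longrightarrow> m' < 7 \<Longrightarrow> v j m = v j' m' \<Longrightarrow> j = j' \<and> m = m'"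
    and fc: "\<And>j b a. j < M \<Longrightarrow> (b, a) \<in> face_slots \<Longrightarrow> {v j 0, v j b, v j a} \<in> F \<and>
        {v j 0, v j b} \<in> C \<and> {v j 0, v j a} \<in> C \<and> {v j b, v j a} \<in> C"
    and tr: "3 * i \<le> triangles C"
    using I unfolding insertion_state_def by auto
  have BK: "B \<subseteq> Kn_edges n" "C \<subseteq> Kn_edges n" "card B = 20 * M + 3 * i" using ps by (auto simp: pos_def)
  have finB: "finite B" using pos_finite[OF ps] by simp
  have B2: "card e = 2" if "e \<in> B" for e using that BK by (auto simp: Kn_edges_pairs pairs_def)
  define S where "S = {..<n} - U"
  have "card S = n - card (U \<inter> {..<n})" unfolding S_def by (simp add: card_Diff_subset_Int Int_commute)
  then have cS: "n - 17 * M - i \<le> card S" using cU by simp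
  have "card S \<noteq> 0" using deg cS by (metis le_zero_eq less_nat_zero_code mult_0_right)
  then have S: "finite S" "S \<noteq> {}" by (auto simp: S_def)
  obtain w where w: "w \<in> S" "card S * degree B w \<le> 2 * card B" using low_degree[OF S finB B2] by blast
  have "2 * card B < M * card S" unfolding BK(3) by (rule less_le_trans[OF deg mult_le_mono2[OF cS]])
  then have "card S * degree B w < card S * M" unfolding mult.commute[of M] by (rule le_less_trans[OF w(2)])
  then have dM: "degree B w < M" by simp
  have wn: "w < n" "w \<notin> U" using w(1) by (auto simp: S_def)
  \<comment> \<open>Pigeonhole: the gadgets occupy disjoint slots, so each spoiled gadget accounts
    for a separate Blocker edge at \<open>w\<close>, and there are fewer than \<open>M\<close> of
    those.\<close>
  have "\<exists>j<M. \<forall>m<7. {w, v j m} \<notin> B"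
  proof (rule ccontr)
    assume "\<not> ?thesis"
    then have "\<forall>j\<in>{..<M}. \<exists>m. m < 7 \<and> {w, v j m} \<in> B" by auto
    then obtain m where m: "\<And>j. j < M \<Longrightarrow> m j < 7 \<and> {w, v j (m j)} \<in> B" by (metis lessThan_iff)
    have "inj_on (\<lambda>j. {w, v j (m j)}) {..<M}"
    proof (rule inj_onI)
      fix j j' assume j: "j \<in> {..<M}" "j' \<in> {..<M}" "{w, v j (m j)} = {w, v j' (m j')}"
      have "v j (m j) \<noteq> w" "v j' (m j') \<noteq> w" using v m j wn(2) by auto
      then have "v j (m j) = v j' (m j')" using j(3) by (auto simp: doubleton_eq_iff)
      then show "j = j'" using inj[of j j' "m j" "m j'"] m[of j] m[of j'] j(1,2) by simp
    qed
    moreover have "(\<lambda>j. {w, v j (m j)}) ` {..<M} \<subseteq> {e \<in> B. w \<in> e}" using m by auto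
    ultimately have "card {..<M} \<le> card {e \<in> B. w \<in> e}" using finB by (intro card_inj_on_le) auto
    then show False using dM by (simp add: degree_def)
  qed
  then obtain j where j: "j < M" "\<And>m. m < 7 \<Longrightarrow> {w, v j m} \<notin> B" by blast
  have vj: "v j m \<in> U" "v j m < n" "w \<noteq> v j m" if "m < 7" for m using v[OF j(1) that] wn by auto
  have gE: "graph U E" by (rule drawingD(2)[OF dr])
  have wC: "w \<notin> e" if "e \<in> C" for e using that CE gE wn(2) by (auto simp: graph_def)
  have wK: "{w, v j m} \<in> Kn_edges n" if "m < 7" for m using vj[OF that] wn by (simp add: doubleton_in_Kn)
  have ne: "{w, v j m} \<noteq> {w, v j m'}" if "m < 7" "m' < 7" "m \<noteq> m'" for m m'
    using inj[OF j(1) j(1), of m m'] that by (auto simp: doubleton_eq_iff)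
  have slots: "b < 7" "a < 7" "0 < b" "0 < a" "a \<noteq> b" "b \<in> {2, 5}" "a \<in> {1, 3, 4, 6}" if "(b, a) \<in> face_slots" for b a
    using that by (auto simp: face_slots_def)
  have planar: "planar_graph {0..<n} C'" if ba: "(b, a) \<in> face_slots"
    and C': "C' \<subseteq> C \<union> {{w, v j 0}, {w, v j b}, {w, v j a}}" "C' \<subseteq> Kn_edges n" for b a C'
  proof -
    let ?t = "{v j 0, v j b, v j a}"
    obtain p' where d: "drawing (insert w U) (E \<union> (\<lambda>v. {w, v}) ` ?t) p' ((F - {?t}) \<union> (\<lambda>v. insert w (?t - {v})) ` ?t)"
      using drawing_insert[OF dr conjunct1[OF fc[OF j(1) ba]] wn(2)] by blast
    show ?thesis by (rule drawing_planar[OF d _ C'(2)]) (use C'(1) CE in auto)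
  qed
  have slot21: "(2, 1) \<in> face_slots" by (simp add: face_slots_def)
  let ?c = "20 * M + 3 * i" and ?e0 = "{w, v j 0}"
  show ?thesis
  proof (rule force_pos[OF ps, of ?e0])
    show "2 * ?c + 1 < n choose 2" using c by simp
    show K0: "?e0 \<in> Kn_edges n" "?e0 \<notin> C" "?e0 \<notin> B" using wK[of 0] wC j(2)[of 0] by auto
    \<comment> \<open>Every face of the gadget contains the hub, so any slot pair certifies the
      first edge; \<open>slot21\<close> commits to nothing.\<close>
    show "planar_graph {0..<n} (insert ?e0 C)" by (rule planar[OF slot21]) (use K0 BK in auto)
    fix f assume f: "pos n (Suc ?c) (insert ?e0 C) (insert f B)"
    \<comment> \<open>Blocker's single answer can touch only one of the two paths.\<close>
    have "\<exists>b a1 a2. (b, a1) \<in> face_slots \<and> (b, a2) \<in> face_slots \<and> a1 \<noteq> a2 \<and> f \<notin> {{w, v j b}, {w, v j a1}, {w, v j a2}}"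
    proof (cases "f \<in> {{w, v j 2}, {w, v j 1}, {w, v j 3}}")
      case True
      then obtain m where m: "f = {w, v j m}" "m < 4" by auto
      then have "f \<noteq> {w, v j 5}" "f \<noteq> {w, v j 4}" "f \<noteq> {w, v j 6}" using ne by simp_all
      then show ?thesis by (intro exI[of _ 5] exI[of _ 4] exI[of _ 6]) (simp add: face_slots_def)
    next
      case False
      then show ?thesis by (intro exI[of _ 2] exI[of _ 1] exI[of _ 3]) (simp add: face_slots_def)
    qed
    then obtain b a1 a2 where ba: "(b, a1) \<in> face_slots" "(b, a2) \<in> face_slots" "a1 \<noteq> a2"
      "f \<noteq> {w, v j b}" "f \<noteq> {w, v j a1}" "f \<noteq> {w, v j a2}" by blast
    let ?C1 = "insert ?e0 C" and ?B1 = "insert f B" and ?e1 = "{w, v j b}"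
    note sl1 = slots[OF ba(1)] and sl2 = slots[OF ba(2)]
    show "force n ?Q ?C1 ?B1"
    proof (rule force_pos[OF f, of ?e1])
      show "2 * Suc ?c + 1 < n choose 2" using c by simp
      show K1: "?e1 \<in> Kn_edges n" "?e1 \<notin> ?C1" "?e1 \<notin> ?B1"
        using wK[OF sl1(1)] wC ne[of b 0] sl1 j(2)[OF sl1(1)] ba(4) by auto
      show "planar_graph {0..<n} (insert ?e1 ?C1)" by (rule planar[OF ba(1)]) (use K0 K1 BK in auto)
      fix f' assume f': "pos n (Suc (Suc ?c)) (insert ?e1 ?C1) (insert f' ?B1)"
      \<comment> \<open>The middle vertex lies in two faces, one for each end of its path, and one
        answer denies at most one end.\<close>
      have "f' \<noteq> {w, v j a1} \<or> f' \<noteq> {w, v j a2}" using ne[OF sl1(2) sl2(2) ba(3)] by auto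
      then obtain a where a: "(b, a) \<in> face_slots" "f' \<noteq> {w, v j a}" "f \<noteq> {w, v j a}" using ba by blast
      let ?C2 = "insert ?e1 ?C1" and ?B2 = "insert f' ?B1" and ?e2 = "{w, v j a}"
      note sl = slots[OF a(1)]
      show "force n ?Q ?C2 ?B2"
      proof (rule force_pos[OF f', of ?e2])
        show "2 * Suc (Suc ?c) + 1 < n choose 2" using c by simp
        show K2: "?e2 \<in> Kn_edges n" "?e2 \<notin> ?C2" "?e2 \<notin> ?B2"
          using wK[OF sl(2)] wC ne[of a 0] ne[OF sl(2,1,5)] sl j(2)[OF sl(2)] a by auto
        show "planar_graph {0..<n} (insert ?e2 ?C2)" by (rule planar[OF a(1)]) (use K0 K1 K2 BK in auto)
        fix f'' assume f'': "pos n (Suc (Suc (Suc ?c))) (insert ?e2 ?C2) (insert f'' ?B2)"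
        let ?C3 = "insert ?e2 ?C2" and ?B3 = "insert f'' ?B2"
        define t where "t = {v j 0, v j b, v j a}"
        have tF: "t \<in> F" and edges: "{v j 0, v j b} \<in> C" "{v j 0, v j a} \<in> C" "{v j b, v j a} \<in> C"
          using fc[OF j(1) a(1)] unfolding t_def by auto
        have dis: "v j 0 \<noteq> v j a" "v j 0 \<noteq> v j b" "v j a \<noteq> v j b"
          using inj[OF j(1) j(1), of 0 a] inj[OF j(1) j(1), of 0 b] inj[OF j(1) j(1), of a b] sl by auto
        define E' where "E' = E \<union> (\<lambda>u. {w, u}) ` t"
        define F' where "F' = (F - {t}) \<union> (\<lambda>u. insert w (t - {u})) ` t"
        obtain p' where d': "drawing (insert w U) E' p' F'"
          using drawing_insert[OF dr tF wn(2)] unfolding E'_def F'_def by blast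
        \<comment> \<open>\<open>w\<close> takes over the slot of the end \<open>a\<close>. The
          sector spanned by hub, middle vertex and \<open>w\<close> is empty and all its sides are
          claimed; the face at the other end of the path has not changed.\<close>
        define v' where "v' = v(j := (v j)(a := w))"
        have v'1: "v' j a = w" "\<And>m. m \<noteq> a \<Longrightarrow> v' j m = v j m" "\<And>j' m. j' \<noteq> j \<Longrightarrow> v' j' m = v j' m"
          by (auto simp: v'_def)
        have 1: "?C3 \<subseteq> E'" using CE unfolding E'_def t_def by auto
        have "insert w U \<inter> {..<n} = insert w (U \<inter> {..<n})" using wn by auto
        then have 2: "card (insert w U \<inter> {..<n}) \<le> 17 * M + Suc i" using cU wn by simp
        have 3: "v' j' m \<in> insert w U \<and> v' j' m < n" if "j' < M" "m < 7" for j' m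
          using v[OF that] wn by (auto simp: v'_def)
        have 4: "j1 = j2 \<and> m1 = m2" if h: "j1 < M" "j2 < M" "m1 < 7" "m2 < 7" "v' j1 m1 = v' j2 m2" for j1 j2 m1 m2
        proof -
          have "v j1 m1 \<noteq> w" "v j2 m2 \<noteq> w" using v h wn by auto
          then show ?thesis using h inj[OF h(1-4)] unfolding v'_def by (auto split: if_splits)
        qed
        have 5: "{v' j' 0, v' j' b', v' j' a'} \<in> F' \<and> {v' j' 0, v' j' b'} \<in> ?C3 \<and> {v' j' 0, v' j' a'} \<in> ?C3 \<and> {v' j' b', v' j' a'} \<in> ?C3"
          if h: "j' < M" "(b', a') \<in> face_slots" for j' b' a'
        proof -
          note s' = slots[OF h(2)]
          show ?thesis
          proof (cases "j' = j \<and> a' = a")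
            case True
            then have bb: "b' = b" using h(2) a(1) by (auto simp: face_slots_def)
            have v's: "v' j' 0 = v j 0" "v' j' b' = v j b" "v' j' a' = w" using True bb sl v'1 by auto
            have "insert w (t - {v j a}) = {v j 0, v j b, w}" unfolding t_def using dis by auto
            moreover have "insert w (t - {v j a}) \<in> F'" unfolding F'_def t_def by blast
            ultimately show ?thesis unfolding v's using edges by (auto simp: insert_commute)
          next
            case False
            have ab: "a \<noteq> b'" "a \<noteq> 0" using sl(7) s'(6) by auto
            have v's: "v' j' 0 = v j' 0" "v' j' b' = v j' b'" "v' j' a' = v j' a'" using False ab by (auto simp: v'_def)
            have "v j' a' \<notin> t"
            proof
              assume "v j' a' \<in> t"
              then obtain m where m: "m \<in> {0, b, a}" "v j' a' = v j m" unfolding t_def by blast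
              then have "m < 7" using sl by auto
              then have "j' = j \<and> a' = m" using inj[OF h(1) j(1) s'(2) _ m(2)] by blast
              then show False using False m(1) s'(4,7) sl(6) by auto
            qed
            then have "{v j' 0, v j' b', v j' a'} \<in> F'" unfolding F'_def using fc[OF h] by blast
            then show ?thesis unfolding v's using fc[OF h] by blast
          qed
        qed
        have "triangles C + 3 \<le> triangles ?C3"
          by (rule triangles_new_vertex[OF refl _ edges wC dis]) (use K0 K1 K2 BK in auto)
        then have 6: "3 * Suc i \<le> triangles ?C3" using tr by simp
        have "20 * M + 3 * Suc i = Suc (Suc (Suc ?c))" by simp
        then have ps': "pos n (20 * M + 3 * Suc i) ?C3 ?B3" using f'' by (simp only:)
        have "insertion_state n M (Suc i) ?C3 ?B3 (insert w U) E' p' F' v'"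
          unfolding insertion_state_def
        proof (intro conjI d' 1 ps' 2 6)
          show "\<forall>j<M. \<forall>m<7. v' j m \<in> insert w U \<and> v' j m < n" using 3 by simp
          show "\<forall>j<M. \<forall>j'<M. \<forall>m<7. \<forall>m'<7. v' j m = v' j' m' \<longrightarrow> j = j' \<and> m = m'"
            by (intro allI impI) (rule 4)
          show "\<forall>j<M. \<forall>(b, a)\<in>face_slots. {v' j 0, v' j b, v' j a} \<in> F' \<and>
            {v' j 0, v' j b} \<in> ?C3 \<and> {v' j 0, v' j a} \<in> ?C3 \<and> {v' j b, v' j a} \<in> ?C3"
            by (intro allI impI ballI case_prodI2, rule 5, assumption, simp)
        qed
        then show "force n ?Q ?C3 ?B3" by (intro force.base exI)
      qed
    qed
  qed
qed

lemma pathF_nth: "Suc i < length ls \<Longrightarrow> {x, ls ! i, ls ! Suc i} \<in> pathF x ls"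
proof (induction x ls arbitrary: i rule: pathF.induct)
  case (3 x a b l)
  then show ?case by (cases i) auto
qed auto

lemma distinct_concat_nth:
  assumes "distinct (concat xss)" "[] \<notin> set xss" "i < length xss" "j < length xss"
    "a < length (xss ! i)" "b < length (xss ! j)" "xss ! i ! a = xss ! j ! b"
  shows "i = j \<and> a = b"
proof -
  have d: "distinct xss" "\<And>ys. ys \<in> set xss \<Longrightarrow> distinct ys"
    "\<And>ys zs. ys \<in> set xss \<Longrightarrow> zs \<in> set xss \<Longrightarrow> ys \<noteq> zs \<Longrightarrow> set ys \<inter> set zs = {}"
    using assms(1,2) by (auto simp: distinct_concat_iff)
  have "xss ! i = xss ! j"
  proof (rule ccontr)
    assume "xss ! i \<noteq> xss ! j"
    then have "set (xss ! i) \<inter> set (xss ! j) = {}" using d(3) assms(3,4) by simp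
    then show False using assms(5-7) nth_mem by (metis disjoint_iff)
  qed
  moreover from this have "i = j" using d(1) assms(3,4) nth_eq_iff_index_eq by blast
  ultimately show ?thesis using d(2)[of "xss ! i"] assms nth_eq_iff_index_eq by (metis nth_mem)
qed

text \<open>The auxiliary corners are \<open>n\<close>, \<open>n + 1\<close>, \<open>n + 2\<close>,
  which lie outside the game and so do not count as used vertices. The slots are the hub followed by
  the first six leaves.\<close>

lemma gadgets_insertion_state:
  assumes "gadgets n M C B"
  shows "\<exists>U E p F v. insertion_state n M 0 C B U E p F v"
proof -
  obtain gs where gs: "length gs = M" "distinct (verts gs)" "set (verts gs) \<subseteq> {..<n}" "C \<subseteq> fans gs"
    "\<forall>g\<in>set gs. good C g" "pos n (20 * M) C B" using assms unfolding gadgets_def by blast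
  have "distinct [n, n + 1, n + 2]" "set (verts gs) \<inter> {n, n + 1, n + 2} = {}" using gs(3) by auto
  then obtain E p F where D: "drawing ({n, n + 1, n + 2} \<union> set (verts gs)) E p F"
    "fans gs \<subseteq> E" "\<forall>(x, ls)\<in>set gs. pathF x ls \<subseteq> F"
    using drawing_fans[OF gs(2)] by metis
  let ?U = "{n, n + 1, n + 2} \<union> set (verts gs)"
  define xss where "xss = map (\<lambda>(x, ls). x # ls) gs"
  define v where "v j m = xss ! j ! m" for j m
  have vs: "verts gs = concat xss" by (simp add: verts_def xss_def)
  have lx: "length xss = M" using gs(1) by (simp add: xss_def)
  have len: "length (xss ! j) = 17" if "j < M" for j
  proof -
    obtain x ls where g: "gs ! j = (x, ls)" by (cases "gs ! j")
    have "(x, ls) \<in> set gs" using g that gs(1) by (metis nth_mem)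
    then have "length ls = 16" using gs(5) by (auto simp: good_def)
    then show ?thesis using g gs(1) that by (simp add: xss_def)
  qed
  have "[] \<notin> set xss" by (auto simp: xss_def)
  note dn = distinct_concat_nth[OF gs(2)[unfolded vs] this]
  have inj: "j = j' \<and> m = m'" if "j < M" "j' < M" "m < 7" "m' < 7" "v j m = v j' m'" for j j' m m'
    using dn[of j j' m m'] that lx len by (simp add: v_def)
  have mem: "v j m \<in> set (verts gs)" if "j < M" "m < 7" for j m
    unfolding vs v_def using that lx len[OF that(1)] by (auto intro!: bexI[of _ "xss ! j"])
  have "?U \<inter> {..<n} = set (verts gs)" using gs(3) by auto
  then have cU: "card (?U \<inter> {..<n}) \<le> 17 * M + 0"
    using card_length[of "verts gs"] length_verts[OF gs(5)] gs(1) by simp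
  have fc: "{v j 0, v j b, v j a} \<in> F \<and> {v j 0, v j b} \<in> C \<and> {v j 0, v j a} \<in> C \<and> {v j b, v j a} \<in> C"
    if h: "j < M" "(b, a) \<in> face_slots" for j b a
  proof -
    obtain x ls where g: "gs ! j = (x, ls)" by (cases "gs ! j")
    have mem: "(x, ls) \<in> set gs" using h(1) gs(1) g by (metis nth_mem)
    have G: "length ls = 16" "spokes x ls \<subseteq> C" "{ls ! 0, ls ! 1} \<in> C" "{ls ! 1, ls ! 2} \<in> C" "{ls ! 3, ls ! 4} \<in> C" "{ls ! 4, ls ! 5} \<in> C"
      using gs(5) mem by (auto simp: good_def)
    have vm: "v j m = (x # ls) ! m" for m using h(1) gs(1) g by (simp add: v_def xss_def)
    have v0: "v j 0 = x" "v j 1 = ls ! 0" "v j 2 = ls ! 1" "v j 3 = ls ! 2" "v j 4 = ls ! 3" "v j 5 = ls ! 4" "v j 6 = ls ! 5"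
      unfolding vm by simp_all
    have sp: "{x, ls ! m} \<in> C" if "m < 16" for m using G(1,2) that by (auto simp: spokes_def)
    have fF: "{x, ls ! m, ls ! Suc m} \<in> F" if "Suc m < 16" for m
      using D(3) mem pathF_nth[of m ls x] G(1) that by auto
    have fF4: "{x, ls ! 0, ls ! 1} \<in> F" "{x, ls ! 1, ls ! 2} \<in> F" "{x, ls ! 3, ls ! 4} \<in> F" "{x, ls ! 4, ls ! 5} \<in> F"
      using fF[of 0] fF[of 1] fF[of 3] fF[of 4] by (simp_all add: numeral_eq_Suc)
    have sp5: "{x, ls ! 0} \<in> C" "{x, ls ! 1} \<in> C" "{x, ls ! 2} \<in> C" "{x, ls ! 3} \<in> C" "{x, ls ! 4} \<in> C" "{x, ls ! 5} \<in> C"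
      by (intro sp; simp)+
    consider "b = 2" "a = 1" | "b = 2" "a = 3" | "b = 5" "a = 4" | "b = 5" "a = 6" using h(2) by (auto simp: face_slots_def)
    then show ?thesis
      by cases (use v0 fF4 sp5 G(3-6) in \<open>simp_all add: insert_commute\<close>)
  qed
  have "insertion_state n M 0 C B ?U E p F v"
    unfolding insertion_state_def
  proof (intro conjI)
    show "drawing ?U E p F" by (rule D(1))
    show "C \<subseteq> E" using gs(4) D(2) by blast
    show "pos n (20 * M + 3 * 0) C B" using gs(6) by simp
    show "card (?U \<inter> {..<n}) \<le> 17 * M + 0" by (rule cU)
    show "\<forall>j<M. \<forall>m<7. v j m \<in> ?U \<and> v j m < n" using mem gs(3) by blast
    show "\<forall>j<M. \<forall>j'<M. \<forall>m<7. \<forall>m'<7. v j m = v j' m' \<longrightarrow> j = j' \<and> m = m'" using inj by blast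
    show "\<forall>j<M. \<forall>(b, a)\<in>face_slots. {v j 0, v j b, v j a} \<in> F \<and> {v j 0, v j b} \<in> C \<and> {v j 0, v j a} \<in> C \<and> {v j b, v j a} \<in> C"
      using fc by blast
  qed simp
  then show ?thesis by blast
qed

section \<open>The number of insertions and the limit\<close>

lemma force_insertions:
  assumes n: "100 \<le> n" "100 * M \<le> n" "1 \<le> M"
  shows "k \<le> n - 17 * M - (6 * n div M + 42) \<Longrightarrow>
    force n (\<lambda>C B. \<exists>U E p F v. insertion_state n M k C B U E p F v) {} {}"
proof (induction k)
  case 0
  show ?case
    by (rule force_trans[OF force_gadgets[OF n(1,2)]]) (intro force.base gadgets_insertion_state)
next
  case (Suc k)
  then have "force n (\<lambda>C B. \<exists>U E p F v. insertion_state n M k C B U E p F v) {} {}" by simp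
  then show ?case
  proof (rule force_trans)
    fix C B assume "\<exists>U E p F v. insertion_state n M k C B U E p F v"
    then obtain U E p F v where I: "insertion_state n M k C B U E p F v" by blast
    have kn: "k < n" using Suc.prems by simp
    have "6 * n = M * (6 * n div M) + 6 * n mod M" by simp
    moreover have "6 * n mod M < M" using n(3) by simp
    ultimately have "6 * n < M * (6 * n div M) + M" by linarith
    moreover have "6 * n div M + 43 \<le> n - 17 * M - k" using Suc.prems by linarith
    then have "M * (6 * n div M + 43) \<le> M * (n - 17 * M - k)" by (rule mult_le_mono2)
    then have "M * (6 * n div M) + 43 * M \<le> M * (n - 17 * M - k)" by (simp add: algebra_simps)
    ultimately have z: "6 * n + 42 * M < M * (n - 17 * M - k)" by simp
    have eq: "2 * (20 * M + 3 * k) = 40 * M + 6 * k" by simp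
    have "40 * M + 6 * k \<le> 6 * n + 42 * M" using kn by simp
    then have deg: "2 * (20 * M + 3 * k) < M * (n - 17 * M - k)" unfolding eq using z by (rule le_less_trans)
    have "40 * M + 6 * k + 5 < 49 * n" using n kn by simp
    then have "2 * (20 * M + 3 * k) + 5 < n choose 2" unfolding eq using choose_two_ge[OF n(1)] by (rule less_le_trans)
    from insertion_step[OF I deg this]
    show "force n (\<lambda>C B. \<exists>U E p F v. insertion_state n M (Suc k) C B U E p F v) C B" .
  qed
qed

lemma g_PCB_K3_ge:
  assumes "100 \<le> n" "100 * M \<le> n" "1 \<le> M"
  shows "3 * (n - 17 * M - (6 * n div M + 42)) \<le> g_PCB_K3 n"
  by (rule force_g_PCB_K3[OF force_insertions[OF assms order_refl]]) (auto simp: insertion_state_def)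

lemma g_PCB_K3_ratio_ge:
  assumes "100 \<le> n" "100 * M \<le> n" "1 \<le> M"
  shows "1 - 6 / real M - (17 * real M + 42) / real n \<le> real (g_PCB_K3 n) / (3 * real n)"
proof -
  have "real (6 * n div M * M) \<le> real (6 * n)" unfolding of_nat_le_iff by (rule div_times_less_eq_dividend)
  then have "real (6 * n div M) \<le> real (6 * n) / real M" using assms(3) by (simp add: pos_le_divide_eq)
  moreover have "real n - 17 * real M - (real (6 * n div M) + 42) \<le> real (n - 17 * M - (6 * n div M + 42))" by linarith
  moreover have "3 * real (n - 17 * M - (6 * n div M + 42)) \<le> real (g_PCB_K3 n)"
    using g_PCB_K3_ge[OF assms] by linarith
  ultimately have "3 * (real n - 17 * real M - (6 * real n / real M + 42)) \<le> real (g_PCB_K3 n)" by simp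
  then have "3 * (real n - 17 * real M - (6 * real n / real M + 42)) / (3 * real n) \<le> real (g_PCB_K3 n) / (3 * real n)"
    by (rule divide_right_mono) simp
  moreover have "3 * (real n - 17 * real M - (6 * real n / real M + 42)) / (3 * real n) = 1 - 6 / real M - (17 * real M + 42) / real n"
    using assms by (simp add: field_simps)
  ultimately show ?thesis by simp
qed

theorem theorem1p6:
  shows "(\<lambda>n. real (g_PCB_K3 n)) \<sim>[at_top] (\<lambda>n. 3 * real n)"
proof (rule asymp_equivI', rule LIMSEQ_I)
  fix r :: real assume r: "0 < r"
  \<comment> \<open>The tolerance \<open>r\<close> is split evenly: \<open>M\<close> makes 6/M
    smaller than r/2, and \<open>K\<close> then does the same for the term of order M/n.\<close>
  obtain M :: nat where M: "12 / r < real M" using reals_Archimedean2 by blast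
  then have M1: "1 \<le> M" using r by (cases M) (auto simp: field_simps)
  have M6: "6 / real M < r / 2" using M M1 r by (simp add: field_simps)
  obtain K :: nat where K: "2 * (17 * real M + 42) / r < real K" using reals_Archimedean2 by blast
  have "norm (real (g_PCB_K3 n) / (3 * real n) - 1) < r" if n: "max K (100 * M) \<le> n" for n
  proof -
    have n1: "100 \<le> n" "100 * M \<le> n" "real K \<le> real n" using n M1 by auto
    have "2 * (17 * real M + 42) / r < real n" using K n1(3) by linarith
    then have "(17 * real M + 42) / real n < r / 2" using n1(1) r by (simp add: field_simps)
    then have "1 - r < real (g_PCB_K3 n) / (3 * real n)" using g_PCB_K3_ratio_ge[OF n1(1,2) M1] M6 by linarith
    moreover have "real (g_PCB_K3 n) \<le> 3 * real n" using g_PCB_K3_le[of n] by linarith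
    then have "real (g_PCB_K3 n) / (3 * real n) \<le> 1" using n1(1) by (simp add: divide_le_eq)
    ultimately show ?thesis using r by (simp add: abs_less_iff)
  qed
  then show "\<exists>no. \<forall>n\<ge>no. norm (real (g_PCB_K3 n) / (3 * real n) - 1) < r" by blast
qed

end
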